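(* Let $\Delta$ be a complete simplicial multi-fan in a lattice $L$ of rank $n$ and $\mathcal V=\{v_i\}_{i\in\Sigma^{(1)}}$ a set of generating edge vectors. Let $N>1$ be an integer. If $c_1(\Delta,\mathcal V)$ is $T$-Cartier divisible by $N$, then the orbifold elliptic genus $\hat\varphi(\Delta,\mathcal V;\tau,\sigma)$ of level $N$ (i.e. with $\sigma=\frac kN$, $0<k<N$) vanishes identically.
   Context: Multi-fans. Let $L$ be a lattice of rank $n$, $L_{\mathbb R}=L\otimes\mathbb R$, $L^*=\mathrm{Hom}(L,\mathbb Z)$, and $\langle\cdot,\cdot\rangle$ the dual pairing. An $n$-dimensional simplicial multi-fan in $L$ is a triple $\Delta=(\Sigma,C,w^\pm)$, where: $\Sigma$ is a finite abstract simplicial complex with the empty simplex included; $\Sigma^{(k)}$ is the set of simplices with exactly $k$ elements (so $\Sigma^{(0)}=\{\emptyset\}$, and a vertex $i$ is identified with $\{i\}\in\Sigma^{(1)}$); $\Sigma=\bigsqcup_{k=0}^n\Sigma^{(k)}$, $\Sigma^{(n)}\neq\emptyset$, and every simplex is contained in an element of $\Sigma^{(n)}$; $C$ assigns to each $I\in\Sigma^{(k)}$ a $k$-dimensional strongly convex rational polyhedral cone $C(I)\subset L_{\mathbb R}$ such that $C(J)$ is a face of $C(I)$ whenever $J$ is a face of $I$ (so $C(I)$ is spanned by the rays $C(i)$, $i\in I$); and $w^\pm:\Sigma^{(n)}\to\mathbb Z_{\ge0}$ are functions, with $w=w^+-w^-$. A vector $v\in L_{\mathbb R}$ is generic if it lies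 on no linear subspace spanned by a cone $C(J)$ of dimension less than $n$. $\Delta$ is pre-complete if $d_v=\sum_{I\in\Sigma^{(n)},\,v\in C(I)}w(I)$ is independent of the generic vector $v$; this integer is $\deg(\Delta)$. For $K\in\Sigma$, let $\Sigma_K=\{J\in\Sigma: K\subset J\}$, let $L^K$ be the image of $L$ in $L_{\mathbb R}/\mathrm{span}\,C(K)$, let $C_K(J)$ be the projection of $C(J)$, and let $w_K^\pm$ be the restriction of $w^\pm$ to $\Sigma_K^{(n-|K|)}=\{I\in\Sigma^{(n)}:K\subset I\}$; then $\Delta_K=(\Sigma_K,C_K,w_K^\pm)$ is the projected multi-fan in $L^K$. $\Delta$ is complete if $\Delta_K$ is pre-complete for all $K\in\Sigma$. Edge vectors. $\mathcal V=\{v_i\}_{i\in\Sigma^{(1)}}$ with $v_i\in L$ generating the ray $C(i)$, not necessarily primitive (but if $\Delta$ is non-singular, i.e. the primitive generators of the rays $C(i)$, $i\in I$, form a basis of $L$ for every $I\in\Sigma^{(n)}$, the $v_i$ are assumed primitive). For $I\in\Sigma^{(n)}$, $L_{I,\mathcal V}$ is the sublattice of $L$ generated by $\{v_i\}_{i\in I}$, $H_I=L/L_{I,\mathcal V}$, and $\{u_i^I\}_{i\in I}\subset L_{\mathbb R}^*$ is the basis dual to $\{v_i\}_{i\in I}$. $L_{\mathcal V}=\bigcap_{I\in\Sigma^{(n)}}L_{I,\mathcal V}$. Chern class. $H_T^2(\Delta)$ is the free abelian group on symbols $x_i$, $i\in\Sigma^{(1)}$ (degree-two part of the face ring of $\Sigma$),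 and $L^*=H^2(BT)$ is embedded in it by $u\mapsto\sum_i\langle u,v_i\rangle x_i$. For $I\in\Sigma^{(n)}$ the homomorphism $\iota_I^*:H_T^2(\Delta)\to L_{\mathbb R}^*$ is given by $\iota_I^*(x_i)=u_i^I$ if $i\in I$ and $0$ if $i\notin I$. An element $x\in H_T^2(\Delta)$ is $T$-Cartier if $\iota_I^*(x)\in L^*$ for every $I\in\Sigma^{(n)}$. $c_1^T(\Delta,\mathcal V)=\sum_{i\in\Sigma^{(1)}}x_i$, and $c_1(\Delta,\mathcal V)$ is its image in $H_T^2(\Delta)/L^*$. $c_1(\Delta,\mathcal V)$ is $T$-Cartier divisible by $N$ if $c_1^T(\Delta,\mathcal V)=Nx+u$ for some $T$-Cartier $x\in H_T^2(\Delta)$ and some $u\in L^*$. Orbifold elliptic genus. For $z,\sigma\in\mathbb C$ and $\tau$ in the upper half plane put $t=e^{2\pi\sqrt{-1}z}$, $q=e^{2\pi\sqrt{-1}\tau}$, $\zeta=e^{2\pi\sqrt{-1}\sigma}$ (with $\zeta^{a}=e^{2\pi\sqrt{-1}a\sigma}$ for $a\in\mathbb Q$) and $$\phi(z,\tau,\sigma)=\zeta^{-\frac12}\frac{1-\zeta t}{1-t}\prod_{m=1}^\infty\frac{(1-\zeta tq^m)(1-\zeta^{-1}t^{-1}q^m)}{(1-tq^m)(1-t^{-1}q^m)}.$$ For generic $v\in L_{\mathcal V}$, $$\hat\varphi^v(\Delta,\mathcal V;z,\tau,\sigma)=\sum_{I\in\Sigma^{(n)}}\frac{w(I)}{|H_I|}\sum_{(h_1,h_2)\in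 H_I\times H_I}\prod_{i\in I}\zeta^{\langle u_i^I,v(h_1)\rangle}\,\phi(-\langle u_i^I,zv-\tau v(h_1)+v(h_2)\rangle,\tau,\sigma),$$ where $v(h)\in L$ denotes a representative of $h$ (the result is independent of representatives). The orbifold elliptic genus $\hat\varphi(\Delta,\mathcal V;\tau,\sigma)$ is the formal power series in $q$ whose coefficients are (up to the factor $\zeta^{-n/2}$) finite linear combinations, with coefficients in $\mathbb Z[\zeta^{1/r},\zeta^{-1/r}]$ ($r$ the least common multiple of the $|H_I|$), of characters $t^u$, $u\in L^*$, of the torus $T=L_{\mathbb R}/L$, determined by $v^*(\hat\varphi(\Delta,\mathcal V))=\hat\varphi^v(\Delta,\mathcal V)$ for all generic $v\in L_{\mathcal V}$, where $v^*(t^u)=t^{\langle u,v\rangle}$. It vanishes identically if and only if $\hat\varphi^v(\Delta,\mathcal V;z,\tau,\sigma)\equiv0$ for all generic $v\in L_{\mathcal V}$. *)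

theory Defs
  imports
    "HOL-Analysis.Analysis"
    "HOL-Library.Poly_Mapping"
    "HOL-Computational_Algebra.Formal_Power_Series"
    "HOL-Computational_Algebra.Group_Closure"
begin

section \<open>Lattices\<close>

text \<open>
  The real vector space $L_{\mathbb R}$ is the type \<open>'a\<close>, so that the rank $n$ of $L$ is
  \<open>DIM('a)\<close>, an arbitrary positive integer.  Only the vector space structure of \<open>'a\<close> is used;
  the dual space consists of linear functionals.
\<close>

definition full_lattice :: "'a::euclidean_space set \<Rightarrow> bool" where
  "full_lattice L \<longleftrightarrow> (\<exists>B. independent B \<and> span B = UNIV \<and> L = group_closure B)"

definition dual_lattice :: "'a::euclidean_space set \<Rightarrow> ('a \<Rightarrow> real) set" where
  "dual_lattice L = {u. linear u \<and> u ` L \<subseteq> \<int>}"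

definition coset :: "'a::ab_group_add set \<Rightarrow> 'a \<Rightarrow> 'a set" where
  "coset W x = (\<lambda>y. x + y) ` W"

definition primitive_in :: "'a::euclidean_space set \<Rightarrow> 'a \<Rightarrow> bool" where
  "primitive_in L p \<longleftrightarrow> p \<in> L \<and> p \<noteq> 0 \<and>
     (\<forall>(m::int). \<forall>x\<in>L. p = of_int m *\<^sub>R x \<longrightarrow> \<bar>m\<bar> = 1)"

section \<open>Multi-fans\<close>

record ('i, 'a) multi_fan =
  simps :: "'i set set"
  cone_of :: "'i set \<Rightarrow> 'a set"
  wplus :: "'i set \<Rightarrow> nat"
  wminus :: "'i set \<Rightarrow> nat"

definition ksimps :: "('i, 'a) multi_fan \<Rightarrow> nat \<Rightarrow> 'i set set" where
  "ksimps \<Delta> k = {I \<in> simps \<Delta>. card I = k}"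

definition verts :: "('i, 'a) multi_fan \<Rightarrow> 'i set" where
  "verts \<Delta> = {i. {i} \<in> simps \<Delta>}"

definition top_simps :: "('i, 'a::euclidean_space) multi_fan \<Rightarrow> 'i set set" where
  "top_simps \<Delta> = ksimps \<Delta> DIM('a)"

definition weight :: "('i, 'a) multi_fan \<Rightarrow> 'i set \<Rightarrow> int" where
  "weight \<Delta> I = int (wplus \<Delta> I) - int (wminus \<Delta> I)"

definition rational_polyhedral_cone :: "'a::euclidean_space set \<Rightarrow> 'a set \<Rightarrow> bool" where
  "rational_polyhedral_cone L S \<longleftrightarrow> (\<exists>G. finite G \<and> G \<subseteq> L \<and> S = convex_cone hull G)"

definition strongly_convex :: "'a::euclidean_space set \<Rightarrow> bool" where
  "strongly_convex S \<longleftrightarrow> S \<inter> uminus ` S = {0}"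

text \<open>
  That \<open>C(I)\<close> is spanned by the rays \<open>C(i)\<close>, \<open>i \<in> I\<close>, is required separately: it does not
  follow from the condition on faces when two vertices of \<open>I\<close> are given the same ray.
\<close>

definition simplicial_multi_fan ::
  "'a::euclidean_space set \<Rightarrow> ('i, 'a) multi_fan \<Rightarrow> bool" where
  "simplicial_multi_fan L \<Delta> \<longleftrightarrow>
     finite (simps \<Delta>) \<and> {} \<in> simps \<Delta> \<and>
     (\<forall>I\<in>simps \<Delta>. finite I \<and> card I \<le> DIM('a) \<and> (\<forall>J. J \<subseteq> I \<longrightarrow> J \<in> simps \<Delta>)) \<and>
     top_simps \<Delta> \<noteq> {} \<and>
     (\<forall>J\<in>simps \<Delta>. \<exists>I\<in>top_simps \<Delta>. J \<subseteq> I) \<and>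
     (\<forall>I\<in>simps \<Delta>.
        rational_polyhedral_cone L (cone_of \<Delta> I) \<and>
        strongly_convex (cone_of \<Delta> I) \<and>
        dim (cone_of \<Delta> I) = card I \<and>
        cone_of \<Delta> I = convex_cone hull (\<Union>i\<in>I. cone_of \<Delta> {i}) \<and>
        (\<forall>J. J \<subseteq> I \<longrightarrow> cone_of \<Delta> J face_of cone_of \<Delta> I))"

text \<open>A vector that is generic for the whole multi-fan.\<close>

definition generic :: "('i, 'a::euclidean_space) multi_fan \<Rightarrow> 'a \<Rightarrow> bool" where
  "generic \<Delta> v \<longleftrightarrow>
     (\<forall>J\<in>simps \<Delta>. dim (cone_of \<Delta> J) < DIM('a) \<longrightarrow> v \<notin> span (cone_of \<Delta> J))"

subsection \<open>Projected multi-fans and completeness\<close>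

text \<open>
  The quotient of \<open>L\<^sub>\<real>\<close> by the span \<open>W\<close> of \<open>C(K)\<close> is the set of cosets \<open>range (coset W)\<close>.  The
  linear subspace of the quotient spanned by a projected cone is the image of the span of that cone,
  and the projection of \<open>C(J)\<close> with \<open>K \<subseteq> J\<close> has dimension \<open>|J| - |K|\<close>, so it is of dimension less
  than \<open>n - |K|\<close> exactly when \<open>dim C(J) < n\<close>.  For \<open>K = {}\<close> the subspace \<open>W\<close> is zero and one gets
  back the multi-fan itself.
\<close>

definition proj :: "('i, 'a::euclidean_space) multi_fan \<Rightarrow> 'i set \<Rightarrow> 'a \<Rightarrow> 'a set" where
  "proj \<Delta> K = coset (span (cone_of \<Delta> K))"

definition proj_generic ::
  "('i, 'a::euclidean_space) multi_fan \<Rightarrow> 'i set \<Rightarrow> 'a set \<Rightarrow> bool" where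
  "proj_generic \<Delta> K c \<longleftrightarrow>
     c \<in> range (proj \<Delta> K) \<and>
     (\<forall>J\<in>simps \<Delta>. K \<subseteq> J \<and> dim (cone_of \<Delta> J) < DIM('a) \<longrightarrow> c \<notin> proj \<Delta> K ` span (cone_of \<Delta> J))"

definition proj_degree_at ::
  "('i, 'a::euclidean_space) multi_fan \<Rightarrow> 'i set \<Rightarrow> 'a set \<Rightarrow> int" where
  "proj_degree_at \<Delta> K c =
     (\<Sum>I | I \<in> top_simps \<Delta> \<and> K \<subseteq> I \<and> c \<in> proj \<Delta> K ` cone_of \<Delta> I. weight \<Delta> I)"

definition proj_pre_complete ::
  "('i, 'a::euclidean_space) multi_fan \<Rightarrow> 'i set \<Rightarrow> bool" where
  "proj_pre_complete \<Delta> K \<longleftrightarrow> (\<exists>d. \<forall>c. proj_generic \<Delta> K c \<longrightarrow> proj_degree_at \<Delta> K c = d)"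

definition complete_multi_fan :: "('i, 'a::euclidean_space) multi_fan \<Rightarrow> bool" where
  "complete_multi_fan \<Delta> \<longleftrightarrow> (\<forall>K\<in>simps \<Delta>. proj_pre_complete \<Delta> K)"

section \<open>Edge vectors\<close>

definition nonsingular :: "'a::euclidean_space set \<Rightarrow> ('i, 'a) multi_fan \<Rightarrow> bool" where
  "nonsingular L \<Delta> \<longleftrightarrow>
     (\<forall>I\<in>top_simps \<Delta>. \<exists>p.
        (\<forall>i\<in>I. primitive_in L (p i) \<and> cone_of \<Delta> {i} = convex_cone hull {p i}) \<and>
        inj_on p I \<and> independent (p ` I) \<and> group_closure (p ` I) = L)"

definition edge_vectors ::
  "'a::euclidean_space set \<Rightarrow> ('i, 'a) multi_fan \<Rightarrow> ('i \<Rightarrow> 'a) \<Rightarrow> bool" where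
  "edge_vectors L \<Delta> V \<longleftrightarrow>
     (\<forall>i\<in>verts \<Delta>. V i \<in> L \<and> cone_of \<Delta> {i} = convex_cone hull {V i}) \<and>
     (nonsingular L \<Delta> \<longrightarrow> (\<forall>i\<in>verts \<Delta>. primitive_in L (V i)))"

definition edge_lattice :: "('i \<Rightarrow> 'a::euclidean_space) \<Rightarrow> 'i set \<Rightarrow> 'a set" where
  "edge_lattice V I = group_closure (V ` I)"

definition quot_group ::
  "'a::euclidean_space set \<Rightarrow> ('i \<Rightarrow> 'a) \<Rightarrow> 'i set \<Rightarrow> 'a set set" where
  "quot_group L V I = coset (edge_lattice V I) ` L"

definition common_lattice ::
  "('i, 'a::euclidean_space) multi_fan \<Rightarrow> ('i \<Rightarrow> 'a) \<Rightarrow> 'a set" where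
  "common_lattice \<Delta> V = (\<Inter>I\<in>top_simps \<Delta>. edge_lattice V I)"

text \<open>The vector \<open>u\<^sub>i\<^sup>I\<close> of the basis dual to \<open>V i\<close>, \<open>i \<in> I\<close>.\<close>

definition dual_basis ::
  "('i \<Rightarrow> 'a::euclidean_space) \<Rightarrow> 'i set \<Rightarrow> 'i \<Rightarrow> 'a \<Rightarrow> real" where
  "dual_basis V I i = (THE u. linear u \<and> (\<forall>j\<in>I. u (V j) = (if j = i then 1 else 0)))"

section \<open>The first Chern class\<close>

definition H2T :: "('i, 'a) multi_fan \<Rightarrow> ('i \<Rightarrow>\<^sub>0 int) set" where
  "H2T \<Delta> = {x. Poly_Mapping.keys x \<subseteq> verts \<Delta>}"

text \<open>The floor is exact here, since \<open>u\<close> takes integral values on the edge vectors.\<close>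

definition embed_dual ::
  "('i, 'a::euclidean_space) multi_fan \<Rightarrow> ('i \<Rightarrow> 'a) \<Rightarrow> ('a \<Rightarrow> real) \<Rightarrow> ('i \<Rightarrow>\<^sub>0 int)" where
  "embed_dual \<Delta> V u = (\<Sum>i\<in>verts \<Delta>. frag_cmul \<lfloor>u (V i)\<rfloor> (frag_of i))"

definition restrict_to ::
  "('i \<Rightarrow> 'a::euclidean_space) \<Rightarrow> 'i set \<Rightarrow> ('i \<Rightarrow>\<^sub>0 int) \<Rightarrow> 'a \<Rightarrow> real" where
  "restrict_to V I x = (\<lambda>y. \<Sum>i\<in>I. of_int (Poly_Mapping.lookup x i) * dual_basis V I i y)"

definition T_Cartier ::
  "'a::euclidean_space set \<Rightarrow> ('i, 'a) multi_fan \<Rightarrow> ('i \<Rightarrow> 'a) \<Rightarrow> ('i \<Rightarrow>\<^sub>0 int) \<Rightarrow> bool" where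
  "T_Cartier L \<Delta> V x \<longleftrightarrow>
     x \<in> H2T \<Delta> \<and> (\<forall>I\<in>top_simps \<Delta>. restrict_to V I x \<in> dual_lattice L)"

definition c1T :: "('i, 'a) multi_fan \<Rightarrow> ('i \<Rightarrow>\<^sub>0 int)" where
  "c1T \<Delta> = (\<Sum>i\<in>verts \<Delta>. frag_of i)"

definition c1_T_Cartier_divisible ::
  "'a::euclidean_space set \<Rightarrow> ('i, 'a) multi_fan \<Rightarrow> ('i \<Rightarrow> 'a) \<Rightarrow> nat \<Rightarrow> bool" where
  "c1_T_Cartier_divisible L \<Delta> V N \<longleftrightarrow>
     (\<exists>x u. T_Cartier L \<Delta> V x \<and> u \<in> dual_lattice L \<and>
        c1T \<Delta> = frag_cmul (int N) x + embed_dual \<Delta> V u)"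

section \<open>The orbifold elliptic genus\<close>

definition ex :: "complex \<Rightarrow> complex" where
  "ex z = exp (2 * of_real pi * \<i> * z)"

definition phi :: "complex \<Rightarrow> complex \<Rightarrow> complex \<Rightarrow> complex" where
  "phi z \<tau> \<sigma> =
     (let t = ex z; q = ex \<tau>; s = ex \<sigma> in
      ex (- \<sigma> / 2) * ((1 - s * t) / (1 - t)) *
      prodinf (\<lambda>m. ((1 - s * t * q ^ Suc m) * (1 - inverse s * inverse t * q ^ Suc m)) /
                   ((1 - t * q ^ Suc m) * (1 - inverse t * q ^ Suc m))))"

definition rep :: "'a set \<Rightarrow> 'a" where
  "rep h = (SOME x. x \<in> h)"

text \<open>The pairing of \<open>- u\<^sub>i\<^sup>I\<close> with \<open>z v - \<tau> v(h\<^sub>1) + v(h\<^sub>2)\<close>, extended complex linearly.\<close>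

definition genus_arg ::
  "('i \<Rightarrow> 'a::euclidean_space) \<Rightarrow> 'a \<Rightarrow> complex \<Rightarrow> complex \<Rightarrow>
     'i set \<Rightarrow> 'a set \<Rightarrow> 'a set \<Rightarrow> 'i \<Rightarrow> complex" where
  "genus_arg V v z \<tau> I h1 h2 i =
     - (z * of_real (dual_basis V I i v)
        - \<tau> * of_real (dual_basis V I i (rep h1))
        + of_real (dual_basis V I i (rep h2)))"

definition genus_along ::
  "'a::euclidean_space set \<Rightarrow> ('i, 'a) multi_fan \<Rightarrow> ('i \<Rightarrow> 'a) \<Rightarrow> 'a \<Rightarrow>
     complex \<Rightarrow> complex \<Rightarrow> complex \<Rightarrow> complex" where
  "genus_along L \<Delta> V v z \<tau> \<sigma> =
     (\<Sum>I\<in>top_simps \<Delta>. of_int (weight \<Delta> I) / of_nat (card (quot_group L V I)) *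
        (\<Sum>(h1, h2)\<in>quot_group L V I \<times> quot_group L V I.
           \<Prod>i\<in>I. ex (of_real (dual_basis V I i (rep h1)) * \<sigma>) *
                 phi (genus_arg V v z \<tau> I h1 h2 i) \<tau> \<sigma>))"

text \<open>
  The poles of \<open>phi\<close> in its first variable are at the points \<open>a + b \<tau>\<close> with \<open>a\<close>, \<open>b\<close> integers,
  where division by zero makes the value of the formal expression meaningless.
\<close>

definition genus_regular ::
  "'a::euclidean_space set \<Rightarrow> ('i, 'a) multi_fan \<Rightarrow> ('i \<Rightarrow> 'a) \<Rightarrow> 'a \<Rightarrow>
     complex \<Rightarrow> complex \<Rightarrow> bool" where
  "genus_regular L \<Delta> V v z \<tau> \<longleftrightarrow>
     (\<forall>I\<in>top_simps \<Delta>. \<forall>h1\<in>quot_group L V I. \<forall>h2\<in>quot_group L V I. \<forall>i\<in>I.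
        \<forall>a b :: int. genus_arg V v z \<tau> I h1 h2 i \<noteq> of_int a + of_int b * \<tau>)"

text \<open>
  A finite linear combination of characters \<open>t\<^sup>u\<close>, \<open>u\<close> in the dual lattice, is a finitely supported
  function on functionals; its pullback along \<open>v\<close> replaces \<open>t\<^sup>u\<close> by \<open>t\<close> to the power \<open>u v\<close>.
\<close>

definition pullback_char ::
  "'a::euclidean_space \<Rightarrow> (('a \<Rightarrow> real) \<Rightarrow>\<^sub>0 complex) \<Rightarrow> complex \<Rightarrow> complex" where
  "pullback_char v c z =
     (\<Sum>u\<in>Poly_Mapping.keys c. Poly_Mapping.lookup c u * ex (of_real (u v) * z))"

text \<open>
  \<open>G\<close> is a power series in \<open>q\<close> with such coefficients whose pullback along every generic \<open>v\<close> in
  the common sublattice is the \<open>q\<close>-expansion of \<open>genus_along\<close>.  For fixed \<open>z\<close> that expansion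
  converges for small \<open>q\<close>, that is, for \<open>Im \<tau>\<close> large (depending on \<open>v\<close> and \<open>z\<close>).
\<close>

definition is_orbifold_genus ::
  "'a::euclidean_space set \<Rightarrow> ('i, 'a) multi_fan \<Rightarrow> ('i \<Rightarrow> 'a) \<Rightarrow> complex \<Rightarrow>
     (('a \<Rightarrow> real) \<Rightarrow>\<^sub>0 complex) fps \<Rightarrow> bool" where
  "is_orbifold_genus L \<Delta> V \<sigma> G \<longleftrightarrow>
     (\<forall>m. Poly_Mapping.keys (fps_nth G m) \<subseteq> dual_lattice L) \<and>
     (\<forall>v\<in>common_lattice \<Delta> V. generic \<Delta> v \<longrightarrow>
        (\<forall>z. \<exists>R>0. \<forall>\<tau>. Im \<tau> > R \<and> genus_regular L \<Delta> V v z \<tau> \<longrightarrow>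
           (\<lambda>m. pullback_char v (fps_nth G m) z * ex \<tau> ^ m) sums genus_along L \<Delta> V v z \<tau> \<sigma>))"

definition orbifold_genus ::
  "'a::euclidean_space set \<Rightarrow> ('i, 'a) multi_fan \<Rightarrow> ('i \<Rightarrow> 'a) \<Rightarrow> complex \<Rightarrow>
     (('a \<Rightarrow> real) \<Rightarrow>\<^sub>0 complex) fps" where
  "orbifold_genus L \<Delta> V \<sigma> = (THE G. is_orbifold_genus L \<Delta> V \<sigma> G)"

end

theory Submission
  imports Defs "HOL-Complex_Analysis.Complex_Analysis"
begin

text \<open>
  For \<open>\<sigma> = k / N\<close> the function \<open>F(w) = \<Sum>\<^sub>I w(I) / |H\<^sub>I| \<Sum> \<Prod>\<^sub>i \<zeta>\<^bsup>u\<^sub>i(h\<^sub>1)\<^esup> \<phi>(- u\<^sub>i(w) + \<tau> u\<^sub>i(h\<^sub>1) - u\<^sub>i(h\<^sub>2))\<close> of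
  \<open>w \<in> L\<^sub>\<complex>\<close> is studied on complex affine lines with direction in \<open>L\<close>, where \<open>u\<^sub>i = u\<^sub>i\<^sup>I\<close>.  Cartier divisibility gives
  \<open>\<Sum>\<^sub>i u\<^sub>i\<^sup>I = N \<iota>\<^sub>I(x) + u\<close> with \<open>\<iota>\<^sub>I(x)\<close> integral on \<open>L\<close>, so that shifting \<open>w\<close> by \<open>y\<close> or \<open>\<tau> y\<close>, \<open>y \<in> L\<close>, only
  permutes the classes \<open>h\<^sub>2\<close> or \<open>h\<^sub>1\<close> and multiplies \<open>F\<close> by \<open>1\<close> or \<open>\<zeta>\<^bsup>u(y)\<^esup>\<close>, independently of \<open>I\<close>.  On a generic
  line no summand has poles in two factors at once; the summands of the maximal simplices
  \<open>I\<close> around a wall \<open>J\<close> have the same residue up to the factor \<open>w(I) / (|H\<^sub>I| u\<^sub>i\<^sup>I(y))\<close>, which is \<open>\<plusminus> w(I)\<close> times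
  a constant, and completeness of the projected multi-fan of \<open>J\<close> makes the sum zero.  Hence \<open>F\<close> is entire on
  the line, bounded by double quasi-periodicity, constant by Liouville, and zero as soon as
  \<open>\<zeta>\<^bsup>u(y)\<^esup> \<noteq> 1\<close>; such \<open>y\<close> exist because \<open>u(v\<^sub>i) = 1\<close> modulo \<open>N\<close>.  Generic lines are dense, so \<open>F\<close>
  vanishes at every regular point.
\<close>

section \<open>Theta functions\<close>

text \<open>Along \<open>v\<close> itself, \<open>F\<close> cannot be treated as a function of
  \<open>z\<close> alone. Several factors of one summand may have a pole at the same
  \<open>z\<close>, so poles of higher order can appear; and \<open>u v\<close> may be divisible by
  \<open>N\<close>, in which case the multiplier is 1 and Liouville yields only a constant. Both
  obstacles disappear once \<open>z v\<close> is regarded as a point of the complexified space: a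
  line through it may have another direction \<open>v'\<close>, with \<open>u v'\<close> congruent
  to 1 modulo \<open>N\<close>, and a small real shift \<open>c\<close> separates the poles. Around
  a wall, Cartier divisibility is used a second time: at a pole the exponential factors of a summand
  merge into \<open>ex (u h1 * \<sigma>)\<close>, which no longer refers to the maximal simplex. The
  order of \<open>H_I\<close> is inversely proportional to the height of \<open>v'\<close> over the
  wall, so the two cancel up to a sign. The genus is given by a definite description. Vanishing of
  \<open>genus_along\<close> shows that the zero series satisfies it, without any
  \<open>q\<close>-expansion being computed; what remains is uniqueness.\<close>

lemma ex_add: "ex (x + y) = ex x * ex y"
  by (simp add: ex_def exp_add ring_distribs)

lemma ex_minus: "ex (- x) = inverse (ex x)"
  by (simp add: ex_def exp_minus)

lemma ex_diff: "ex (x - y) = ex x * inverse (ex y)"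
  by (metis diff_conv_add_uminus ex_add ex_minus)

lemma ex_of_nat_mult: "ex (of_nat n * x) = ex x ^ n"
  by (simp add: ex_def exp_of_nat_mult[symmetric] mult_ac)

lemma ex_0 [simp]: "ex 0 = 1"
  by (simp add: ex_def)

lemma ex_nonzero [simp]: "ex x \<noteq> 0"
  by (simp add: ex_def)

lemma ex_sum: "finite A \<Longrightarrow> ex (\<Sum>i\<in>A. f i) = (\<Prod>i\<in>A. ex (f i))"
  by (induction A rule: finite_induct) (auto simp: ex_add)

lemma ex_eq_1_iff: "ex x = 1 \<longleftrightarrow> x \<in> \<int>"
proof
  assume "ex x = 1"
  then obtain n :: int where n: "Im (2 * of_real pi * \<i> * x) = of_int (2 * n) * pi"
      "Re (2 * of_real pi * \<i> * x) = 0"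
    unfolding ex_def exp_eq_1 by auto
  then have "Re x = of_int n" "Im x = 0"
    by auto
  then have "x = of_int n"
    by (simp add: complex_eq_iff)
  then show "x \<in> \<int>" by simp
next
  assume "x \<in> \<int>"
  then obtain n :: int where "x = of_int n" by (auto elim: Ints_cases)
  then show "ex x = 1"
    unfolding ex_def exp_eq_1 by (auto intro!: exI[of _ n])
qed

lemma ex_of_int [simp]: "ex (of_int n) = 1"
  by (simp add: ex_eq_1_iff)

lemma ex_1 [simp]: "ex 1 = 1"
  by (simp add: ex_eq_1_iff)

lemma norm_ex: "norm (ex z) = exp (- 2 * pi * Im z)"
  by (simp add: ex_def)

lemma norm_ex_less_1: "Im z > 0 \<Longrightarrow> norm (ex z) < 1"
  by (simp add: norm_ex)

lemma ex_holomorphic [holomorphic_intros]: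
  "f holomorphic_on A \<Longrightarrow> (\<lambda>z. ex (f z)) holomorphic_on A"
  unfolding ex_def by (intro holomorphic_intros)

text \<open>The infinite q-Pochhammer symbol \<open>(x q; q)\<close>. Exponents start at 1, which
  leaves the factor \<open>1 - x\<close> to \<open>theta\<close>.\<close>

definition qprod :: "complex \<Rightarrow> complex \<Rightarrow> complex" where
  "qprod q x = prodinf (\<lambda>m. 1 - x * q ^ Suc m)"

lemma qprod_convergent:
  fixes q x :: complex
  assumes "norm q < 1"
  shows "convergent_prod (\<lambda>m. 1 - x * q ^ Suc m)"
proof (intro abs_convergent_prod_imp_convergent_prod summable_imp_abs_convergent_prod)
  have "summable (\<lambda>m. norm (x * q) * norm q ^ m)"
    using assms by (intro summable_mult summable_geometric) auto
  then show "summable (\<lambda>m. norm (1 - x * q ^ Suc m - 1))"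
    by (simp add: norm_mult norm_power mult_ac)
qed

lemma qprod_LIMSEQ:
  assumes "norm q < 1"
  shows "(\<lambda>n. \<Prod>m<n. 1 - x * q ^ Suc m) \<longlonglongrightarrow> qprod q x"
  using convergent_prod_LIMSEQ[OF qprod_convergent[OF assms]]
  unfolding qprod_def LIMSEQ_lessThan_iff_atMost .

lemma qprod_shift:
  assumes "norm q < 1"
  shows "qprod q x = (1 - x * q) * qprod q (x * q)"
proof (rule LIMSEQ_unique)
  show "(\<lambda>n. \<Prod>m<Suc n. 1 - x * q ^ Suc m) \<longlonglongrightarrow> qprod q x"
    using qprod_LIMSEQ[OF assms] by (rule LIMSEQ_Suc)
  have "(\<Prod>m<Suc n. 1 - x * q ^ Suc m) = (1 - x * q) * (\<Prod>m<n. 1 - (x * q) * q ^ Suc m)" for n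
    by (subst prod.lessThan_Suc_shift) (simp add: mult_ac)
  then show "(\<lambda>n. \<Prod>m<Suc n. 1 - x * q ^ Suc m) \<longlonglongrightarrow> (1 - x * q) * qprod q (x * q)"
    using tendsto_mult_left[OF qprod_LIMSEQ[OF assms, of "x * q"], of "1 - x * q"] by simp
qed

lemma qprod_eq_0D:
  assumes "norm q < 1" "qprod q x = 0"
  shows "\<exists>m. x * q ^ Suc m = 1"
  using prodinf_nonzero[OF qprod_convergent[OF assms(1), of x]] assms(2)
  unfolding qprod_def by auto

text \<open>The partial products converge uniformly on unit discs, by comparison with the geometric
  series of \<open>norm q\<close>.\<close>

lemma qprod_holomorphic:
  assumes "norm q < 1"
  shows "qprod q holomorphic_on UNIV"
proof (rule holomorphic_uniform_sequence)
  show "(\<lambda>x. \<Prod>m<n. 1 - x * q ^ Suc m) holomorphic_on UNIV" for n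
    by (intro holomorphic_intros)
  fix x :: complex
  have "uniformly_convergent_on (cball x 1) (\<lambda>N x. \<Prod>n<N. 1 + (- x * q ^ Suc n))"
  proof (rule uniformly_convergent_on_prod)
    show "uniformly_convergent_on (cball x 1) (\<lambda>N x. \<Sum>n<N. norm (- x * q ^ Suc n))"
    proof (rule Weierstrass_m_test')
      fix n y assume "y \<in> cball x 1"
      then have "norm y \<le> norm x + 1"
        by (metis dist_commute dist_norm mem_cball norm_triangle_sub order_trans add_left_mono)
      then show "norm (norm (- y * q ^ Suc n)) \<le> (norm x + 1) * norm q ^ Suc n"
        by (auto simp: norm_mult norm_power abs_mult simp del: power_Suc intro!: mult_right_mono)
    next
      have "summable (\<lambda>m. ((norm x + 1) * norm q) * norm q ^ m)"
        using assms by (intro summable_mult summable_geometric) auto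
      then show "summable (\<lambda>m. (norm x + 1) * norm q ^ Suc m)"
        by (simp add: mult_ac)
    qed
  qed (auto intro!: continuous_intros)
  then obtain l where l: "uniform_limit (cball x 1) (\<lambda>N x. \<Prod>n<N. 1 - x * q ^ Suc n) l sequentially"
    by (auto simp: uniformly_convergent_on_def)
  have "l y = qprod q y" if "y \<in> cball x 1" for y
    using tendsto_uniform_limitI[OF l that] qprod_LIMSEQ[OF assms] LIMSEQ_unique by blast
  then have "uniform_limit (cball x 1) (\<lambda>N x. \<Prod>n<N. 1 - x * q ^ Suc n) (qprod q) sequentially"
    using l uniform_limit_cong' by (metis (no_types, lifting))
  then show "\<exists>d>0. cball x d \<subseteq> UNIV \<and>
      uniform_limit (cball x d) (\<lambda>N x. \<Prod>n<N. 1 - x * q ^ Suc n) (qprod q) sequentially"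
    by (intro exI[of _ 1]) auto
qed auto

text \<open>In product form this is the odd Jacobi theta function times \<open>ex (z / 2)\<close>
  and a constant depending on \<tau>. The exponential makes it 1-periodic; the constant would cancel
  in \<open>phi_theta\<close>.\<close>

definition theta :: "complex \<Rightarrow> complex \<Rightarrow> complex" where
  "theta \<tau> z = (1 - ex z) * (qprod (ex \<tau>) (ex z) * qprod (ex \<tau>) (ex (- z)))"

definition period_lattice :: "complex \<Rightarrow> complex set" where
  "period_lattice \<tau> = {of_int a + of_int b * \<tau> | a b. True}"

lemma theta_holomorphic:
  assumes "Im \<tau> > 0"
  shows "theta \<tau> holomorphic_on UNIV"
proof -
  have "(qprod (ex \<tau>) \<circ> g) holomorphic_on UNIV" if "g holomorphic_on UNIV" for g
    using qprod_holomorphic[OF norm_ex_less_1[OF assms]] that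
    by (intro holomorphic_on_compose) (auto elim: holomorphic_on_subset)
  then have *: "(\<lambda>z. qprod (ex \<tau>) (g z)) holomorphic_on UNIV" if "g holomorphic_on UNIV" for g
    using that by (simp add: o_def)
  show ?thesis
    unfolding theta_def by (intro holomorphic_intros *)
qed

section \<open>Quasi-periodicity and zeros of the theta function\<close>

lemma theta_plus_1: "theta \<tau> (z + 1) = theta \<tau> z"
proof -
  have "ex (- (z + 1)) = ex (- z)"
    by (simp add: ex_minus ex_add ex_diff)
  then show ?thesis by (simp add: theta_def ex_add)
qed

text \<open>Replacing \<open>t\<close> by \<open>t q\<close> removes the first factor of one product
  and adds a factor to the other; the multiplier is the quotient of \<open>1 - inverse t\<close> by
  \<open>1 - t\<close>.\<close>

lemma theta_plus_tau:
  assumes "Im \<tau> > 0"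
  shows "theta \<tau> (z + \<tau>) = - ex (- z) * theta \<tau> z"
proof -
  define q t where "q = ex \<tau>" and "t = ex z"
  have q: "norm q < 1" "q \<noteq> 0" "t \<noteq> 0"
    using norm_ex_less_1[OF assms] by (auto simp: q_def t_def)
  have "ex (z + \<tau>) = t * q" "ex (- (z + \<tau>)) = inverse (t * q)"
    by (simp_all only: ex_add ex_minus q_def t_def)
  then have "theta \<tau> (z + \<tau>) = (1 - t * q) * qprod q (t * q) * qprod q (inverse (t * q))"
    by (simp add: theta_def flip: q_def)
  also have "(1 - t * q) * qprod q (t * q) = qprod q t"
    by (rule qprod_shift[OF q(1), symmetric])
  also have "qprod q (inverse (t * q)) = (1 - inverse t) * qprod q (inverse t)"
    using qprod_shift[OF q(1), of "inverse (t * q)"] q by (simp add: mult.assoc)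
  finally have 1: "theta \<tau> (z + \<tau>) = qprod q t * ((1 - inverse t) * qprod q (inverse t))" .
  have 2: "theta \<tau> z = (1 - t) * (qprod q t * qprod q (inverse t))"
    by (simp add: theta_def ex_minus q_def t_def)
  have 3: "ex (- z) = inverse t" by (simp add: ex_minus t_def)
  have "1 - inverse t = - inverse t * (1 - t)" using q by (simp add: field_simps)
  then show ?thesis unfolding 1 2 3 by simp
qed

lemma theta_eq_0_shift:
  assumes "Im \<tau> > 0"
  shows "theta \<tau> (z + (of_int a + of_int b * \<tau>)) = 0 \<longleftrightarrow> theta \<tau> z = 0"
proof -
  have 1: "theta \<tau> (z + of_int a) = theta \<tau> z" for a z
  proof (induction a rule: int_induct[where k = 0])
    case (step1 i)
    then show ?case using theta_plus_1[of \<tau> "z + of_int i"] by (simp add: add_ac)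
  next
    case (step2 i)
    then show ?case using theta_plus_1[of \<tau> "z + of_int i - 1"] by (simp add: algebra_simps)
  qed auto
  have 2: "theta \<tau> (z + of_int b * \<tau>) = 0 \<longleftrightarrow> theta \<tau> z = 0" for b z
  proof (induction b rule: int_induct[where k = 0])
    case (step1 i)
    then show ?case using theta_plus_tau[OF assms, of "z + of_int i * \<tau>"] by (simp add: algebra_simps)
  next
    case (step2 i)
    then show ?case using theta_plus_tau[OF assms, of "z + of_int i * \<tau> - \<tau>"] by (simp add: algebra_simps)
  qed auto
  show ?thesis
    using 1[of "z + of_int b * \<tau>" a] 2[of z b] by (simp add: add_ac)
qed

lemma ex_eq_1_shift:
  assumes "ex z * ex \<tau> ^ n = 1"
  shows "\<exists>a::int. z = of_int a - of_nat n * \<tau>"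
proof -
  have "ex (z + of_nat n * \<tau>) = 1"
    using assms by (simp add: ex_add ex_of_nat_mult)
  then obtain a :: int where "z + of_nat n * \<tau> = of_int a"
    by (auto simp: ex_eq_1_iff elim!: Ints_cases)
  then show ?thesis by (metis add_diff_cancel_right')
qed

text \<open>An infinite product with \<open>norm q < 1\<close> vanishes only if one of its factors
  does. Conversely the zero at the origin suffices, since quasi-periodicity carries it to all
  lattice points.\<close>

lemma theta_eq_0_iff:
  assumes "Im \<tau> > 0"
  shows "theta \<tau> z = 0 \<longleftrightarrow> z \<in> period_lattice \<tau>"
proof
  assume "theta \<tau> z = 0"
  then consider "ex z = 1" | "qprod (ex \<tau>) (ex z) = 0" | "qprod (ex \<tau>) (ex (- z)) = 0"
    by (auto simp: theta_def)
  then show "z \<in> period_lattice \<tau>"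
  proof cases
    case 1
    then obtain a :: int where "z = of_int a + of_int 0 * \<tau>"
      by (auto simp: ex_eq_1_iff elim!: Ints_cases)
    then show ?thesis unfolding period_lattice_def by blast
  next
    case 2
    then obtain m where "ex z * ex \<tau> ^ Suc m = 1"
      using qprod_eq_0D norm_ex_less_1[OF assms] by blast
    then obtain a :: int where "z = of_int a - of_nat (Suc m) * \<tau>"
      using ex_eq_1_shift by blast
    then have "z = of_int a + of_int (- int (Suc m)) * \<tau>" by (simp add: algebra_simps)
    then show ?thesis unfolding period_lattice_def by blast
  next
    case 3
    then obtain m where "ex (- z) * ex \<tau> ^ Suc m = 1"
      using qprod_eq_0D norm_ex_less_1[OF assms] by blast
    then obtain a :: int where "- z = of_int a - of_nat (Suc m) * \<tau>"
      using ex_eq_1_shift by blast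
    then have "z = of_int (- a) + of_int (int (Suc m)) * \<tau>"
      by (metis add.inverse_inverse diff_conv_add_uminus minus_diff_eq of_int_minus of_int_of_nat_eq uminus_add_conv_diff)
    then show ?thesis unfolding period_lattice_def by blast
  qed
next
  assume "z \<in> period_lattice \<tau>"
  then obtain a b :: int where "z = 0 + (of_int a + of_int b * \<tau>)"
    by (auto simp: period_lattice_def)
  then show "theta \<tau> z = 0"
    using theta_eq_0_shift[OF assms, of 0 a b] by (simp add: theta_def)
qed

text \<open>At the origin only \<open>1 - ex z\<close> vanishes, because \<open>qprod\<close> could
  vanish at 1 only if a positive power of \<open>q\<close> were 1. A simple zero here is what makes
  the poles of \<open>phi_theta\<close> at most simple.\<close>

lemma theta_simple_zero:
  assumes "Im \<tau> > 0"
  shows "\<exists>d. d \<noteq> 0 \<and> (theta \<tau> has_field_derivative d) (at 0)"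
proof -
  define E where "E = (\<lambda>z. qprod (ex \<tau>) (ex z) * qprod (ex \<tau>) (ex (- z)))"
  have q: "norm (ex \<tau>) < 1" by (rule norm_ex_less_1[OF assms])
  have "qprod (ex \<tau>) 1 \<noteq> 0"
  proof
    assume "qprod (ex \<tau>) 1 = 0"
    then obtain m where "1 * ex \<tau> ^ Suc m = 1" using qprod_eq_0D[OF q] by blast
    then have "norm (ex \<tau>) ^ Suc m = 1" by (metis mult_1 norm_one norm_power)
    moreover have "norm (ex \<tau>) ^ Suc m < 1" using q by (intro power_Suc_less_one) auto
    ultimately show False by linarith
  qed
  then have E0: "E 0 \<noteq> 0" by (simp add: E_def)
  have "qprod (ex \<tau>) field_differentiable at x" for x
    using qprod_holomorphic[OF q] by (simp add: holomorphic_on_def)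
  moreover have "ex field_differentiable at x" for x
    using ex_holomorphic[of "\<lambda>z. z" UNIV] by (simp add: holomorphic_on_def)
  ultimately have "(qprod (ex \<tau>) \<circ> ex) field_differentiable at 0"
      "(qprod (ex \<tau>) \<circ> (ex \<circ> uminus)) field_differentiable at 0"
    by (auto intro!: field_differentiable_compose derivative_intros)
  then have "E field_differentiable at 0"
    unfolding E_def o_def by (intro derivative_intros)
  then obtain e where e: "(E has_field_derivative e) (at 0)"
    by (auto simp: field_differentiable_def)
  have "((\<lambda>z. 1 - ex z) has_field_derivative (- 2 * of_real pi * \<i>)) (at 0)"
    unfolding ex_def by (auto intro!: derivative_eq_intros)
  from DERIV_mult[OF this e]
  have "((\<lambda>z. (1 - ex z) * E z) has_field_derivative (- 2 * of_real pi * \<i>) * E 0) (at 0)"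
    by simp
  moreover have "(\<lambda>z. (1 - ex z) * E z) = theta \<tau>"
    by (auto simp: theta_def E_def)
  ultimately have "(theta \<tau> has_field_derivative (- 2 * of_real pi * \<i>) * E 0) (at 0)" by simp
  then show ?thesis using E0 by (intro exI[of _ "(- 2 * of_real pi * \<i>) * E 0"]) auto
qed

lemma eventually_not_period:
  assumes "Im \<tau> > 0"
  shows "eventually (\<lambda>w. w \<notin> period_lattice \<tau>) (at z)"
proof -
  \<comment> \<open>A half period lies outside the lattice, so \<open>theta\<close> is not
    identically zero and its zeros are isolated.\<close>
  have "theta \<tau> (\<tau> / 2) \<noteq> 0"
  proof
    assume "theta \<tau> (\<tau> / 2) = 0"
    then obtain a b :: int where ab: "\<tau> / 2 = of_int a + of_int b * \<tau>"
      using theta_eq_0_iff[OF assms] by (auto simp: period_lattice_def)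
    have "Im \<tau> / 2 = of_int b * Im \<tau>" using arg_cong[OF ab, of Im] by simp
    then have "of_int (2 * b) = (1 :: real)" using assms by simp
    then have "2 * b = 1" by linarith
    then show False by presburger
  qed
  then have "eventually (\<lambda>w. theta \<tau> w \<noteq> 0) (at z)"
    by (intro non_zero_neighbour_alt[OF theta_holomorphic[OF assms], of z "\<tau> / 2", THEN eventually_mono])
      auto
  then show ?thesis by (simp add: theta_eq_0_iff[OF assms])
qed

text \<open>
  At the poles division by zero gives \<open>0\<close>, so that the quasi-periodicity of \<open>phi_theta\<close> needs no
  regularity hypothesis.
\<close>

definition phi_theta :: "complex \<Rightarrow> complex \<Rightarrow> complex \<Rightarrow> complex" where
  "phi_theta \<tau> \<sigma> z = ex (- \<sigma> / 2) * (theta \<tau> (z + \<sigma>) / theta \<tau> z)"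

text \<open>Off the period lattice no factor of a denominator vanishes, which permits splitting the
  infinite product of quotients into a quotient of infinite products.\<close>

lemma phi_eq_phi_theta:
  assumes "Im \<tau> > 0" "z \<notin> period_lattice \<tau>"
  shows "phi z \<tau> \<sigma> = phi_theta \<tau> \<sigma> z"
proof -
  define q t s where "q = ex \<tau>" and "t = ex z" and "s = ex \<sigma>"
  have q: "norm q < 1" using norm_ex_less_1[OF assms(1)] by (simp add: q_def)
  have nz: "theta \<tau> z \<noteq> 0" using assms theta_eq_0_iff by blast
  have z1: "1 - t * q ^ Suc m \<noteq> 0" for m
  proof
    assume *: "1 - t * q ^ Suc m = 0"
    then obtain a :: int where "z = of_int a - of_nat (Suc m) * \<tau>"
      using ex_eq_1_shift[of z \<tau> "Suc m"] by (auto simp: t_def q_def)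
    then have "z = of_int a + of_int (- int (Suc m)) * \<tau>" by (simp add: algebra_simps)
    then show False using assms(2) unfolding period_lattice_def by blast
  qed
  have z2: "1 - inverse t * q ^ Suc m \<noteq> 0" for m
  proof
    assume *: "1 - inverse t * q ^ Suc m = 0"
    then obtain a :: int where "- z = of_int a - of_nat (Suc m) * \<tau>"
      using ex_eq_1_shift[of "- z" \<tau> "Suc m"] by (auto simp: t_def q_def ex_minus)
    then have "z = of_int (- a) + of_int (int (Suc m)) * \<tau>"
      by (metis add.inverse_inverse diff_conv_add_uminus minus_diff_eq of_int_minus of_int_of_nat_eq uminus_add_conv_diff)
    then show False using assms(2) unfolding period_lattice_def by blast
  qed
  note c = qprod_convergent[OF q]
  have "prodinf (\<lambda>m. ((1 - s * t * q ^ Suc m) * (1 - inverse s * inverse t * q ^ Suc m)) /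
                   ((1 - t * q ^ Suc m) * (1 - inverse t * q ^ Suc m)))
      = qprod q (s * t) * qprod q (inverse s * inverse t) / (qprod q t * qprod q (inverse t))"
    (is "prodinf ?f = ?r")
  proof -
    have "prodinf (\<lambda>m. (1 - (s * t) * q ^ Suc m) * (1 - (inverse s * inverse t) * q ^ Suc m))
        = qprod q (s * t) * qprod q (inverse s * inverse t)"
      unfolding qprod_def by (rule prodinf_mult[OF c c, symmetric])
    moreover have "prodinf (\<lambda>m. (1 - t * q ^ Suc m) * (1 - inverse t * q ^ Suc m))
        = qprod q t * qprod q (inverse t)"
      unfolding qprod_def by (rule prodinf_mult[OF c c, symmetric])
    ultimately show ?thesis
      using prodinf_divide[OF convergent_prod_mult[OF c c] convergent_prod_mult[OF c c],
          of "s * t" "inverse s * inverse t" t "inverse t"] z1 z2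
      by (simp only: no_zero_divisors simp_thms not_False_eq_True)
  qed
  then show ?thesis
    by (simp add: phi_def phi_theta_def theta_def ex_add ex_minus ex_diff mult_ac flip: q_def t_def s_def)
qed

section \<open>Multipliers, holomorphy and residue of the quotient of theta functions\<close>

lemma phi_theta_plus_1: "phi_theta \<tau> \<sigma> (z + 1) = phi_theta \<tau> \<sigma> z"
proof -
  have "z + 1 + \<sigma> = (z + \<sigma>) + 1" by simp
  then show ?thesis by (simp only: phi_theta_def theta_plus_1)
qed

text \<open>The multipliers of numerator and denominator depend on \<open>z\<close> in the same way,
  so only the constant \<open>ex (- \<sigma>)\<close> survives. For real \<sigma> it has modulus
  1.\<close>

lemma phi_theta_plus_tau:
  assumes "Im \<tau> > 0"
  shows "phi_theta \<tau> \<sigma> (z + \<tau>) = ex (- \<sigma>) * phi_theta \<tau> \<sigma> z"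
proof -
  have "z + \<tau> + \<sigma> = (z + \<sigma>) + \<tau>" by simp
  then have *: "phi_theta \<tau> \<sigma> (z + \<tau>) =
      ex (- \<sigma> / 2) * ((- ex (- (z + \<sigma>)) * theta \<tau> (z + \<sigma>)) / (- ex (- z) * theta \<tau> z))"
    by (simp only: phi_theta_def theta_plus_tau[OF assms])
  have "ex (- (z + \<sigma>)) = ex (- z) * ex (- \<sigma>)"
    by (simp add: ex_add ex_minus ex_diff)
  then show ?thesis unfolding * by (simp add: phi_theta_def)
qed

lemma phi_theta_shift:
  assumes "Im \<tau> > 0"
  shows "phi_theta \<tau> \<sigma> (z + (of_int a + of_int b * \<tau>)) = ex (- of_int b * \<sigma>) * phi_theta \<tau> \<sigma> z"
proof -
  let ?f = "phi_theta \<tau> \<sigma>"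
  have 1: "?f (z + of_int a) = ?f z" for a z
  proof (induction a rule: int_induct[where k = 0])
    case (step1 i)
    then show ?case using phi_theta_plus_1[of \<tau> \<sigma> "z + of_int i"] by (simp add: add_ac)
  next
    case (step2 i)
    then show ?case using phi_theta_plus_1[of \<tau> \<sigma> "z + of_int i - 1"] by (simp add: algebra_simps)
  qed auto
  have 2: "?f (z + of_int b * \<tau>) = ex (- of_int b * \<sigma>) * ?f z" for b z
  proof (induction b rule: int_induct[where k = 0])
    case (step1 i)
    have "- of_int (i + 1) * \<sigma> = - of_int i * \<sigma> + - \<sigma>" by (simp add: algebra_simps)
    then have "ex (- of_int (i + 1) * \<sigma>) = ex (- of_int i * \<sigma>) * ex (- \<sigma>)" by (metis ex_add)
    then show ?case using step1 phi_theta_plus_tau[OF assms, of \<sigma> "z + of_int i * \<tau>"]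
      by (simp add: algebra_simps)
  next
    case (step2 i)
    have "- of_int i * \<sigma> = - of_int (i - 1) * \<sigma> + - \<sigma>" by (simp add: algebra_simps)
    then have "ex (- of_int i * \<sigma>) = ex (- of_int (i - 1) * \<sigma>) * ex (- \<sigma>)" by (metis ex_add)
    then show ?case using step2 phi_theta_plus_tau[OF assms, of \<sigma> "z + of_int i * \<tau> - \<tau>"]
      by (simp add: algebra_simps)
  qed auto
  show ?thesis
    using 1[of "z + of_int b * \<tau>" a] 2[of z b] by (simp add: add_ac)
qed

lemma phi_theta_holomorphic:
  assumes "Im \<tau> > 0"
  shows "phi_theta \<tau> \<sigma> holomorphic_on - period_lattice \<tau>"
proof -
  have "theta \<tau> holomorphic_on A" for A
    using theta_holomorphic[OF assms] holomorphic_on_subset by blast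
  moreover have "(theta \<tau> \<circ> (\<lambda>z. z + \<sigma>)) holomorphic_on A" for A
    using theta_holomorphic[OF assms]
    by (intro holomorphic_on_compose) (auto intro!: holomorphic_intros intro: holomorphic_on_subset)
  ultimately show ?thesis
    unfolding phi_theta_def o_def using theta_eq_0_iff[OF assms]
    by (intro holomorphic_intros) auto
qed

text \<open>The residue stays anonymous: the residues at all poles are multiples of the same \<rho>,
  and they cancel whatever its value.\<close>

lemma phi_theta_residue:
  assumes "Im \<tau> > 0"
  shows "\<exists>\<rho>. ((\<lambda>z. z * phi_theta \<tau> \<sigma> z) \<longlongrightarrow> \<rho>) (at 0)"
proof -
  obtain d where d: "d \<noteq> 0" "(theta \<tau> has_field_derivative d) (at 0)"
    using theta_simple_zero[OF assms] by blast
  have "theta \<tau> 0 = 0" by (simp add: theta_def)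
  with d(2) have "((\<lambda>z. theta \<tau> z / z) \<longlongrightarrow> d) (at 0)"
    by (simp add: has_field_derivative_iff)
  then have l1: "((\<lambda>z. inverse (theta \<tau> z / z)) \<longlongrightarrow> inverse d) (at 0)"
    using d(1) by (rule tendsto_inverse)
  have "continuous_on UNIV (\<lambda>z. theta \<tau> (z + \<sigma>))"
    using holomorphic_on_imp_continuous_on[OF theta_holomorphic[OF assms]]
    by (rule continuous_on_compose2) (auto intro!: continuous_intros)
  then have "isCont (\<lambda>z. theta \<tau> (z + \<sigma>)) 0"
    by (simp add: continuous_on_eq_continuous_at)
  then have l2: "((\<lambda>z. theta \<tau> (z + \<sigma>)) \<longlongrightarrow> theta \<tau> \<sigma>) (at 0)"
    by (simp add: isCont_def)
  have "((\<lambda>z. ex (- \<sigma> / 2) * (theta \<tau> (z + \<sigma>) * inverse (theta \<tau> z / z)))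
      \<longlongrightarrow> ex (- \<sigma> / 2) * (theta \<tau> \<sigma> * inverse d)) (at 0)"
    by (intro tendsto_intros l1 l2)
  moreover have "ex (- \<sigma> / 2) * (theta \<tau> (z + \<sigma>) * inverse (theta \<tau> z / z)) = z * phi_theta \<tau> \<sigma> z" for z
    unfolding phi_theta_def divide_inverse inverse_mult_distrib inverse_inverse_eq by (simp only: mult_ac)
  ultimately have "((\<lambda>z. z * phi_theta \<tau> \<sigma> z) \<longlongrightarrow> ex (- \<sigma> / 2) * (theta \<tau> \<sigma> * inverse d)) (at 0)"
    by (simp only:)
  then show ?thesis ..
qed

section \<open>Lattices, cosets and dual bases\<close>

lemma group_closure_of_int_scaleR:
  fixes x :: "'a::real_vector"
  assumes "x \<in> group_closure S"
  shows "of_int m *\<^sub>R x \<in> group_closure S"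
proof -
  have nat: "of_nat n *\<^sub>R x \<in> group_closure S" for n
    by (induction n) (auto simp: scaleR_add_left intro: group_closure_add assms)
  show ?thesis
  proof (cases "m \<ge> 0")
    case True
    then show ?thesis using nat[of "nat m"] by simp
  next
    case False
    then show ?thesis using nat[of "nat (- m)"] group_closure_minus_iff[of "of_int m *\<^sub>R x" S] by simp
  qed
qed

lemma group_closure_sum_of_int:
  fixes V :: "'i \<Rightarrow> 'a::real_vector"
  assumes "finite I" "\<And>i. i \<in> I \<Longrightarrow> V i \<in> S"
  shows "(\<Sum>i\<in>I. of_int (m i) *\<^sub>R V i) \<in> group_closure S"
  using assms
  by (induction I rule: finite_induct)
    (auto intro!: group_closure_add group_closure_of_int_scaleR intro: group_closure.base)

lemma group_closure_subset:
  assumes "S \<subseteq> group_closure T"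
  shows "group_closure S \<subseteq> group_closure T"
proof
  fix x assume "x \<in> group_closure S"
  then show "x \<in> group_closure T"
    by induction (use assms in \<open>auto intro: group_closure.diff\<close>)
qed

text \<open>One predicate serves lattices and real subspaces alike, since cosets of both
  occur.\<close>

definition subgrp :: "'a::ab_group_add set \<Rightarrow> bool" where
  "subgrp W \<longleftrightarrow> 0 \<in> W \<and> (\<forall>x\<in>W. \<forall>y\<in>W. x - y \<in> W)"

lemma subgrp_group_closure: "subgrp (group_closure S)"
  by (auto simp: subgrp_def intro: group_closure.diff)

lemma subgrp_0: "subgrp W \<Longrightarrow> 0 \<in> W"
  and subgrp_diff: "subgrp W \<Longrightarrow> x \<in> W \<Longrightarrow> y \<in> W \<Longrightarrow> x - y \<in> W"
  by (auto simp: subgrp_def)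

lemma subgrp_uminus: "subgrp W \<Longrightarrow> x \<in> W \<Longrightarrow> - x \<in> W"
  using subgrp_diff[of W 0 x] subgrp_0[of W] by simp

lemma subgrp_add: "subgrp W \<Longrightarrow> x \<in> W \<Longrightarrow> y \<in> W \<Longrightarrow> x + y \<in> W"
  using subgrp_diff[of W x "- y"] subgrp_uminus[of W y] by simp

lemma in_coset_iff: "y \<in> coset W x \<longleftrightarrow> y - x \<in> W"
proof
  assume "y - x \<in> W"
  then have "x + (y - x) \<in> (\<lambda>y. x + y) ` W" by (rule imageI)
  then show "y \<in> coset W x" by (simp add: coset_def)
qed (auto simp: coset_def)

lemma coset_eq_iff:
  assumes "subgrp W"
  shows "coset W x = coset W y \<longleftrightarrow> x - y \<in> W"
proof
  assume "coset W x = coset W y"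
  moreover have "x \<in> coset W x" using subgrp_0[OF assms] by (simp add: in_coset_iff)
  ultimately show "x - y \<in> W" by (simp add: in_coset_iff)
next
  assume *: "x - y \<in> W"
  have "z - x \<in> W \<longleftrightarrow> z - y \<in> W" for z
    using subgrp_add[OF assms _ *, of "z - x"] subgrp_diff[OF assms _ *, of "z - y"] by auto
  then show "coset W x = coset W y" by (auto simp: in_coset_iff)
qed

lemma rep_coset:
  assumes "subgrp W"
  shows "rep (coset W x) - x \<in> W"
proof -
  have "x \<in> coset W x" using subgrp_0[OF assms] by (simp add: in_coset_iff)
  then have "rep (coset W x) \<in> coset W x" unfolding rep_def by (rule someI)
  then show ?thesis by (simp add: in_coset_iff)
qed

text \<open>\<open>X1\<close> is a union of cosets and need not be a subgroup: it will also be the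
  slice of \<open>L\<close> on which an affine function vanishes, which may be empty. Since
  \<open>rep\<close> picks an uncontrolled element, \<open>f\<close> has to respect
  differences.\<close>

lemma coset_bij:
  fixes W1 :: "'b::ab_group_add set" and W2 :: "'a::ab_group_add set"
  assumes W: "subgrp W1" "subgrp W2"
    and f: "\<And>x. x \<in> X1 \<Longrightarrow> f x \<in> X2"
    and cl: "\<And>x w. x \<in> X1 \<Longrightarrow> w \<in> W1 \<Longrightarrow> x + w \<in> X1"
    and inj: "\<And>x y. x \<in> X1 \<Longrightarrow> y \<in> X1 \<Longrightarrow> f x - f y \<in> W2 \<longleftrightarrow> x - y \<in> W1"
    and surj: "\<And>y. y \<in> X2 \<Longrightarrow> \<exists>x\<in>X1. f x - y \<in> W2"
  shows "bij_betw (\<lambda>h. coset W2 (f (rep h))) (coset W1 ` X1) (coset W2 ` X2)"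
proof -
  have rep: "rep (coset W1 x) \<in> X1" "rep (coset W1 x) - x \<in> W1" if "x \<in> X1" for x
    using cl[OF that rep_coset[OF W(1), of x]] rep_coset[OF W(1), of x] by auto
  have "inj_on (\<lambda>h. coset W2 (f (rep h))) (coset W1 ` X1)"
  proof (rule inj_onI; clarify)
    fix x y assume xy: "x \<in> X1" "y \<in> X1"
      and "coset W2 (f (rep (coset W1 x))) = coset W2 (f (rep (coset W1 y)))"
    then have "rep (coset W1 x) - rep (coset W1 y) \<in> W1"
      using inj rep by (auto simp: coset_eq_iff[OF W(2)])
    then have "(rep (coset W1 x) - rep (coset W1 y)) - (rep (coset W1 x) - x) + (rep (coset W1 y) - y) \<in> W1"
      by (intro subgrp_add[OF W(1) subgrp_diff[OF W(1)]] rep(2) xy)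
    then show "coset W1 x = coset W1 y"
      by (simp add: coset_eq_iff[OF W(1)])
  qed
  moreover have "(\<lambda>h. coset W2 (f (rep h))) ` (coset W1 ` X1) = coset W2 ` X2"
  proof (intro equalityI subsetI; clarify)
    fix x assume "x \<in> X1"
    then show "coset W2 (f (rep (coset W1 x))) \<in> coset W2 ` X2"
      using f rep by blast
  next
    fix y assume "y \<in> X2"
    then obtain x where x: "x \<in> X1" "f x - y \<in> W2" using surj by blast
    have "f (rep (coset W1 x)) - f x \<in> W2"
      using inj[of "rep (coset W1 x)" x] rep[OF x(1)] x(1) by auto
    then have "f (rep (coset W1 x)) - y \<in> W2"
      using subgrp_add[OF W(2) _ x(2), of "f (rep (coset W1 x)) - f x"] by simp
    then have "coset W2 (f (rep (coset W1 x))) = coset W2 y"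
      by (simp add: coset_eq_iff[OF W(2)])
    then show "coset W2 y \<in> (\<lambda>h. coset W2 (f (rep h))) ` (coset W1 ` X1)"
      using x(1) by (metis image_eqI)
  qed
  ultimately show ?thesis by (simp add: bij_betw_def)
qed

text \<open>Invariance of \<Psi> absorbs the discrepancy between \<open>f (rep h)\<close> and the
  representative that \<open>rep\<close> picks in its coset.\<close>

lemma sum_coset_reindex:
  fixes W1 :: "'b::ab_group_add set" and W2 :: "'a::ab_group_add set"
    and \<Psi> :: "'a \<Rightarrow> 'c::comm_monoid_add"
  assumes W: "subgrp W1" "subgrp W2"
    and f: "\<And>x. x \<in> X1 \<Longrightarrow> f x \<in> X2"
    and cl: "\<And>x w. x \<in> X1 \<Longrightarrow> w \<in> W1 \<Longrightarrow> x + w \<in> X1"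
    and inj: "\<And>x y. x \<in> X1 \<Longrightarrow> y \<in> X1 \<Longrightarrow> f x - f y \<in> W2 \<longleftrightarrow> x - y \<in> W1"
    and surj: "\<And>y. y \<in> X2 \<Longrightarrow> \<exists>x\<in>X1. f x - y \<in> W2"
    and \<Psi>: "\<And>y w. y \<in> X2 \<Longrightarrow> w \<in> W2 \<Longrightarrow> \<Psi> (y + w) = \<Psi> y"
  shows "(\<Sum>h\<in>coset W2 ` X2. \<Psi> (rep h)) = (\<Sum>h\<in>coset W1 ` X1. \<Psi> (f (rep h)))"
proof -
  have "(\<Sum>h\<in>coset W2 ` X2. \<Psi> (rep h)) = (\<Sum>h\<in>coset W1 ` X1. \<Psi> (rep (coset W2 (f (rep h)))))"
    using sum.reindex_bij_betw[OF coset_bij[OF W f cl inj surj], where g = "\<lambda>h. \<Psi> (rep h)"] by simp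
  also have "\<dots> = (\<Sum>h\<in>coset W1 ` X1. \<Psi> (f (rep h)))"
  proof (intro sum.cong refl; clarify)
    fix x assume x: "x \<in> X1"
    have "rep (coset W1 x) \<in> X1" using cl[OF x rep_coset[OF W(1), of x]] by auto
    then show "\<Psi> (rep (coset W2 (f (rep (coset W1 x))))) = \<Psi> (f (rep (coset W1 x)))"
      using \<Psi>[OF f rep_coset[OF W(2)], of "rep (coset W1 x)" "f (rep (coset W1 x))"] by simp
  qed
  finally show ?thesis .
qed

section \<open>Bases, coordinates and integrality\<close>

definition basis_family :: "('i \<Rightarrow> 'a::euclidean_space) \<Rightarrow> 'i set \<Rightarrow> bool" where
  "basis_family V I \<longleftrightarrow> finite I \<and> inj_on V I \<and> independent (V ` I) \<and> span (V ` I) = UNIV"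

lemma linear_eq_on_basis_family:
  assumes "basis_family V I" "linear f" "linear g" "\<And>i. i \<in> I \<Longrightarrow> f (V i) = g (V i)"
  shows "f = g"
proof
  fix x
  show "f x = g x"
    using linear_eq_on[OF assms(2,3), of x "V ` I"] assms by (auto simp: basis_family_def)
qed

lemma dual_basis:
  fixes V :: "'i \<Rightarrow> 'a::euclidean_space"
  assumes "basis_family V I" "i \<in> I"
  shows linear_dual_basis: "linear (dual_basis V I i)"
    and dual_basis_eq: "j \<in> I \<Longrightarrow> dual_basis V I i (V j) = (if j = i then 1 else 0)"
proof -
  let ?P = "\<lambda>u :: 'a \<Rightarrow> real. linear u \<and> (\<forall>j\<in>I. u (V j) = (if j = i then 1 else 0))"
  have "\<exists>!u. ?P u"
  proof (rule ex_ex1I)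
    obtain g :: "'a \<Rightarrow> real" where g: "linear g" "\<forall>x\<in>V ` I. g x = (if x = V i then 1 else 0)"
      using linear_independent_extend[of "V ` I" "\<lambda>x. if x = V i then 1 else 0"] assms
      by (auto simp: basis_family_def)
    have "g (V j) = (if j = i then 1 else 0)" if "j \<in> I" for j
      using g(2) that assms inj_onD[of V I j i] by (auto simp: basis_family_def)
    then show "\<exists>u. ?P u" using g(1) by blast
  next
    fix u v assume "?P u" "?P v"
    then show "u = v" by (intro linear_eq_on_basis_family[OF assms(1)]) auto
  qed
  then have "?P (dual_basis V I i)" unfolding dual_basis_def by (rule theI')
  then show "linear (dual_basis V I i)"
    "j \<in> I \<Longrightarrow> dual_basis V I i (V j) = (if j = i then 1 else 0)" by auto
qed

lemma linear_basis_expansion: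
  fixes f :: "'a::euclidean_space \<Rightarrow> 'b::real_vector"
  assumes "basis_family V I" "linear f"
  shows "f x = (\<Sum>i\<in>I. dual_basis V I i x *\<^sub>R f (V i))"
proof -
  have "f = (\<lambda>x. \<Sum>i\<in>I. dual_basis V I i x *\<^sub>R f (V i))"
  proof (rule linear_eq_on_basis_family[OF assms])
    show "linear (\<lambda>x. \<Sum>i\<in>I. dual_basis V I i x *\<^sub>R f (V i))"
      using linear_dual_basis[OF assms(1)]
      by (intro linearI) (auto simp: linear_add linear_cmul scaleR_add_left sum.distrib scaleR_sum_right)
    fix j assume "j \<in> I"
    then show "f (V j) = (\<Sum>i\<in>I. dual_basis V I i (V j) *\<^sub>R f (V i))"
      using assms(1) by (simp add: dual_basis_eq[OF assms(1)] basis_family_def if_distrib[of "\<lambda>c. c *\<^sub>R _"] cong: if_cong)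
  qed
  then show ?thesis by (rule fun_cong)
qed

lemma basis_expansion:
  "basis_family V I \<Longrightarrow> x = (\<Sum>i\<in>I. dual_basis V I i x *\<^sub>R V i)"
  using linear_basis_expansion[of V I "\<lambda>x. x" x] by (simp add: linear_id[unfolded id_def])

lemma subgrp_edge_lattice: "subgrp (edge_lattice V I)"
  by (simp add: edge_lattice_def subgrp_group_closure)

lemma edge_lattice_iff:
  assumes "basis_family V I"
  shows "x \<in> edge_lattice V I \<longleftrightarrow> (\<forall>i\<in>I. dual_basis V I i x \<in> \<int>)"
proof
  assume "x \<in> edge_lattice V I"
  then have "x \<in> group_closure (V ` I)" by (simp add: edge_lattice_def)
  then show "\<forall>i\<in>I. dual_basis V I i x \<in> \<int>"
  proof induction
    case (base x)
    then show ?case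
      using linear_0[OF linear_dual_basis[OF assms]] by (auto simp: dual_basis_eq[OF assms])
  next
    case (diff x y)
    then show ?case using linear_diff[OF linear_dual_basis[OF assms]] by simp
  qed
next
  assume *: "\<forall>i\<in>I. dual_basis V I i x \<in> \<int>"
  have "x = (\<Sum>i\<in>I. of_int \<lfloor>dual_basis V I i x\<rfloor> *\<^sub>R V i)"
    using basis_expansion[OF assms, of x] * by simp
  then show "x \<in> edge_lattice V I"
    using group_closure_sum_of_int[of I V "V ` I" "\<lambda>i. \<lfloor>dual_basis V I i x\<rfloor>"] assms
    by (auto simp: edge_lattice_def basis_family_def)
qed

text \<open>A basis indexed by itself presents \<open>L\<close> as an edge lattice, so that the
  criterion of integral coordinates applies to \<open>L\<close> as well.\<close>

lemma full_latticeE: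
  assumes "full_lattice L"
  obtains B where "basis_family (\<lambda>b. b) B" "L = edge_lattice (\<lambda>b. b) B"
proof -
  from assms obtain B where "independent B" "span B = UNIV" "L = group_closure B"
    by (auto simp: full_lattice_def)
  then show ?thesis
    using that[of B] by (auto simp: basis_family_def edge_lattice_def independent_imp_finite)
qed

lemma subgrp_full_lattice: "full_lattice L \<Longrightarrow> subgrp L"
  by (auto simp: full_lattice_def subgrp_group_closure)

lemma full_lattice_of_int_scaleR: "full_lattice L \<Longrightarrow> x \<in> L \<Longrightarrow> of_int m *\<^sub>R x \<in> L"
  by (auto simp: full_lattice_def group_closure_of_int_scaleR)

lemma edge_lattice_subset:
  assumes "full_lattice L" "V ` I \<subseteq> L"
  shows "edge_lattice V I \<subseteq> L"
proof -
  from assms obtain B where "L = group_closure B" by (auto simp: full_lattice_def)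
  then show ?thesis
    using group_closure_subset[of "V ` I" B] assms by (auto simp: edge_lattice_def)
qed

section \<open>Finiteness of lattice quotients and common denominators\<close>

lemma finite_lattice_bounded:
  assumes "full_lattice L" "bounded S"
  shows "finite (L \<inter> S)"
proof -
  obtain B where B: "basis_family (\<lambda>b. b) B" "L = edge_lattice (\<lambda>b. b) B"
    using full_latticeE[OF assms(1)] by blast
  let ?d = "dual_basis (\<lambda>b. b) B"
  have "\<exists>K. \<forall>x\<in>S. \<bar>?d b x\<bar> \<le> K" if "b \<in> B" for b
  proof -
    have "bounded (?d b ` S)"
      using linear_dual_basis[OF B(1) that] assms(2)
      by (intro bounded_linear_image) (auto simp: linear_conv_bounded_linear)
    then show ?thesis by (auto simp: bounded_iff)
  qed
  then obtain K where K: "\<And>b x. b \<in> B \<Longrightarrow> x \<in> S \<Longrightarrow> \<bar>?d b x\<bar> \<le> K b" by metis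
  have finB: "finite B" using B(1) by (simp add: basis_family_def)
  let ?F = "Pi\<^sub>E B (\<lambda>b. {- \<lceil>K b\<rceil>..\<lceil>K b\<rceil>})"
  have "L \<inter> S \<subseteq> (\<lambda>c. \<Sum>b\<in>B. of_int (c b) *\<^sub>R b) ` ?F"
  proof
    fix x assume x: "x \<in> L \<inter> S"
    then have int: "?d b x \<in> \<int>" if "b \<in> B" for b
      using edge_lattice_iff[OF B(1)] B(2) that by auto
    define c where "c = restrict (\<lambda>b. \<lfloor>?d b x\<rfloor>) B"
    have "x = (\<Sum>b\<in>B. of_int (c b) *\<^sub>R b)"
      using basis_expansion[OF B(1), of x] int by (simp add: c_def)
    moreover have "c \<in> ?F"
    proof (rule PiE_I)
      fix b assume b: "b \<in> B"
      have "\<bar>?d b x\<bar> \<le> K b" using K b x by blast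
      then have "\<bar>of_int \<lfloor>?d b x\<rfloor>\<bar> \<le> K b" using int[OF b] by simp
      then show "c b \<in> {- \<lceil>K b\<rceil>..\<lceil>K b\<rceil>}" using b by (simp add: c_def) linarith
    qed (simp add: c_def)
    ultimately show "x \<in> (\<lambda>c. \<Sum>b\<in>B. of_int (c b) *\<^sub>R b) ` ?F" by blast
  qed
  then show ?thesis
    using finB by (meson finite_PiE finite_atLeastAtMost_int finite_imageI finite_subset)
qed

lemma finite_quot_group:
  assumes "full_lattice L" "basis_family V I" "V ` I \<subseteq> L"
  shows "finite (quot_group L V I)"
proof -
  let ?d = "dual_basis V I"
  have fin: "finite I" using assms(2) by (simp add: basis_family_def)
  define S where "S = {x. \<forall>i\<in>I. 0 \<le> ?d i x \<and> ?d i x \<le> 1}"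
  have "bounded S"
    unfolding bounded_iff
  proof (intro exI[of _ "\<Sum>i\<in>I. norm (V i)"] ballI)
    fix x assume x: "x \<in> S"
    have "norm (\<Sum>i\<in>I. ?d i x *\<^sub>R V i) \<le> (\<Sum>i\<in>I. norm (V i))"
      using x by (intro sum_norm_le) (auto simp: S_def intro: mult_left_le_one_le)
    then show "norm x \<le> (\<Sum>i\<in>I. norm (V i))"
      using basis_expansion[OF assms(2), of x] by simp
  qed
  then have "finite (L \<inter> S)" by (rule finite_lattice_bounded[OF assms(1)])
  moreover have "quot_group L V I \<subseteq> coset (edge_lattice V I) ` (L \<inter> S)"
  proof
    fix h assume "h \<in> quot_group L V I"
    then obtain x where x: "x \<in> L" "h = coset (edge_lattice V I) x" by (auto simp: quot_group_def)
    \<comment> \<open>Reducing all coordinates modulo 1 moves the representative into the closed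
      fundamental parallelepiped \<open>S\<close>, which is bounded.\<close>
    define y where "y = x - (\<Sum>i\<in>I. of_int \<lfloor>?d i x\<rfloor> *\<^sub>R V i)"
    have e: "(\<Sum>i\<in>I. of_int \<lfloor>?d i x\<rfloor> *\<^sub>R V i) \<in> edge_lattice V I"
      using fin unfolding edge_lattice_def by (intro group_closure_sum_of_int) auto
    then have "y \<in> L" unfolding y_def
      using edge_lattice_subset[OF assms(1,3)] subgrp_diff[OF subgrp_full_lattice[OF assms(1)] x(1)] by blast
    moreover have "?d j y = ?d j x - of_int \<lfloor>?d j x\<rfloor>" if "j \<in> I" for j
    proof -
      have "?d j (\<Sum>i\<in>I. of_int \<lfloor>?d i x\<rfloor> *\<^sub>R V i) = (\<Sum>i\<in>I. of_int \<lfloor>?d i x\<rfloor> * (if i = j then 1 else 0))"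
        using linear_dual_basis[OF assms(2) that]
        by (simp add: linear_sum linear_cmul dual_basis_eq[OF assms(2) that] cong: sum.cong)
      also have "\<dots> = of_int \<lfloor>?d j x\<rfloor>" using that fin by (simp add: if_distrib cong: if_cong)
      finally show ?thesis
        unfolding y_def using linear_dual_basis[OF assms(2) that] by (simp add: linear_diff)
    qed
    then have "y \<in> S" by (auto simp: S_def) linarith
    moreover have "coset (edge_lattice V I) x = coset (edge_lattice V I) y"
      using e by (simp add: coset_eq_iff[OF subgrp_edge_lattice] y_def)
    ultimately show "h \<in> coset (edge_lattice V I) ` (L \<inter> S)" using x(2) by blast
  qed
  ultimately show ?thesis using finite_subset by blast
qed

text \<open>Pigeonhole: two different multiples of \<open>x\<close> fall into the same one of
  finitely many classes.\<close>

lemma multiple_in_edge_lattice: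
  assumes "full_lattice L" "basis_family V I" "V ` I \<subseteq> L" "x \<in> L"
  shows "\<exists>m::nat. m > 0 \<and> of_nat m *\<^sub>R x \<in> edge_lattice V I"
proof -
  have "range (\<lambda>m::nat. coset (edge_lattice V I) (of_nat m *\<^sub>R x)) \<subseteq> quot_group L V I"
    using full_lattice_of_int_scaleR[OF assms(1,4)]
    by (auto simp: quot_group_def) (metis image_eqI of_int_of_nat_eq)
  then have "finite (range (\<lambda>m::nat. coset (edge_lattice V I) (of_nat m *\<^sub>R x)))"
    using finite_quot_group[OF assms(1-3)] finite_subset by blast
  then have "\<not> inj (\<lambda>m::nat. coset (edge_lattice V I) (of_nat m *\<^sub>R x))"
    using finite_imageD infinite_UNIV_nat by blast
  then obtain k l :: nat where kl: "k < l"
    "coset (edge_lattice V I) (of_nat k *\<^sub>R x) = coset (edge_lattice V I) (of_nat l *\<^sub>R x)"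
    unfolding inj_def by (metis nat_neq_iff)
  then have "of_nat l *\<^sub>R x - of_nat k *\<^sub>R x \<in> edge_lattice V I"
    using coset_eq_iff[OF subgrp_edge_lattice] by metis
  then have "of_nat (l - k) *\<^sub>R x \<in> edge_lattice V I"
    using kl(1) by (simp add: of_nat_diff scaleR_diff_left)
  then show ?thesis using kl(1) by (intro exI[of _ "l - k"]) auto
qed

lemma common_multiple:
  assumes L: "full_lattice L" and T: "finite T" and X: "finite X" "X \<subseteq> L"
    and bf: "\<And>I. I \<in> T \<Longrightarrow> basis_family V I \<and> V ` I \<subseteq> L"
  shows "\<exists>M::nat. M > 0 \<and> (\<forall>x\<in>X. \<forall>I\<in>T. of_nat M *\<^sub>R x \<in> edge_lattice V I)"
proof -
  have "\<exists>m::nat. m > 0 \<and> of_nat m *\<^sub>R x \<in> edge_lattice V I" if "(x, I) \<in> X \<times> T" for x I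
    using that bf X(2) by (intro multiple_in_edge_lattice[OF L]) auto
  then have "\<forall>p\<in>X \<times> T. \<exists>m::nat. m > 0 \<and> of_nat m *\<^sub>R fst p \<in> edge_lattice V (snd p)"
    by auto
  from bchoice[OF this] obtain m where
    m: "\<forall>p\<in>X \<times> T. m p > 0 \<and> of_nat (m p) *\<^sub>R fst p \<in> edge_lattice V (snd p)"
    by (rule exE)
  define M where "M = (\<Prod>p\<in>X \<times> T. m p)"
  have fin: "finite (X \<times> T)" using T X by blast
  have "of_nat M *\<^sub>R x \<in> edge_lattice V I" if "x \<in> X" "I \<in> T" for x I
  proof -
    have "m (x, I) dvd M" unfolding M_def using fin that by (intro dvd_prodI) auto
    then obtain c where "M = m (x, I) * c" by blast
    then have "of_nat M *\<^sub>R x = of_int (int c) *\<^sub>R (of_nat (m (x, I)) *\<^sub>R x)"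
      by (simp add: mult.commute)
    moreover have "of_nat (m (x, I)) *\<^sub>R x \<in> group_closure (V ` I)"
      using bspec[OF m, of "(x, I)"] that by (simp add: edge_lattice_def)
    ultimately show ?thesis
      by (simp only: edge_lattice_def group_closure_of_int_scaleR)
  qed
  moreover have "M > 0" unfolding M_def using m by (intro prod_pos) auto
  ultimately show ?thesis by blast
qed

text \<open>It suffices to treat the finitely many vectors of a lattice basis, as edge lattices are
  closed under differences.\<close>

lemma lattice_multiple_in_edge_lattice:
  assumes L: "full_lattice L" and T: "finite T"
    and bf: "\<And>I. I \<in> T \<Longrightarrow> basis_family V I \<and> V ` I \<subseteq> L"
  shows "\<exists>M::nat. M > 0 \<and> (\<forall>x\<in>L. \<forall>I\<in>T. of_nat M *\<^sub>R x \<in> edge_lattice V I)"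
proof -
  obtain B where B: "basis_family (\<lambda>b. b) B" "L = edge_lattice (\<lambda>b. b) B"
    using full_latticeE[OF L] by blast
  have "finite B" using B(1) by (simp add: basis_family_def)
  moreover have "B \<subseteq> L" unfolding B(2) edge_lattice_def by (auto intro: group_closure.base)
  ultimately obtain M :: nat where M: "M > 0" "\<forall>b\<in>B. \<forall>I\<in>T. of_nat M *\<^sub>R b \<in> edge_lattice V I"
    using common_multiple[OF L T _ _ bf, of B] by blast
  have "of_nat M *\<^sub>R x \<in> edge_lattice V I" if "x \<in> L" "I \<in> T" for x I
  proof -
    have "x \<in> group_closure B" using that(1) B(2) by (simp add: edge_lattice_def)
    then show ?thesis
    proof induction
      case (base s)
      then show ?case using M(2) that(2) subgrp_0[OF subgrp_edge_lattice, of V I] by auto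
    next
      case (diff s t)
      then show ?case using subgrp_diff[OF subgrp_edge_lattice] by (simp add: scaleR_diff_right)
    qed
  qed
  then show ?thesis using M(1) by blast
qed

section \<open>Maximal simplices as bases, and generic lattice points\<close>

lemma simplicial_cones:
  fixes \<Delta> :: "('i, 'a::euclidean_space) multi_fan"
  assumes "simplicial_multi_fan L \<Delta>" "I \<in> simps \<Delta>"
  shows "dim (cone_of \<Delta> I) = card I"
    and "cone_of \<Delta> I = convex_cone hull (\<Union>i\<in>I. cone_of \<Delta> {i})"
    and "J \<subseteq> I \<Longrightarrow> J \<in> simps \<Delta> \<and> cone_of \<Delta> J \<subseteq> cone_of \<Delta> I"
proof -
  note * = assms(1)[unfolded simplicial_multi_fan_def]
  note 1 = *[THEN conjunct2, THEN conjunct2, THEN conjunct2, THEN conjunct2, THEN conjunct2,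
      rule_format, OF assms(2)]
  show "dim (cone_of \<Delta> I) = card I" using 1 by (elim conjE)
  show "cone_of \<Delta> I = convex_cone hull (\<Union>i\<in>I. cone_of \<Delta> {i})" using 1 by (elim conjE)
  assume "J \<subseteq> I"
  then have "cone_of \<Delta> J face_of cone_of \<Delta> I" using 1 by (elim conjE allE impE)
  moreover have "\<forall>J. J \<subseteq> I \<longrightarrow> J \<in> simps \<Delta>"
    using bspec[OF *[THEN conjunct2, THEN conjunct2, THEN conjunct1] assms(2)] by (elim conjE)
  ultimately show "J \<in> simps \<Delta> \<and> cone_of \<Delta> J \<subseteq> cone_of \<Delta> I"
    using \<open>J \<subseteq> I\<close> face_of_imp_subset by metis
qed

text \<open>Dimension count: a cone of full dimension \<open>n\<close> lying in the span of only
  \<open>n\<close> edge vectors forces these to be distinct and independent.\<close>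

lemma simplicial_top:
  fixes \<Delta> :: "('i, 'a::euclidean_space) multi_fan"
  assumes "simplicial_multi_fan L \<Delta>" "edge_vectors L \<Delta> V" "I \<in> top_simps \<Delta>"
  shows "basis_family V I" "V ` I \<subseteq> L" "card I = DIM('a)" "finite I" "I \<in> simps \<Delta>"
proof -
  have I: "I \<in> simps \<Delta>" "card I = DIM('a)" using assms(3) by (auto simp: top_simps_def ksimps_def)
  then have fin: "finite I" by (intro card_ge_0_finite) simp
  have vert: "i \<in> verts \<Delta>" if "i \<in> I" for i
    using simplicial_cones(3)[OF assms(1) I(1), of "{i}"] that by (simp add: verts_def)
  then have V: "V i \<in> L" "cone_of \<Delta> {i} = convex_cone hull {V i}" if "i \<in> I" for i
    using assms(2) that by (auto simp: edge_vectors_def)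
  have cone: "cone_of \<Delta> I = convex_cone hull (\<Union>i\<in>I. cone_of \<Delta> {i})"
    and dim: "dim (cone_of \<Delta> I) = card I"
    by (rule simplicial_cones[OF assms(1) I(1)])+
  have cc: "convex_cone (span S)" for S :: "'a set"
    by (simp add: subspace_imp_convex_cone)
  have "cone_of \<Delta> {i} \<subseteq> span (V ` I)" if "i \<in> I" for i
    unfolding V(2)[OF that] using that by (intro hull_minimal cc) (auto intro: span_base)
  then have "cone_of \<Delta> I \<subseteq> span (V ` I)"
    unfolding cone by (intro hull_minimal cc) auto
  then have "dim (cone_of \<Delta> I) \<le> dim (span (V ` I))" by (rule dim_subset)
  then have "DIM('a) \<le> dim (V ` I)" using dim I by simp
  moreover have "dim (V ` I) \<le> card (V ` I)" using fin by (intro dim_le_card') auto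
  moreover have "card (V ` I) \<le> card I" using fin by (rule card_image_le)
  ultimately have eq: "card (V ` I) = card I" "dim (V ` I) = DIM('a)" using I(2) by auto
  then have "span (V ` I) = UNIV" by (simp add: dim_eq_full)
  moreover have "independent (V ` I)"
    using card_le_dim_spanning[of "V ` I" "V ` I"] fin eq I(2) span_superset[of "V ` I"] by simp
  moreover have "inj_on V I" using eq(1) fin by (simp add: eq_card_imp_inj_on)
  ultimately show "basis_family V I" using fin by (simp add: basis_family_def)
  show "V ` I \<subseteq> L" using V by auto
qed (use assms(3) in \<open>auto simp: top_simps_def ksimps_def intro: card_ge_0_finite\<close>)

text \<open>Along a polynomial curve of lattice points each functional becomes a nonzero polynomial
  in one parameter, so only finitely many parameters are bad.\<close>

lemma lattice_point_avoiding:
  fixes x0 :: "'a::euclidean_space"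
  assumes L: "full_lattice L" and A: "finite A" "\<And>a. a \<in> A \<Longrightarrow> linear a \<and> a \<noteq> (\<lambda>_. 0)" and m: "m \<noteq> 0"
  shows "\<exists>g\<in>L. \<forall>a\<in>A. a (x0 + m *\<^sub>R g) \<noteq> (0::real)"
proof -
  obtain B where B: "basis_family (\<lambda>b. b) B" "L = edge_lattice (\<lambda>b. b) B"
    using full_latticeE[OF L] by blast
  have fin: "finite B" using B(1) by (simp add: basis_family_def)
  then obtain idx :: "'a \<Rightarrow> nat" where idx: "inj_on idx B"
    using finite_imp_inj_to_nat_seg by blast
  \<comment> \<open>Distinct positive exponents keep the coefficients \<open>m * a b\<close> apart
    from each other and from the constant term \<open>a x0\<close>.\<close>
  define g where "g = (\<lambda>s::nat. \<Sum>b\<in>B. of_int (int s ^ Suc (idx b)) *\<^sub>R b)"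
  define p where "p = (\<lambda>a :: 'a \<Rightarrow> real. [:a x0:] + (\<Sum>b\<in>B. monom (m * a b) (Suc (idx b))))"
  have "p a \<noteq> 0" if "a \<in> A" for a
  proof
    assume p0: "p a = 0"
    have "a b = 0" if b: "b \<in> B" for b
    proof -
      have "0 = coeff (p a) (Suc (idx b))" using p0 by simp
      also have "\<dots> = (\<Sum>b'\<in>B. if idx b' = idx b then m * a b' else 0)"
        by (simp add: p_def coeff_sum)
      also have "\<dots> = (\<Sum>b'\<in>B. if b' = b then m * a b' else 0)"
        using b idx by (intro sum.cong) (auto dest: inj_onD)
      also have "\<dots> = m * a b" using fin b by simp
      finally show ?thesis using m by simp
    qed
    then have "a = (\<lambda>_. 0)"
      using A(2)[OF that] by (intro linear_eq_on_basis_family[OF B(1)]) (auto simp: linear_iff)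
    then show False using A(2)[OF that] by blast
  qed
  then have "finite (\<Union>a\<in>A. {s. poly (p a) s = 0})"
    using A(1) poly_roots_finite by blast
  then have "finite (real -` (\<Union>a\<in>A. {s. poly (p a) s = 0}))"
    by (rule finite_vimageI) (simp add: inj_on_def)
  then obtain s :: nat where "s \<notin> real -` (\<Union>a\<in>A. {s. poly (p a) s = 0})"
    using ex_new_if_finite infinite_UNIV_nat by blast
  then have s: "poly (p a) (real s) \<noteq> 0" if "a \<in> A" for a using that by auto
  have "a (x0 + m *\<^sub>R g s) = poly (p a) (real s)" if "a \<in> A" for a
  proof -
    have "linear a" using A(2) that by blast
    then show ?thesis
      by (simp add: p_def g_def poly_sum poly_monom linear_add linear_cmul linear_sum sum_distrib_left mult_ac)
  qed
  moreover have "g s \<in> L"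
    unfolding g_def B(2) edge_lattice_def by (rule group_closure_sum_of_int[OF fin]) auto
  ultimately show ?thesis using s by metis
qed

text \<open>The form \<open>x0 + m *\<^sub>R g\<close> keeps the class of \<open>x0\<close> modulo
  \<open>m L\<close>: an edge vector modulo \<open>N\<close> for the direction of the lines, and 0
  modulo a common denominator for the uniqueness of the genus.\<close>

lemma generic_lattice_point:
  fixes x0 :: "'a::euclidean_space" and \<Delta> :: "('i, 'a) multi_fan"
  assumes L: "full_lattice L" and \<Delta>: "simplicial_multi_fan L \<Delta>"
    and A: "finite A" "\<And>a. a \<in> A \<Longrightarrow> linear a \<and> a \<noteq> (\<lambda>_. 0 :: real)" and m: "m \<noteq> 0"
  shows "\<exists>g\<in>L. generic \<Delta> (x0 + m *\<^sub>R g) \<and> (\<forall>a\<in>A. a (x0 + m *\<^sub>R g) \<noteq> 0)"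
proof -
  define S where "S = {J \<in> simps \<Delta>. dim (cone_of \<Delta> J) < DIM('a)}"
  have "finite S" using \<Delta> by (simp add: S_def simplicial_multi_fan_def)
  have "\<exists>a. a \<noteq> 0 \<and> span (cone_of \<Delta> J) \<subseteq> {x. a \<bullet> x = 0}" if "J \<in> S" for J
    using that lowdim_subset_hyperplane by (auto simp: S_def)
  then obtain n where n: "\<And>J. J \<in> S \<Longrightarrow> n J \<noteq> 0 \<and> span (cone_of \<Delta> J) \<subseteq> {x. n J \<bullet> x = 0}"
    by metis
  let ?A = "A \<union> (\<lambda>J x. n J \<bullet> x) ` S"
  have "linear a \<and> a \<noteq> (\<lambda>_. 0)" if a: "a \<in> ?A" for a
  proof (cases "a \<in> A")
    case False
    then obtain J where J: "J \<in> S" "a = (\<lambda>x. n J \<bullet> x)" using a by auto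
    have "n J \<bullet> n J \<noteq> 0" using n[OF J(1)] by simp
    then have "a \<noteq> (\<lambda>_. 0)" using J(2) by metis
    then show ?thesis by (simp add: J(2) bounded_linear.linear[OF bounded_linear_inner_right])
  qed (use A in auto)
  moreover have "finite ?A" using A(1) \<open>finite S\<close> by blast
  ultimately obtain g where g: "g \<in> L" "\<forall>a\<in>?A. a (x0 + m *\<^sub>R g) \<noteq> 0"
    using lattice_point_avoiding[OF L _ _ m, of ?A x0] by blast
  then have "generic \<Delta> (x0 + m *\<^sub>R g)"
    using n by (fastforce simp: generic_def S_def)
  then show ?thesis using g by blast
qed

section \<open>Walls\<close>

lemma span_face:
  assumes bf: "basis_family V I" and i: "i \<in> I"
  shows "span (V ` (I - {i})) = {y. dual_basis V I i y = 0}"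
proof (intro equalityI subsetI)
  fix y assume "y \<in> span (V ` (I - {i}))"
  then have "dual_basis V I i y = (\<lambda>_. 0) y"
    by (intro linear_eq_on[OF linear_dual_basis[OF bf i], of _ y "V ` (I - {i})"])
      (auto simp: dual_basis_eq[OF bf i] linear_iff split: if_splits)
  then show "y \<in> {y. dual_basis V I i y = 0}" by simp
next
  fix y assume y: "y \<in> {y. dual_basis V I i y = 0}"
  have fin: "finite I" using bf by (simp add: basis_family_def)
  have "y = (\<Sum>j\<in>I. dual_basis V I j y *\<^sub>R V j)" by (rule basis_expansion[OF bf])
  also have "\<dots> = (\<Sum>j\<in>I - {i}. dual_basis V I j y *\<^sub>R V j)"
    using y by (intro sum.mono_neutral_right fin) auto
  also have "\<dots> \<in> span (V ` (I - {i}))"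
    by (intro span_sum span_scale span_base) auto
  finally show "y \<in> span (V ` (I - {i}))" .
qed

lemma edge_lattice_face:
  assumes bf: "basis_family V I" and i: "i \<in> I"
  shows "edge_lattice V (I - {i}) = {y \<in> edge_lattice V I. dual_basis V I i y = 0}"
proof (intro equalityI subsetI)
  fix y assume y: "y \<in> edge_lattice V (I - {i})"
  have "V ` (I - {i}) \<subseteq> group_closure (V ` I)" by (auto intro: group_closure.base)
  then have 1: "y \<in> edge_lattice V I"
    using y group_closure_subset unfolding edge_lattice_def by blast
  have "y \<in> group_closure (V ` (I - {i}))" using y by (simp add: edge_lattice_def)
  then have "y \<in> span (V ` (I - {i}))"
  proof induction
    case (base s)
    then show ?case by (auto intro: span_base span_zero)
  qed (rule span_diff)
  then show "y \<in> {y \<in> edge_lattice V I. dual_basis V I i y = 0}"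
    using 1 span_face[OF assms] by simp
next
  fix y assume y: "y \<in> {y \<in> edge_lattice V I. dual_basis V I i y = 0}"
  have fin: "finite I" using bf by (simp add: basis_family_def)
  have int: "dual_basis V I j y \<in> \<int>" if "j \<in> I" for j
    using y that by (simp add: edge_lattice_iff[OF bf])
  have "y = (\<Sum>j\<in>I. dual_basis V I j y *\<^sub>R V j)" by (rule basis_expansion[OF bf])
  also have "\<dots> = (\<Sum>j\<in>I - {i}. dual_basis V I j y *\<^sub>R V j)"
    using y by (intro sum.mono_neutral_right fin) auto
  also have "\<dots> = (\<Sum>j\<in>I - {i}. of_int \<lfloor>dual_basis V I j y\<rfloor> *\<^sub>R V j)"
    using int by (intro sum.cong refl) simp
  also have "\<dots> \<in> edge_lattice V (I - {i})"
    unfolding edge_lattice_def using fin by (intro group_closure_sum_of_int) auto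
  finally show "y \<in> edge_lattice V (I - {i})" .
qed

text \<open>Both functionals vanish on the hyperplane spanned by the common facet, hence they are
  proportional; evaluation at \<open>V i\<close> gives the constant.\<close>

lemma dual_basis_face_proportional:
  assumes bf: "basis_family V I" "i \<in> I" and bf0: "basis_family V I0" "i0 \<in> I0"
    and eq: "I - {i} = I0 - {i0}"
  shows "dual_basis V I0 i0 y = dual_basis V I0 i0 (V i) * dual_basis V I i y"
proof -
  have "dual_basis V I0 i0 = (\<lambda>y. dual_basis V I0 i0 (V i) * dual_basis V I i y)"
  proof (rule linear_eq_on_basis_family[OF bf(1) linear_dual_basis[OF bf0]])
    show "linear (\<lambda>y. dual_basis V I0 i0 (V i) * dual_basis V I i y)"
      using linear_dual_basis[OF bf] by (intro linearI) (auto simp: linear_add linear_cmul algebra_simps)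
    fix j assume j: "j \<in> I"
    show "dual_basis V I0 i0 (V j) = dual_basis V I0 i0 (V i) * dual_basis V I i (V j)"
    proof (cases "j = i")
      case False
      then have "j \<in> I0 - {i0}" using j eq by blast
      then show ?thesis using False j by (simp add: dual_basis_eq[OF bf] dual_basis_eq[OF bf0])
    qed (simp add: dual_basis_eq[OF bf] bf(2))
  qed
  then show ?thesis by (rule fun_cong)
qed

text \<open>On the hyperplane of a facet, the coordinates indexed by the facet are determined by the
  facet alone. This is why the factors that stay regular at a pole agree for all simplices around a
  wall.\<close>

lemma dual_basis_face_agree:
  assumes bf: "basis_family V I" "i \<in> I" and bf0: "basis_family V I0" "i0 \<in> I0"
    and eq: "I - {i} = I0 - {i0}" and j: "j \<in> I - {i}" and y: "dual_basis V I i y = 0"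
  shows "dual_basis V I j y = dual_basis V I0 j y"
proof -
  have j': "j \<in> I" "j \<in> I0" using j eq by auto
  have "dual_basis V I j b = dual_basis V I0 j b" if b: "b \<in> V ` (I - {i})" for b
  proof -
    obtain l where l: "l \<in> I - {i}" "b = V l" using b by auto
    then have "l \<in> I0 - {i0}" using eq by simp
    then show ?thesis
      using l dual_basis_eq[OF bf(1) j'(1), of l] dual_basis_eq[OF bf0(1) j'(2), of l] by auto
  qed
  moreover have "y \<in> span (V ` (I - {i}))" using span_face[OF bf] y by simp
  ultimately show ?thesis
    using linear_eq_on[OF linear_dual_basis[OF bf(1) j'(1)] linear_dual_basis[OF bf0(1) j'(2)]] by metis
qed

text \<open>The heights of lattice points over a facet form a subgroup of the reals with a common
  denominator, hence a cyclic one; \<open>e\<close> has least positive height.\<close>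

lemma lattice_height_generator:
  assumes L: "full_lattice L" and bf: "basis_family V I" "V ` I \<subseteq> L" and i: "i \<in> I"
  shows "\<exists>e\<in>L. dual_basis V I i e > 0 \<and> (\<forall>y\<in>L. \<exists>m::int. dual_basis V I i y = of_int m * dual_basis V I i e)"
proof -
  let ?d = "dual_basis V I i"
  have lin: "linear ?d" by (rule linear_dual_basis[OF bf(1) i])
  obtain M :: nat where M: "M > 0" "\<forall>y\<in>L. of_nat M *\<^sub>R y \<in> edge_lattice V I"
    using lattice_multiple_in_edge_lattice[OF L, of "{I}" V] bf by auto
  have Mint: "of_nat M * ?d y \<in> \<int>" if "y \<in> L" for y
  proof -
    have "?d (of_nat M *\<^sub>R y) \<in> \<int>" using M(2) that i edge_lattice_iff[OF bf(1)] by blast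
    then show ?thesis by (simp add: linear_cmul[OF lin])
  qed
  \<comment> \<open>The factor \<open>M\<close> makes all heights integral, so that the least
    positive one can be found among natural numbers.\<close>
  define P where "P = (\<lambda>n::nat. n > 0 \<and> (\<exists>y\<in>L. of_nat M * ?d y = of_nat n))"
  have "V i \<in> L" using bf(2) i by auto
  moreover have "?d (V i) = 1" using i by (simp add: dual_basis_eq[OF bf(1) i])
  ultimately have "P M" using M(1) by (auto simp: P_def)
  define n where "n = (LEAST n. P n)"
  have "P n" unfolding n_def using \<open>P M\<close> by (rule LeastI)
  then obtain e where e: "e \<in> L" "of_nat M * ?d e = of_nat n" "n > 0" by (auto simp: P_def)
  have "\<exists>m::int. ?d y = of_int m * ?d e" if y: "y \<in> L" for y
  proof -
    obtain c :: int where c: "of_nat M * ?d y = of_int c" using Mint[OF y] by (auto elim: Ints_cases)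
    define y' where "y' = y - of_int (c div int n) *\<^sub>R e"
    have "y' \<in> L" unfolding y'_def
      by (intro subgrp_diff[OF subgrp_full_lattice[OF L]] y full_lattice_of_int_scaleR[OF L] e)
    have "of_nat M * ?d y' = of_int c - of_int (c div int n) * of_nat n"
      using c e(2) by (simp add: y'_def linear_diff[OF lin] linear_cmul[OF lin] algebra_simps)
    also have "\<dots> = of_int (c mod int n)"
      by (metis minus_div_mult_eq_mod of_int_diff of_int_mult of_int_of_nat_eq)
    also have "\<dots> = of_nat (nat (c mod int n))" using e(3) by simp
    finally have *: "of_nat M * ?d y' = of_nat (nat (c mod int n))" .
    have "nat (c mod int n) < n" using e(3) by (simp add: nat_less_iff)
    then have "\<not> P (nat (c mod int n))" unfolding n_def by (rule not_less_Least)
    then have "nat (c mod int n) = 0" using * \<open>y' \<in> L\<close> by (auto simp: P_def)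
    then have "?d y' = 0" using * M(1) by simp
    then show ?thesis
      by (intro exI[of _ "c div int n"]) (simp add: y'_def linear_diff[OF lin] linear_cmul[OF lin])
  qed
  moreover have "?d e > 0"
    using e(2,3) M(1) by (metis of_nat_0_less_iff zero_less_mult_pos)
  ultimately show ?thesis using e(1) by blast
qed

text \<open>
  The group \<open>H\<^sub>I\<close> is an extension of a cyclic group, generated by a lattice vector \<open>e\<close> at
  minimal height over the facet, by the corresponding group of the facet.
\<close>

lemma card_quot_group_face:
  assumes L: "full_lattice L" and bf: "basis_family V I" "V ` I \<subseteq> L" and i: "i \<in> I"
    and d: "linear d" "\<And>y. dual_basis V I i y = d y / (of_int m * d e)"
    and e: "e \<in> L" "d e \<noteq> 0" "\<And>y. y \<in> L \<Longrightarrow> \<exists>m::int. d y = of_int m * d e" and m: "m \<noteq> 0"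
  shows "card (quot_group L V I) = nat \<bar>m\<bar> * card (coset (edge_lattice V (I - {i})) ` {y \<in> L. d y = 0})"
proof -
  let ?WI = "edge_lattice V I" and ?WJ = "edge_lattice V (I - {i})"
  let ?T = "coset ?WJ ` {y \<in> L. d y = 0}"
  have sL: "subgrp L" by (rule subgrp_full_lattice[OF L])
  have WI: "?WI \<subseteq> L" by (rule edge_lattice_subset[OF L bf(2)])
  have d0: "dual_basis V I i y = 0 \<longleftrightarrow> d y = 0" for y using d(2) e(2) m by simp
  have WJ: "?WJ = {y \<in> ?WI. d y = 0}" using edge_lattice_face[OF bf(1) i] d0 by simp
  have rep: "rep t \<in> L" "d (rep t) = 0" "t = coset ?WJ (rep t)" if "t \<in> ?T" for t
  proof -
    from that obtain y where y: "y \<in> L" "d y = 0" "t = coset ?WJ y" by auto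
    have r: "rep t - y \<in> ?WJ" unfolding y(3) by (rule rep_coset[OF subgrp_edge_lattice])
    then show "rep t \<in> L" using y(1) WI subgrp_add[OF sL, of "rep t - y" y] WJ by auto
    show "d (rep t) = 0" using r y(2) by (simp add: WJ linear_diff[OF d(1)])
    show "t = coset ?WJ (rep t)"
      using r y(3) coset_eq_iff[OF subgrp_edge_lattice] by metis
  qed
  have de: "dual_basis V I i (V i) = 1" using dual_basis_eq[OF bf(1) i i] by simp
  then have dV: "d (V i) = of_int m * d e" using d(2)[of "V i"] e(2) m by (simp add: field_simps)
  have int: "d y / (of_int m * d e) \<in> \<int>" if "y \<in> ?WI" for y
    using that i by (simp add: edge_lattice_iff[OF bf(1)] d(2)[symmetric])
  \<comment> \<open>\<open>V i\<close> has \<open>m\<close> times the height of \<open>e\<close>. A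
    class of \<open>H_I\<close> thus amounts to a height modulo \<open>abs m\<close>, in units of
    \<open>d e\<close>, together with a class of the facet group.\<close>
  let ?f = "\<lambda>(l, t). coset ?WI (rep t + of_int l *\<^sub>R e)"
  have "bij_betw ?f ({0..<\<bar>m\<bar>} \<times> ?T) (quot_group L V I)"
    unfolding bij_betw_def
  proof (intro conjI equalityI subsetI)
    show "inj_on ?f ({0..<\<bar>m\<bar>} \<times> ?T)"
    proof (rule inj_onI)
      fix p p' assume p: "p \<in> {0..<\<bar>m\<bar>} \<times> ?T" "p' \<in> {0..<\<bar>m\<bar>} \<times> ?T" and "?f p = ?f p'"
      obtain l t l' t' where pt: "p = (l, t)" "p' = (l', t')" by (metis surj_pair)
      have lt: "l \<in> {0..<\<bar>m\<bar>}" "t \<in> ?T" "l' \<in> {0..<\<bar>m\<bar>}" "t' \<in> ?T" using p pt by auto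
      have w: "(rep t + of_int l *\<^sub>R e) - (rep t' + of_int l' *\<^sub>R e) \<in> ?WI" (is "?w \<in> _")
        using \<open>?f p = ?f p'\<close> by (simp add: pt coset_eq_iff[OF subgrp_edge_lattice])
      have dw: "d ?w = of_int (l - l') * d e"
        using rep(2)[OF lt(2)] rep(2)[OF lt(4)]
        by (simp add: linear_diff[OF d(1)] linear_add[OF d(1)] linear_cmul[OF d(1)] algebra_simps)
      obtain c :: int where "d ?w / (of_int m * d e) = of_int c" using int[OF w] by (auto elim: Ints_cases)
      then have "d ?w = of_int (c * m) * d e" using e(2) m by (simp add: field_simps)
      then have "of_int (l - l') = (of_int (c * m) :: real)" using e(2) dw by simp
      then have c: "l - l' = c * m" by linarith
      have "\<bar>l - l'\<bar> < \<bar>m\<bar>" using lt by auto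
      then have "c = 0" using c m by (metis abs_mult dvd_imp_le_int dvd_triv_right linorder_not_le mult_eq_0_iff)
      then have l: "l = l'" using c by simp
      then have "rep t - rep t' \<in> ?WJ" using w rep(2)[OF lt(2)] rep(2)[OF lt(4)]
        by (simp add: WJ linear_diff[OF d(1)])
      then have "t = t'" using rep(3)[OF lt(2)] rep(3)[OF lt(4)] coset_eq_iff[OF subgrp_edge_lattice] by metis
      then show "p = p'" using l pt by simp
    qed
  next
    fix h assume "h \<in> ?f ` ({0..<\<bar>m\<bar>} \<times> ?T)"
    then obtain l t where "t \<in> ?T" "h = coset ?WI (rep t + of_int l *\<^sub>R e)" by auto
    then show "h \<in> quot_group L V I"
      using subgrp_add[OF sL rep(1) full_lattice_of_int_scaleR[OF L e(1)]] by (auto simp: quot_group_def)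
  next
    fix h assume "h \<in> quot_group L V I"
    then obtain y where y: "y \<in> L" "h = coset ?WI y" by (auto simp: quot_group_def)
    obtain m' :: int where m': "d y = of_int m' * d e" using e(3) y(1) by blast
    \<comment> \<open>\<open>m\<close> is negative if \<open>V i\<close> and \<open>e\<close> lie on
      opposite sides of the hyperplane; \<open>sgn m\<close> turns the quotient by
      \<open>abs m\<close> into one by \<open>m\<close>.\<close>
    define l q where "l = m' mod \<bar>m\<bar>" and "q = sgn m * (m' div \<bar>m\<bar>)"
    have "m' = l + (m' div \<bar>m\<bar>) * \<bar>m\<bar>" by (simp add: l_def)
    then have lq: "m' = l + q * m" unfolding q_def by (simp add: abs_sgn mult_ac)
    define y' where "y' = y - of_int q *\<^sub>R V i - of_int l *\<^sub>R e"
    have Vi: "V i \<in> L" "V i \<in> ?WI" using bf(2) i by (auto simp: edge_lattice_def intro: group_closure.base)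
    have "y' \<in> L" unfolding y'_def
      by (intro subgrp_diff[OF sL] y full_lattice_of_int_scaleR[OF L] e Vi)
    moreover have "d y' = 0"
      unfolding y'_def
      by (simp only: linear_diff[OF d(1)] linear_cmul[OF d(1)] m' dV lq) (simp add: algebra_simps)
    ultimately have T: "coset ?WJ y' \<in> ?T" by blast
    have "rep (coset ?WJ y') - y' \<in> ?WI"
      using rep_coset[OF subgrp_edge_lattice, of V "I - {i}" y'] WJ by blast
    moreover have "of_int q *\<^sub>R V i \<in> ?WI"
      using Vi(2) unfolding edge_lattice_def by (rule group_closure_of_int_scaleR)
    ultimately have "(rep (coset ?WJ y') - y') - of_int q *\<^sub>R V i \<in> ?WI"
      by (rule subgrp_diff[OF subgrp_edge_lattice])
    then have "coset ?WI (rep (coset ?WJ y') + of_int l *\<^sub>R e) = h"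
      by (simp add: y(2) coset_eq_iff[OF subgrp_edge_lattice] y'_def algebra_simps)
    moreover have "l \<in> {0..<\<bar>m\<bar>}" using m by (simp add: l_def)
    ultimately show "h \<in> ?f ` ({0..<\<bar>m\<bar>} \<times> ?T)"
      using T by (intro image_eqI[of _ _ "(l, coset ?WJ y')"]) auto
  qed
  from bij_betw_same_card[OF this] show ?thesis by (simp add: card_cartesian_product)
qed

text \<open>The order of the group is \<open>abs m\<close> times that of the facet group, while the
  dual vector is the reference height \<open>d\<close> divided by \<open>m * d e\<close>. In the
  product \<open>m\<close> cancels, and what remains depends on the wall and \<open>v\<close>
  only.\<close>

lemma card_quot_group_height:
  assumes L: "full_lattice L"
  shows "\<exists>c. \<forall>I i. basis_family V I \<and> V ` I \<subseteq> L \<and> i \<in> I \<and> I - {i} = J \<longrightarrow>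
           of_nat (card (quot_group L V I)) * \<bar>dual_basis V I i v\<bar> = (c :: real)"
proof (cases "\<exists>I i. basis_family V I \<and> V ` I \<subseteq> L \<and> i \<in> I \<and> I - {i} = J")
  case True
  then obtain I0 i0 where 0: "basis_family V I0" "V ` I0 \<subseteq> L" "i0 \<in> I0" "I0 - {i0} = J" by blast
  define d where "d = dual_basis V I0 i0"
  have lin: "linear d" unfolding d_def by (rule linear_dual_basis[OF 0(1,3)])
  obtain e where e: "e \<in> L" "d e > 0" "\<And>y. y \<in> L \<Longrightarrow> \<exists>m::int. d y = of_int m * d e"
    using lattice_height_generator[OF L 0(1-3)] unfolding d_def by blast
  define K where "K = card (coset (edge_lattice V J) ` {y \<in> L. d y = 0})"
  have "of_nat (card (quot_group L V I)) * \<bar>dual_basis V I i v\<bar> = of_nat K * \<bar>d v\<bar> / d e"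
    if I: "basis_family V I" "V ` I \<subseteq> L" "i \<in> I" "I - {i} = J" for I i
  proof -
    have pr: "d y = d (V i) * dual_basis V I i y" for y
      unfolding d_def by (rule dual_basis_face_proportional[OF I(1,3) 0(1,3) trans[OF I(4) 0(4)[symmetric]]])
    have "d (V i0) = 1" using dual_basis_eq[OF 0(1,3,3)] by (simp add: d_def)
    then have nz: "d (V i) \<noteq> 0" using pr[of "V i0"] by auto
    have "V i \<in> L" using I by auto
    then obtain m :: int where m: "d (V i) = of_int m * d e" using e(3) by blast
    then have "m \<noteq> 0" using nz by auto
    have db: "dual_basis V I i y = d y / (of_int m * d e)" for y
      using pr[of y] nz m by (simp add: field_simps)
    have "card (quot_group L V I) = nat \<bar>m\<bar> * K"
      using card_quot_group_face[OF L I(1-3) lin db e(1) _ e(3) \<open>m \<noteq> 0\<close>] e(2) I(4) by (simp add: K_def)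
    then show ?thesis using \<open>m \<noteq> 0\<close> e(2) by (simp add: db abs_mult field_simps)
  qed
  then show ?thesis by blast
qed blast

section \<open>Cones around a wall and their projections\<close>

lemma finite_top_simps: "simplicial_multi_fan L \<Delta> \<Longrightarrow> finite (top_simps \<Delta>)"
  unfolding simplicial_multi_fan_def top_simps_def ksimps_def by (elim conjE) (rule finite_Collect_conjI[OF disjI1], simp)

lemma simplicial_span_cone:
  fixes \<Delta> :: "('i, 'a::euclidean_space) multi_fan"
  assumes "simplicial_multi_fan L \<Delta>" "edge_vectors L \<Delta> V" "J \<in> simps \<Delta>"
  shows "span (cone_of \<Delta> J) = span (V ` J)" "j \<in> J \<Longrightarrow> V j \<in> cone_of \<Delta> J"
    "W \<in> {S. convex_cone S} \<Longrightarrow> V ` J \<subseteq> W \<Longrightarrow> cone_of \<Delta> J \<subseteq> W"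
proof -
  have V: "cone_of \<Delta> {j} = convex_cone hull {V j}" if "j \<in> J" for j
  proof -
    have "j \<in> verts \<Delta>" using simplicial_cones(3)[OF assms(1,3), of "{j}"] that by (simp add: verts_def)
    then show ?thesis using assms(2) by (auto simp: edge_vectors_def)
  qed
  note cone = simplicial_cones(2)[OF assms(1,3)]
  show *: "cone_of \<Delta> J \<subseteq> W" if W: "W \<in> {S. convex_cone S}" "V ` J \<subseteq> W" for W
    unfolding cone
  proof (rule hull_minimal)
    show "(\<Union>j\<in>J. cone_of \<Delta> {j}) \<subseteq> W"
    proof (rule UN_least)
      fix j assume "j \<in> J"
      then show "cone_of \<Delta> {j} \<subseteq> W"
        using W V hull_minimal[of "{V j}" W convex_cone] by auto
    qed
  qed (use W in auto)
  show V': "V j \<in> cone_of \<Delta> J" if "j \<in> J" for j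
  proof -
    have "V j \<in> convex_cone hull {V j}" by (simp add: hull_inc)
    then show ?thesis unfolding cone using V[OF that] that by (auto intro!: hull_inc)
  qed
  have "cone_of \<Delta> J \<subseteq> span (V ` J)"
    by (intro *) (auto simp: convex_cone_span intro: span_base)
  moreover have "V ` J \<subseteq> span (cone_of \<Delta> J)" using V' by (auto intro: span_base)
  ultimately show "span (cone_of \<Delta> J) = span (V ` J)"
    by (intro equalityI span_minimal subspace_span)
qed

text \<open>A vanishing coordinate would put \<open>v\<close> into the span of a facet. Along a
  generic direction the argument of every factor therefore moves, which isolates the poles.\<close>

lemma generic_dual_basis_nonzero:
  fixes \<Delta> :: "('i, 'a::euclidean_space) multi_fan"
  assumes fan: "simplicial_multi_fan L \<Delta>" and edges: "edge_vectors L \<Delta> V"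
    and v: "generic \<Delta> v" and I: "I \<in> top_simps \<Delta>" "i \<in> I"
  shows "dual_basis V I i v \<noteq> 0"
proof
  note top = simplicial_top[OF fan edges]
  assume "dual_basis V I i v = 0"
  have J: "I - {i} \<in> simps \<Delta>" using simplicial_cones(3)[OF fan top(5)[OF I(1)]] by blast
  have "v \<in> span (cone_of \<Delta> (I - {i}))"
    using \<open>dual_basis V I i v = 0\<close> span_face[OF top(1)[OF I(1)] I(2)] simplicial_span_cone(1)[OF fan edges J] by simp
  moreover have "dim (cone_of \<Delta> (I - {i})) < DIM('a)"
    using simplicial_cones(1)[OF fan J] top(3,4)[OF I(1)] I(2) card_Diff1_less by metis
  ultimately show False using v J by (auto simp: generic_def)
qed

lemma proj_image_iff:
  assumes "subspace S" "span (cone_of \<Delta> K) \<subseteq> S"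
  shows "proj \<Delta> K v \<in> proj \<Delta> K ` S \<longleftrightarrow> v \<in> S"
proof
  assume "proj \<Delta> K v \<in> proj \<Delta> K ` S"
  then obtain s where s: "s \<in> S" "coset (span (cone_of \<Delta> K)) v = coset (span (cone_of \<Delta> K)) s"
    by (auto simp: proj_def)
  have "subgrp (span (cone_of \<Delta> K))" by (auto simp: subgrp_def span_zero span_diff)
  then have "v - s \<in> S" using s(2) assms(2) by (auto simp: coset_eq_iff)
  then show "v \<in> S" using subspace_add[OF assms(1) _ s(1), of "v - s"] by simp
qed blast

text \<open>
  Pre-completeness of the projected multi-fan of a wall says that the weights of the maximal cones
  on its two sides have the same sum; for \<open>card J < DIM('a) - 1\<close> the sum is empty.
\<close>

lemma complete_wall_balance:
  fixes \<Delta> :: "('i, 'a::euclidean_space) multi_fan"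
  assumes \<Delta>: "simplicial_multi_fan L \<Delta>" and V: "edge_vectors L \<Delta> V" and "complete_multi_fan \<Delta>"
    and v: "generic \<Delta> v" and J: "J \<in> simps \<Delta>" "card J < DIM('a)"
  shows "(\<Sum>(I, i) | I \<in> top_simps \<Delta> \<and> i \<in> I \<and> I - {i} = J. of_int (weight \<Delta> I) * sgn (dual_basis V I i v)) = 0"
proof -
  let ?T = "{(I, i). I \<in> top_simps \<Delta> \<and> i \<in> I \<and> I - {i} = J}"
  let ?W = "span (cone_of \<Delta> J)"
  note top = simplicial_top[OF \<Delta> V]
  have subW: "subgrp ?W" by (auto simp: subgrp_def span_zero span_diff)
  have nz: "dual_basis V I i v \<noteq> 0" if "(I, i) \<in> ?T" for I i
    using that by (intro generic_dual_basis_nonzero[OF \<Delta> V v]) auto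
  \<comment> \<open>A general multiple \<open>c\<close> is allowed because \<open>v\<close> and
    \<open>- v\<close> will probe the two sides of the wall.\<close>
  have gen: "proj_generic \<Delta> J (proj \<Delta> J (c *\<^sub>R v))" if "c \<noteq> 0" for c
    unfolding proj_generic_def
  proof (intro conjI ballI impI)
    fix J' assume J': "J' \<in> simps \<Delta>" "J \<subseteq> J' \<and> dim (cone_of \<Delta> J') < DIM('a)"
    have "c *\<^sub>R v \<notin> span (cone_of \<Delta> J')"
      using v J' that span_scale[of "c *\<^sub>R v" _ "inverse c"] by (auto simp: generic_def)
    moreover have "?W \<subseteq> span (cone_of \<Delta> J')"
      using simplicial_cones(3)[OF \<Delta> J'(1), of J] J' by (auto intro!: span_mono)
    ultimately show "proj \<Delta> J (c *\<^sub>R v) \<notin> proj \<Delta> J ` span (cone_of \<Delta> J')"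
      by (subst proj_image_iff) auto
  qed auto
  \<comment> \<open>Modulo the span of the wall, the cone of \<open>I\<close> is the half-line
    directed by \<open>V i\<close>, so only the sign of the coordinate of index \<open>i\<close>
    matters.\<close>
  have side: "proj \<Delta> J (c *\<^sub>R v) \<in> proj \<Delta> J ` cone_of \<Delta> I \<longleftrightarrow> c * dual_basis V I i v > 0"
    if Ii: "(I, i) \<in> ?T" and c: "c \<noteq> 0" for I i c
  proof -
    let ?d = "dual_basis V I i"
    have I: "I \<in> top_simps \<Delta>" "i \<in> I" "I - {i} = J" using Ii by auto
    have lin: "linear ?d" by (rule linear_dual_basis[OF top(1)[OF I(1)] I(2)])
    have W: "?W = {y. ?d y = 0}"
      using simplicial_span_cone(1)[OF \<Delta> V J(1)] span_face[OF top(1)[OF I(1)] I(2)] I(3) by simp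
    have dI: "?d j \<ge> 0" if "j \<in> cone_of \<Delta> I" for j
    proof -
      have "cone_of \<Delta> I \<subseteq> {y. ?d y \<ge> 0}"
      proof (rule simplicial_span_cone(3)[OF \<Delta> V top(5)[OF I(1)]])
        show "{y. ?d y \<ge> 0} \<in> {S. convex_cone S}"
          by (auto simp: convex_cone_iff linear_0[OF lin] linear_add[OF lin] linear_cmul[OF lin])
        show "V ` I \<subseteq> {y. ?d y \<ge> 0}"
          by (auto simp: dual_basis_eq[OF top(1)[OF I(1)] I(2)])
      qed
      then show ?thesis using that by auto
    qed
    show ?thesis
    proof
      assume "proj \<Delta> J (c *\<^sub>R v) \<in> proj \<Delta> J ` cone_of \<Delta> I"
      then obtain y where y: "y \<in> cone_of \<Delta> I" "c *\<^sub>R v - y \<in> ?W"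
        by (auto simp: proj_def coset_eq_iff[OF subW])
      then have "c * ?d v = ?d y" by (simp add: W linear_diff[OF lin] linear_cmul[OF lin])
      then have "c * ?d v \<ge> 0" using dI[OF y(1)] by simp
      then show "c * ?d v > 0" using nz[OF Ii] c by (simp add: less_le)
    next
      assume pos: "c * ?d v > 0"
      have "(c * ?d v) *\<^sub>R V i \<in> cone_of \<Delta> I"
      proof -
        have "V i \<in> cone_of \<Delta> I" by (rule simplicial_span_cone(2)[OF \<Delta> V top(5)[OF I(1)] I(2)])
        then show ?thesis using pos simplicial_cones(2)[OF \<Delta> top(5)[OF I(1)]]
          by (metis convex_cone_hull_mul less_imp_le)
      qed
      moreover have "c *\<^sub>R v - (c * ?d v) *\<^sub>R V i \<in> ?W"
        using dual_basis_eq[OF top(1)[OF I(1)] I(2) I(2)]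
        by (simp add: W linear_diff[OF lin] linear_cmul[OF lin])
      ultimately show "proj \<Delta> J (c *\<^sub>R v) \<in> proj \<Delta> J ` cone_of \<Delta> I"
        by (auto simp: proj_def image_iff coset_eq_iff[OF subW] intro!: bexI[of _ "(c * ?d v) *\<^sub>R V i"])
    qed
  qed
  have card_top: "card I = DIM('a)" "finite I" if "I \<in> top_simps \<Delta>" for I using top that by auto
  obtain d0 where d0: "\<And>c. proj_generic \<Delta> J c \<Longrightarrow> proj_degree_at \<Delta> J c = d0"
    using \<open>complete_multi_fan \<Delta>\<close> J(1) unfolding complete_multi_fan_def proj_pre_complete_def by blast
  have cardJ: "\<exists>i. (I, i) \<in> ?T" if I: "I \<in> top_simps \<Delta>" "J \<subseteq> I" and ne: "Suc (card J) = DIM('a)" for I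
  proof -
    have "card (I - J) = 1"
      using I ne card_top[OF I(1)] by (simp add: card_Diff_subset finite_subset)
    then obtain i where "I - J = {i}" by (auto simp: card_1_singleton_iff)
    then show ?thesis using I by (intro exI[of _ i]) auto
  qed
  have deg: "of_int d0 = (\<Sum>(I, i)\<in>?T. if c * dual_basis V I i v > 0 then of_int (weight \<Delta> I) else (0::real))"
    if c: "c \<noteq> 0" and ne: "Suc (card J) = DIM('a)" for c
  proof -
    let ?S = "{I. I \<in> top_simps \<Delta> \<and> J \<subseteq> I \<and> proj \<Delta> J (c *\<^sub>R v) \<in> proj \<Delta> J ` cone_of \<Delta> I}"
    let ?T' = "{(I, i) \<in> ?T. c * dual_basis V I i v > 0}"
    have finT: "finite ?T"
    proof (rule finite_subset)
      show "?T \<subseteq> Sigma (top_simps \<Delta>) (\<lambda>I. I)" by auto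
      show "finite (Sigma (top_simps \<Delta>) (\<lambda>I. I))"
        by (intro finite_SigmaI finite_top_simps[OF \<Delta>] card_top)
    qed
    have bij: "bij_betw fst ?T' ?S"
      unfolding bij_betw_def
    proof (intro conjI equalityI subsetI)
      show "inj_on fst ?T'" by (rule inj_onI) auto
      fix I assume "I \<in> fst ` ?T'"
      then obtain i where i: "(I, i) \<in> ?T" "c * dual_basis V I i v > 0" by auto
      then show "I \<in> ?S" using side[OF i(1) c] by auto
    next
      fix I assume I: "I \<in> ?S"
      then obtain i where i: "(I, i) \<in> ?T" using cardJ[OF _ _ ne] by blast
      then show "I \<in> fst ` ?T'" using side[OF i c] I by force
    qed
    have "of_int d0 = (of_int (proj_degree_at \<Delta> J (proj \<Delta> J (c *\<^sub>R v))) :: real)"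
      using d0[OF gen[OF c]] by simp
    also have "\<dots> = (\<Sum>I\<in>?S. of_int (weight \<Delta> I))" by (simp add: proj_degree_at_def)
    also have "\<dots> = (\<Sum>p\<in>?T'. of_int (weight \<Delta> (fst p)))"
      using sum.reindex_bij_betw[OF bij, of "\<lambda>I. of_int (weight \<Delta> I) :: real"] by simp
    also have "\<dots> = (\<Sum>p\<in>?T. if c * dual_basis V (fst p) (snd p) v > 0 then of_int (weight \<Delta> (fst p)) else 0)"
    proof -
      have "?T' = {p \<in> ?T. c * dual_basis V (fst p) (snd p) v > 0}" by auto
      then show ?thesis by (simp only: sum.inter_filter[OF finT])
    qed
    finally show ?thesis by (simp add: case_prod_unfold)
  qed
  show ?thesis
  proof (cases "?T = {}")
    case True
    then show ?thesis by (simp only: sum.empty)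
  next
    case False
    then obtain I i where Ii: "(I, i) \<in> ?T" by auto
    then have ne: "Suc (card J) = DIM('a)" using card_top[of I] by (auto simp: card_Suc_Diff1)
    \<comment> \<open>The sign is the indicator of the side of \<open>v\<close> minus that of the
      side of \<open>- v\<close>; weighted by either indicator, the sum is the degree
      \<open>d0\<close>.\<close>
    have "(\<Sum>(I, i)\<in>?T. of_int (weight \<Delta> I) * sgn (dual_basis V I i v))
        = (\<Sum>(I, i)\<in>?T. (if 1 * dual_basis V I i v > 0 then of_int (weight \<Delta> I) else 0)
            - (if (-1) * dual_basis V I i v > 0 then of_int (weight \<Delta> I) else (0::real)))"
      using nz by (intro sum.cong refl) (auto simp: sgn_if)
    also have "\<dots> = of_int d0 - of_int d0"
      unfolding case_prod_unfold sum_subtractf using deg[of 1, OF _ ne] deg[of "-1", OF _ ne]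
      by (simp add: case_prod_unfold)
    finally show ?thesis by simp
  qed
qed

section \<open>Periods and residues\<close>

text \<open>\<open>x\<close> and \<open>u\<close> are the witnesses of Cartier divisibility; fixing
  them fixes the functional \<open>u\<close> that governs all multipliers. \<tau> is fixed too,
  since the analysis takes place on lines in the complexified space.\<close>

locale divisible_fan =
  fixes L :: "'a::euclidean_space set"
    and \<Delta> :: "('i, 'a) multi_fan"
    and V :: "'i \<Rightarrow> 'a"
    and N k :: nat
    and \<tau> :: complex
    and x :: "'i \<Rightarrow>\<^sub>0 int"
    and u :: "'a \<Rightarrow> real"
  assumes lattice: "full_lattice L"
    and fan: "simplicial_multi_fan L \<Delta>"
    and complete: "complete_multi_fan \<Delta>"
    and edges: "edge_vectors L \<Delta> V"
    and k: "0 < k" "k < N"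
    and Cartier: "T_Cartier L \<Delta> V x"
    and u: "u \<in> dual_lattice L"
    and chern: "c1T \<Delta> = frag_cmul (int N) x + embed_dual \<Delta> V u"
    and tau: "Im \<tau> > 0"
begin

abbreviation \<sigma> :: complex where "\<sigma> \<equiv> of_nat k / of_nat N"
abbreviation P :: "complex \<Rightarrow> complex" where "P \<equiv> phi_theta \<tau> \<sigma>"
abbreviation d :: "'i set \<Rightarrow> 'i \<Rightarrow> 'a \<Rightarrow> real" where "d \<equiv> dual_basis V"
abbreviation W :: "'i set \<Rightarrow> 'a set" where "W \<equiv> edge_lattice V"
abbreviation Q :: "'i set \<Rightarrow> 'a set set" where "Q \<equiv> quot_group L V"
abbreviation T :: "'i set set" where "T \<equiv> top_simps \<Delta>"

lemmas top = simplicial_top[OF fan edges]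
lemmas subgrp_L = subgrp_full_lattice[OF lattice]
lemmas subgrp_W = subgrp_edge_lattice[of V]

lemma W_subset: "I \<in> T \<Longrightarrow> W I \<subseteq> L"
  using edge_lattice_subset[OF lattice top(2)] by blast

lemma finite_T: "finite T"
  by (rule finite_top_simps[OF fan])

lemma finite_Q: "I \<in> T \<Longrightarrow> finite (Q I)"
  using finite_quot_group[OF lattice top(1,2)] by blast

lemma linear_d: "I \<in> T \<Longrightarrow> i \<in> I \<Longrightarrow> linear (d I i)"
  using linear_dual_basis[OF top(1)] by blast

lemma d_add: "I \<in> T \<Longrightarrow> i \<in> I \<Longrightarrow> d I i (y + y') = d I i y + d I i y'"
  and d_diff: "I \<in> T \<Longrightarrow> i \<in> I \<Longrightarrow> d I i (y - y') = d I i y - d I i y'"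
  and d_scale: "I \<in> T \<Longrightarrow> i \<in> I \<Longrightarrow> d I i (c *\<^sub>R y) = c * d I i y"
  using linear_d[of I i] by (simp_all add: linear_add linear_diff linear_cmul)

lemma d_W_int: "I \<in> T \<Longrightarrow> i \<in> I \<Longrightarrow> w \<in> W I \<Longrightarrow> d I i w \<in> \<int>"
  using edge_lattice_iff[OF top(1)] by blast

section \<open>Multipliers of lattice translations\<close>

lemma chern_coeff:
  assumes "i \<in> verts \<Delta>"
  shows "1 = of_nat N * of_int (Poly_Mapping.lookup x i) + u (V i)"
proof -
  have "finite (simps \<Delta>)" using fan unfolding simplicial_multi_fan_def by (elim conjE)
  then have fin: "finite (verts \<Delta>)"
    unfolding verts_def by (rule finite_vimageI[of _ "\<lambda>i. {i}", unfolded vimage_def]) (auto simp: inj_on_def)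
  have l: "Poly_Mapping.lookup (frag_of j :: 'i \<Rightarrow>\<^sub>0 int) i = (if j = i then 1 else 0)" for j
    by (simp add: lookup_single when_def)
  have "Poly_Mapping.lookup (c1T \<Delta>) i = 1"
    using fin assms by (simp add: c1T_def lookup_sum l)
  moreover have "Poly_Mapping.lookup (embed_dual \<Delta> V u) i = \<lfloor>u (V i)\<rfloor>"
    using fin assms by (simp add: embed_dual_def lookup_sum l if_distrib cong: if_cong)
  ultimately have "1 = int N * Poly_Mapping.lookup x i + \<lfloor>u (V i)\<rfloor>"
    using arg_cong[OF chern, of "\<lambda>f. Poly_Mapping.lookup f i"] by (simp add: lookup_add)
  moreover have "u (V i) \<in> \<int>"
    using u edges assms by (auto simp: dual_lattice_def edge_vectors_def)
  ultimately show ?thesis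
    by (metis of_int_1 of_int_add of_int_mult of_int_of_nat_eq floor_of_int Ints_cases)
qed

text \<open>The multiple of \<open>N\<close> in the sum of the dual basis meets the denominator of
  \<sigma> and becomes an integer, which \<open>ex\<close> does not see. What is left does not
  depend on \<open>I\<close>.\<close>

lemma ex_sum_dual:
  assumes I: "I \<in> T" and y: "y \<in> L"
  shows "(\<Prod>i\<in>I. ex (of_real (d I i y) * \<sigma>)) = ex (of_real (u y) * \<sigma>)"
proof -
  have lin: "linear u" using u by (simp add: dual_lattice_def)
  have vert: "i \<in> verts \<Delta>" if "i \<in> I" for i
    using simplicial_cones(3)[OF fan top(5)[OF I], of "{i}"] that by (simp add: verts_def)
  have "(\<Sum>i\<in>I. d I i y) = (\<Sum>i\<in>I. d I i y * (of_nat N * of_int (Poly_Mapping.lookup x i) + u (V i)))"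
    using chern_coeff vert by (intro sum.cong refl) (metis mult.right_neutral)
  also have "\<dots> = of_nat N * restrict_to V I x y + u y"
    using linear_basis_expansion[OF top(1)[OF I] lin, of y]
    by (simp add: restrict_to_def sum.distrib sum_distrib_left algebra_simps)
  finally have s: "(\<Sum>i\<in>I. d I i y) = of_nat N * restrict_to V I x y + u y" .
  have "restrict_to V I x y \<in> \<int>"
    using Cartier I y by (auto simp: T_Cartier_def dual_lattice_def)
  then obtain m :: int where m: "restrict_to V I x y = of_int m" by (auto elim: Ints_cases)
  have "(\<Prod>i\<in>I. ex (of_real (d I i y) * \<sigma>)) = ex (of_real (\<Sum>i\<in>I. d I i y) * \<sigma>)"
    using top(4)[OF I] by (simp only: ex_sum[symmetric] of_real_sum sum_distrib_right)
  also have "of_real (\<Sum>i\<in>I. d I i y) * \<sigma> = of_int (int k * m) + of_real (u y) * \<sigma>"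
    unfolding s m using k by (simp add: field_simps)
  also have "ex \<dots> = ex (of_real (u y) * \<sigma>)"
    by (simp only: ex_add ex_of_int mult_1)
  finally show ?thesis .
qed

text \<open>\<xi> stands for the pairing of a dual basis vector with a point of the complexified
  space. Such points are represented by their coordinates only, since the type \<open>'a\<close> is
  real.\<close>

definition ffactor :: "'i set \<Rightarrow> 'i \<Rightarrow> complex \<Rightarrow> 'a \<Rightarrow> 'a \<Rightarrow> complex" where
  "ffactor I i \<xi> h1 h2 =
     ex (of_real (d I i h1) * \<sigma>) * P (- (\<xi> - \<tau> * of_real (d I i h1) + of_real (d I i h2)))"

text \<open>A change of \<open>h1\<close> by the edge lattice shifts the argument of
  \<open>P\<close> by an integer multiple of \<tau>; the exponential in front undoes the resulting
  multiplier. So already each single factor is independent of representatives.\<close>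

lemma ffactor_shift:
  assumes I: "I \<in> T" "i \<in> I" and w: "w1 \<in> W I" "w2 \<in> W I"
  shows "ffactor I i \<xi> (h1 + w1) (h2 + w2) = ffactor I i \<xi> h1 h2"
proof -
  obtain m1 m2 :: int where m: "d I i w1 = of_int m1" "d I i w2 = of_int m2"
    using d_W_int[OF I w(1)] d_W_int[OF I w(2)] by (auto elim!: Ints_cases)
  let ?a = "- (\<xi> - \<tau> * of_real (d I i h1) + of_real (d I i h2))"
  have a: "- (\<xi> - \<tau> * of_real (d I i (h1 + w1)) + of_real (d I i (h2 + w2)))
      = ?a + (of_int (- m2) + of_int m1 * \<tau>)"
    by (simp add: d_add[OF I] m algebra_simps)
  have "of_real (d I i (h1 + w1)) * \<sigma> + - of_int m1 * \<sigma> = of_real (d I i h1) * \<sigma>"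
    by (simp add: d_add[OF I] m algebra_simps)
  then have e: "ex (of_real (d I i (h1 + w1)) * \<sigma>) * ex (- of_int m1 * \<sigma>) = ex (of_real (d I i h1) * \<sigma>)"
    by (simp only: ex_add[symmetric])
  show ?thesis
    unfolding ffactor_def a phi_theta_shift[OF tau] e[symmetric] by (simp only: mult_ac)
qed

lemma ffactor_add_1:
  assumes I: "I \<in> T" "i \<in> I"
  shows "ffactor I i (\<xi> + of_real (d I i y)) h1 h2 = ffactor I i \<xi> h1 (h2 + y)"
  unfolding ffactor_def by (simp add: d_add[OF I] algebra_simps)

lemma ffactor_add_tau:
  assumes I: "I \<in> T" "i \<in> I"
  shows "ffactor I i (\<xi> + \<tau> * of_real (d I i y)) h1 h2
    = ex (of_real (d I i y) * \<sigma>) * ffactor I i \<xi> (h1 - y) h2"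
proof -
  have "of_real (d I i h1) * \<sigma> = of_real (d I i y) * \<sigma> + of_real (d I i (h1 - y)) * \<sigma>"
    by (simp add: d_diff[OF I] algebra_simps)
  then have "ex (of_real (d I i h1) * \<sigma>) = ex (of_real (d I i y) * \<sigma>) * ex (of_real (d I i (h1 - y)) * \<sigma>)"
    by (simp only: ex_add)
  moreover have "\<xi> + \<tau> * of_real (d I i y) - \<tau> * of_real (d I i h1) = \<xi> - \<tau> * of_real (d I i (h1 - y))"
    by (simp add: d_diff[OF I] algebra_simps)
  ultimately show ?thesis unfolding ffactor_def by (simp only: mult_ac)
qed

definition fsum :: "('i set \<Rightarrow> 'i \<Rightarrow> complex) \<Rightarrow> complex" where
  "fsum \<xi> = (\<Sum>I\<in>T. of_int (weight \<Delta> I) / of_nat (card (Q I)) *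
     (\<Sum>g1\<in>Q I. \<Sum>g2\<in>Q I. \<Prod>i\<in>I. ffactor I i (\<xi> I i) (rep g1) (rep g2)))"

lemma sum_Q_shift:
  assumes I: "I \<in> T" and y: "y \<in> L" and \<Psi>: "\<And>h w. w \<in> W I \<Longrightarrow> \<Psi> (h + w) = \<Psi> h"
  shows "(\<Sum>g\<in>Q I. \<Psi> (rep g)) = (\<Sum>g\<in>Q I. \<Psi> (rep g + y))"
  unfolding quot_group_def
proof (rule sum_coset_reindex[OF subgrp_W subgrp_W])
  fix h assume h: "h \<in> L"
  show "h + y \<in> L" using subgrp_add[OF subgrp_L h y] .
  show "\<exists>h'\<in>L. h' + y - h \<in> W I"
    using subgrp_diff[OF subgrp_L h y] subgrp_0[OF subgrp_W] by (intro bexI[of _ "h - y"]) auto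
  fix w assume w: "w \<in> W I"
  show "h + w \<in> L" using subgrp_add[OF subgrp_L h] W_subset[OF I] w by blast
  show "\<Psi> (h + w) = \<Psi> h" using \<Psi>[OF w] .
qed auto

lemma fsum_add_1:
  assumes y: "y \<in> L"
  shows "fsum (\<lambda>I i. \<xi> I i + of_real (d I i y)) = fsum \<xi>"
proof -
  have "(\<Sum>g1\<in>Q I. \<Sum>g2\<in>Q I. \<Prod>i\<in>I. ffactor I i (\<xi> I i + of_real (d I i y)) (rep g1) (rep g2))
      = (\<Sum>g1\<in>Q I. \<Sum>g2\<in>Q I. \<Prod>i\<in>I. ffactor I i (\<xi> I i) (rep g1) (rep g2))"
    if I: "I \<in> T" for I
  proof (rule sum.cong[OF refl])
    fix g1
    have "(\<Prod>i\<in>I. ffactor I i (\<xi> I i) (rep g1) (h + w)) = (\<Prod>i\<in>I. ffactor I i (\<xi> I i) (rep g1) h)"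
      if "w \<in> W I" for h w
      using ffactor_shift[OF I _ subgrp_0[OF subgrp_W] that, of _ _ "rep g1" h] by (intro prod.cong) auto
    from sum_Q_shift[OF I y this]
    show "(\<Sum>g2\<in>Q I. \<Prod>i\<in>I. ffactor I i (\<xi> I i + of_real (d I i y)) (rep g1) (rep g2))
      = (\<Sum>g2\<in>Q I. \<Prod>i\<in>I. ffactor I i (\<xi> I i) (rep g1) (rep g2))"
      using I by (simp add: ffactor_add_1 cong: prod.cong)
  qed
  then show ?thesis unfolding fsum_def by (intro sum.cong refl) simp
qed

lemma fsum_add_tau:
  assumes y: "y \<in> L"
  shows "fsum (\<lambda>I i. \<xi> I i + \<tau> * of_real (d I i y)) = ex (of_real (u y) * \<sigma>) * fsum \<xi>"
proof -
  have "(\<Sum>g1\<in>Q I. \<Sum>g2\<in>Q I. \<Prod>i\<in>I. ffactor I i (\<xi> I i + \<tau> * of_real (d I i y)) (rep g1) (rep g2))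
      = ex (of_real (u y) * \<sigma>) * (\<Sum>g1\<in>Q I. \<Sum>g2\<in>Q I. \<Prod>i\<in>I. ffactor I i (\<xi> I i) (rep g1) (rep g2))"
    if I: "I \<in> T" for I
  proof -
    let ?\<Psi> = "\<lambda>h. \<Sum>g2\<in>Q I. \<Prod>i\<in>I. ffactor I i (\<xi> I i) h (rep g2)"
    have my: "- y \<in> L" by (rule subgrp_uminus[OF subgrp_L y])
    have inv: "?\<Psi> (h + w) = ?\<Psi> h" if "w \<in> W I" for h w
    proof -
      have "ffactor I i (\<xi> I i) (h + w) g = ffactor I i (\<xi> I i) h g" if "i \<in> I" for i g
        using ffactor_shift[OF I that \<open>w \<in> W I\<close> subgrp_0[OF subgrp_W], of "\<xi> I i" h g] by simp
      then show ?thesis by (simp cong: prod.cong)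
    qed
    \<comment> \<open>Each factor contributes an exponential of its own; their product is the same
      for every \<open>I\<close> by Cartier divisibility.\<close>
    have "(\<Prod>i\<in>I. ffactor I i (\<xi> I i + \<tau> * of_real (d I i y)) h1 h2)
        = ex (of_real (u y) * \<sigma>) * (\<Prod>i\<in>I. ffactor I i (\<xi> I i) (h1 + - y) h2)" for h1 h2
      unfolding ex_sum_dual[OF I y, symmetric] prod.distrib[symmetric]
      by (rule prod.cong[OF refl]) (simp only: ffactor_add_tau[OF I] diff_conv_add_uminus)
    then have "(\<Sum>g1\<in>Q I. \<Sum>g2\<in>Q I. \<Prod>i\<in>I. ffactor I i (\<xi> I i + \<tau> * of_real (d I i y)) (rep g1) (rep g2))
        = (\<Sum>g1\<in>Q I. ex (of_real (u y) * \<sigma>) * ?\<Psi> (rep g1 + - y))"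
      by (simp only: sum_distrib_left)
    also have "\<dots> = ex (of_real (u y) * \<sigma>) * (\<Sum>g1\<in>Q I. ?\<Psi> (rep g1))"
      unfolding sum_distrib_left[symmetric] using sum_Q_shift[OF I my inv] by simp
    finally show ?thesis .
  qed
  then have "fsum (\<lambda>I i. \<xi> I i + \<tau> * of_real (d I i y)) = (\<Sum>I\<in>T. ex (of_real (u y) * \<sigma>) *
      (of_int (weight \<Delta> I) / of_nat (card (Q I)) *
       (\<Sum>g1\<in>Q I. \<Sum>g2\<in>Q I. \<Prod>i\<in>I. ffactor I i (\<xi> I i) (rep g1) (rep g2))))"
    unfolding fsum_def by (intro sum.cong refl) (simp only: mult.left_commute)
  then show ?thesis unfolding fsum_def by (simp only: sum_distrib_left[symmetric])
qed

text \<open>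
  \<open>wall_coeff I i r p\<close> is, up to the factor \<open>- \<rho> / d I i v'\<close>, the residue along the direction \<open>v'\<close> at the
  point \<open>r + \<tau> p\<close> of the summand of \<open>I\<close> and \<open>(h1, h2)\<close>, when its factor of index \<open>i\<close> has a pole there.
\<close>

definition wall_coeff :: "'i set \<Rightarrow> 'i \<Rightarrow> 'a \<Rightarrow> 'a \<Rightarrow> 'a \<Rightarrow> 'a \<Rightarrow> complex" where
  "wall_coeff I i r p h1 h2 = ex (of_real (d I i p) * \<sigma>) *
     (\<Prod>j\<in>I - {i}. ffactor I j (of_real (d I j r) + \<tau> * of_real (d I j p)) h1 h2)"

text \<open>The condition says that the factor of index \<open>i\<close> has its argument in the
  period lattice at the point \<open>r + \<tau> p\<close>: in the real basis 1, \<tau> of the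
  complex numbers this becomes two integrality conditions.\<close>

definition wall_sum :: "'i set \<Rightarrow> 'i \<Rightarrow> 'a \<Rightarrow> 'a \<Rightarrow> complex" where
  "wall_sum I i r p = (\<Sum>g1\<in>Q I. \<Sum>g2\<in>Q I.
     if d I i (p - rep g1) \<in> \<int> \<and> d I i (r + rep g2) \<in> \<int> then wall_coeff I i r p (rep g1) (rep g2) else 0)"

lemma wall_coeff_shift:
  assumes I: "I \<in> T" and w: "w1 \<in> W I" "w2 \<in> W I"
  shows "wall_coeff I i r p (h1 + w1) (h2 + w2) = wall_coeff I i r p h1 h2"
  unfolding wall_coeff_def using ffactor_shift[OF I _ w] by simp

text \<open>A class on which the height is integral contains points where it is exactly 0, reached
  by adding multiples of \<open>V i\<close>, and these form one class of the facet lattice. The sign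
  \<open>c\<close> covers both \<open>p - h1\<close> and \<open>r + h2\<close>.\<close>

lemma sum_Q_face:
  assumes I: "I \<in> T" "i \<in> I" and c: "c = 1 \<or> c = -1"
    and \<Psi>: "\<And>h w. w \<in> W I \<Longrightarrow> \<Psi> (h + w) = \<Psi> h"
  shows "(\<Sum>g\<in>Q I. if d I i (p + c *\<^sub>R rep g) \<in> \<int> then \<Psi> (rep g) else (0 :: complex))
    = (\<Sum>g\<in>coset (W (I - {i})) ` {h \<in> L. d I i (p + c *\<^sub>R h) = 0}. \<Psi> (rep g))"
proof -
  have cc: "c * c = 1" using c by auto
  let ?X = "{h \<in> L. d I i (p + c *\<^sub>R h) \<in> \<int>}"
  have WJ: "W (I - {i}) = {y \<in> W I. d I i y = 0}" by (rule edge_lattice_face[OF top(1)[OF I(1)] I(2)])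
  have dd: "d I i (p + c *\<^sub>R h) = d I i p + c * d I i h" for h by (simp add: d_add[OF I] d_scale[OF I])
  have cint: "c * m \<in> \<int> \<longleftrightarrow> m \<in> \<int>" for m using c by auto
  have dw: "d I i (p + c *\<^sub>R (h + w)) = d I i (p + c *\<^sub>R h) + c * d I i w" for h w
    unfolding dd by (simp only: d_add[OF I] distrib_left add.assoc)
  have inv: "d I i (p + c *\<^sub>R (h + w)) \<in> \<int> \<longleftrightarrow> d I i (p + c *\<^sub>R h) \<in> \<int>" if "w \<in> W I" for h w
  proof -
    have "c * d I i w \<in> \<int>" using d_W_int[OF I that] cint by blast
    then show ?thesis unfolding dw by (metis Ints_add Ints_diff add_diff_cancel_right')
  qed
  have "{g \<in> Q I. d I i (p + c *\<^sub>R rep g) \<in> \<int>} = coset (W I) ` ?X"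
  proof -
    have "d I i (p + c *\<^sub>R rep (coset (W I) h)) \<in> \<int> \<longleftrightarrow> d I i (p + c *\<^sub>R h) \<in> \<int>" for h
      using inv[OF rep_coset[OF subgrp_W, of I h], of h] by simp
    then show ?thesis by (auto simp: quot_group_def)
  qed
  then have "(\<Sum>g\<in>Q I. if d I i (p + c *\<^sub>R rep g) \<in> \<int> then \<Psi> (rep g) else 0) = (\<Sum>g\<in>coset (W I) ` ?X. \<Psi> (rep g))"
    by (simp add: sum.inter_filter[OF finite_Q[OF I(1)], symmetric])
  also have "\<dots> = (\<Sum>g\<in>coset (W (I - {i})) ` {h \<in> L. d I i (p + c *\<^sub>R h) = 0}. \<Psi> (rep g))"
  proof (rule sum_coset_reindex[OF subgrp_W subgrp_W])
    fix h assume h: "h \<in> {h \<in> L. d I i (p + c *\<^sub>R h) = 0}"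
    then show "h \<in> ?X" by auto
    fix w assume w: "w \<in> W (I - {i})"
    then have "h + w \<in> L" using h WJ W_subset[OF I(1)] subgrp_add[OF subgrp_L] by blast
    then show "h + w \<in> {h \<in> L. d I i (p + c *\<^sub>R h) = 0}" using h w WJ by (auto simp only: mem_Collect_eq dw)
  next
    fix h h' assume h: "h \<in> {h \<in> L. d I i (p + c *\<^sub>R h) = 0}" "h' \<in> {h \<in> L. d I i (p + c *\<^sub>R h) = 0}"
    then have "c * d I i h = c * d I i h'" by (auto simp only: dd)
    then have "d I i (h - h') = 0" using c by (auto simp: d_diff[OF I])
    then show "h - h' \<in> W I \<longleftrightarrow> h - h' \<in> W (I - {i})" using WJ by simp
  next
    fix h assume h: "h \<in> ?X"
    then obtain m :: int where m: "d I i (p + c *\<^sub>R h) = of_int m" by (auto elim: Ints_cases)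
    \<comment> \<open>\<open>V i\<close> has height 1 and \<open>c * c = 1\<close>, so adding
      \<open>- c * m\<close> copies of it cancels the height \<open>m\<close>.\<close>
    obtain n :: int where n: "of_int n = - c * of_int m" using c by (metis minus_minus mult_minus1 mult_1 of_int_minus)
    have Vi: "V i \<in> L" "V i \<in> W I" using top(2)[OF I(1)] I(2)
      by (auto simp: edge_lattice_def intro: group_closure.base)
    have w: "of_int n *\<^sub>R V i \<in> W I"
      using Vi(2) unfolding edge_lattice_def by (rule group_closure_of_int_scaleR)
    have dV: "d I i (V i) = 1" using dual_basis_eq[OF top(1)[OF I(1)] I(2) I(2)] by simp
    have "h + of_int n *\<^sub>R V i \<in> L" using h w W_subset[OF I(1)] subgrp_add[OF subgrp_L] by blast
    moreover have "d I i (p + c *\<^sub>R (h + of_int n *\<^sub>R V i)) = 0"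
    proof -
      have "d I i (p + c *\<^sub>R (h + of_int n *\<^sub>R V i)) = d I i (p + c *\<^sub>R h) + c * of_int n"
        by (simp add: dd d_add[OF I] d_scale[OF I] dV algebra_simps)
      also have "c * of_int n = - of_int m" unfolding n using cc by (simp flip: mult.assoc)
      finally show ?thesis using m by simp
    qed
    ultimately show "\<exists>h'\<in>{h \<in> L. d I i (p + c *\<^sub>R h) = 0}. h' - h \<in> W I"
      using w by (intro bexI[of _ "h + of_int n *\<^sub>R V i"]) auto
  qed (use \<Psi> in auto)
  finally show ?thesis .
qed

text \<open>For representatives at height 0 the regular factors see only the facet, and the
  exponentials, including that of the singular factor, merge into
  \<open>ex (u h1 * \<sigma>)\<close>. The resulting expression \<open>B\<close> keeps no trace of
  the vertex off the wall; \<open>I0\<close> merely supplies coordinates on the facet.\<close>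

lemma wall_sum_face:
  assumes I: "I \<in> T" "i \<in> I" and I0: "I0 \<in> T" "i0 \<in> I0" and eq: "I - {i} = I0 - {i0}"
  shows "wall_sum I i r p = wall_sum I0 i0 r p"
proof -
  define J where "J = I0 - {i0}"
  define X1 X2 where "X1 = {h \<in> L. p - h \<in> span (V ` J)}" and "X2 = {h \<in> L. r + h \<in> span (V ` J)}"
  define B where "B = (\<lambda>h1 h2. ex (of_real (u h1) * \<sigma>) *
     (\<Prod>j\<in>J. P (- (of_real (d I0 j (r + h2)) + \<tau> * of_real (d I0 j (p - h1))))))"
  have "wall_sum I i r p = (\<Sum>g1\<in>coset (W J) ` X1. \<Sum>g2\<in>coset (W J) ` X2. B (rep g1) (rep g2))"
    if I: "I \<in> T" "i \<in> I" "I - {i} = J" for I i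
  proof -
    note bf = top(1)[OF I(1)]
    have sp: "y \<in> span (V ` J) \<longleftrightarrow> d I i y = 0" for y using span_face[OF bf I(2)] I(3) by auto
    have X: "X1 = {h \<in> L. d I i (p + (-1) *\<^sub>R h) = 0}" "X2 = {h \<in> L. d I i (r + 1 *\<^sub>R h) = 0}"
      by (simp_all add: X1_def X2_def sp)
    have WJ: "W J \<subseteq> W I" using edge_lattice_face[OF bf I(2)] I(3) by auto
    have inv1: "wall_coeff I i r p (h1 + w) h2 = wall_coeff I i r p h1 h2" if "w \<in> W I" for h1 h2 w
      using wall_coeff_shift[OF I(1) that subgrp_0[OF subgrp_W], of i r p h1 h2] by simp
    have inv2: "wall_coeff I i r p h1 (h2 + w) = wall_coeff I i r p h1 h2" if "w \<in> W I" for h1 h2 w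
      using wall_coeff_shift[OF I(1) subgrp_0[OF subgrp_W] that, of i r p h1 h2] by simp
    have "wall_sum I i r p = (\<Sum>g1\<in>Q I. if d I i (p + (-1) *\<^sub>R rep g1) \<in> \<int> then
        (\<Sum>g2\<in>Q I. if d I i (r + 1 *\<^sub>R rep g2) \<in> \<int> then wall_coeff I i r p (rep g1) (rep g2) else 0) else 0)"
      unfolding wall_sum_def by (intro sum.cong refl) auto
    also have "\<dots> = (\<Sum>g1\<in>Q I. if d I i (p + (-1) *\<^sub>R rep g1) \<in> \<int> then
        (\<Sum>g2\<in>coset (W J) ` X2. wall_coeff I i r p (rep g1) (rep g2)) else 0)"
      using sum_Q_face[OF I(1,2), of 1 "wall_coeff I i r p (rep g1)" r for g1] inv2
      by (simp only: X(2) I(3) simp_thms)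
    also have "\<dots> = (\<Sum>g1\<in>coset (W J) ` X1. \<Sum>g2\<in>coset (W J) ` X2. wall_coeff I i r p (rep g1) (rep g2))"
      using sum_Q_face[OF I(1,2), of "-1" "\<lambda>h. \<Sum>g2\<in>coset (W J) ` X2. wall_coeff I i r p h (rep g2)" p] inv1
      by (simp only: X(1) I(3) simp_thms)
    also have "\<dots> = (\<Sum>g1\<in>coset (W J) ` X1. \<Sum>g2\<in>coset (W J) ` X2. B (rep g1) (rep g2))"
    proof (intro sum.cong refl)
      fix g1 g2 assume g: "g1 \<in> coset (W J) ` X1" "g2 \<in> coset (W J) ` X2"
      define h1 h2 where "h1 = rep g1" and "h2 = rep g2"
      have h1: "h1 \<in> L" "d I i (p - h1) = 0"
      proof -
        from g obtain y where y: "y \<in> L" "d I i (p - y) = 0" "g1 = coset (W J) y" by (auto simp: X1_def sp)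
        have w: "h1 - y \<in> W J" unfolding h1_def y(3) by (rule rep_coset[OF subgrp_W])
        then have "h1 - y \<in> L" using WJ W_subset[OF I(1)] by blast
        then show "h1 \<in> L" using subgrp_add[OF subgrp_L _ y(1), of "h1 - y"] by simp
        have "d I i (h1 - y) = 0" using w edge_lattice_face[OF bf I(2)] I(3) by auto
        then show "d I i (p - h1) = 0" using y(2) by (simp add: d_diff[OF I(1,2)])
      qed
      have h2: "d I i (r + h2) = 0"
      proof -
        from g obtain y where y: "y \<in> L" "d I i (r + y) = 0" "g2 = coset (W J) y" by (auto simp: X2_def sp)
        have w: "h2 - y \<in> W J" unfolding h2_def y(3) by (rule rep_coset[OF subgrp_W])
        have "d I i (h2 - y) = 0" using w edge_lattice_face[OF bf I(2)] I(3) by auto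
        then show "d I i (r + h2) = 0" using y(2) by (simp add: d_diff[OF I(1,2)] d_add[OF I(1,2)])
      qed
      have fin: "finite I" using top(4)[OF I(1)] .
      have "ffactor I j (of_real (d I j r) + \<tau> * of_real (d I j p)) h1 h2 =
          ex (of_real (d I j h1) * \<sigma>) * P (- (of_real (d I0 j (r + h2)) + \<tau> * of_real (d I0 j (p - h1))))"
        if j: "j \<in> J" for j
      proof -
        have jI: "j \<in> I" using j I(3) by blast
        have "d I j (r + h2) = d I0 j (r + h2)" "d I j (p - h1) = d I0 j (p - h1)"
          using dual_basis_face_agree[OF bf I(2) top(1)[OF I0(1)] I0(2)] I(3) j h1(2) h2
          unfolding J_def by blast+
        then have "of_real (d I j r) + \<tau> * of_real (d I j p) - \<tau> * of_real (d I j h1) + of_real (d I j h2)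
            = of_real (d I0 j (r + h2)) + \<tau> * of_real (d I0 j (p - h1))"
          unfolding \<open>d I j (r + h2) = d I0 j (r + h2)\<close>[symmetric] \<open>d I j (p - h1) = d I0 j (p - h1)\<close>[symmetric]
            d_add[OF I(1) jI] d_diff[OF I(1) jI] of_real_add of_real_diff
          by (simp add: algebra_simps)
        then show ?thesis by (simp only: ffactor_def)
      qed
      then have "wall_coeff I i r p h1 h2 = (ex (of_real (d I i p) * \<sigma>) * (\<Prod>j\<in>J. ex (of_real (d I j h1) * \<sigma>))) *
          (\<Prod>j\<in>J. P (- (of_real (d I0 j (r + h2)) + \<tau> * of_real (d I0 j (p - h1)))))"
        by (simp add: wall_coeff_def I(3) prod.distrib mult.assoc)
      \<comment> \<open>Since \<open>p - h1\<close> has height 0, the exponential at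
        \<open>p\<close> is the one at \<open>h1\<close> that was missing from the product over
        \<open>I\<close>.\<close>
      also have "d I i p = d I i h1" using h1(2) by (simp add: d_diff[OF I(1,2)])
      also have "ex (of_real (d I i h1) * \<sigma>) * (\<Prod>j\<in>J. ex (of_real (d I j h1) * \<sigma>)) = ex (of_real (u h1) * \<sigma>)"
        using prod.remove[OF fin I(2), of "\<lambda>j. ex (of_real (d I j h1) * \<sigma>)"] ex_sum_dual[OF I(1) h1(1)] I(3)
        by simp
      finally show "wall_coeff I i r p (rep g1) (rep g2) = B (rep g1) (rep g2)"
        by (simp add: B_def h1_def h2_def)
    qed
    finally show ?thesis .
  qed
  from this[of I i] this[of I0 i0] show ?thesis using I I0 eq by (simp add: J_def)
qed

text \<open>The pairs \<open>(I, i)\<close> are grouped by the wall \<open>I - {i}\<close>. Within a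
  group all terms share a common factor apart from the weight and the sign of the height, and these
  are balanced by completeness.\<close>

lemma wall_residues_cancel:
  assumes v: "generic \<Delta> v"
  shows "(\<Sum>I\<in>T. of_int (weight \<Delta> I) / of_nat (card (Q I)) *
     (\<Sum>i\<in>I. wall_sum I i r p / of_real (d I i v))) = 0"
proof -
  let ?S = "Sigma T (\<lambda>I. I)"
  define h where "h = (\<lambda>(I, i). of_int (weight \<Delta> I) / of_nat (card (Q I)) * (wall_sum I i r p / of_real (d I i v)))"
  have fin: "finite ?S" using finite_T top(4) by blast
  have "(\<Sum>I\<in>T. of_int (weight \<Delta> I) / of_nat (card (Q I)) * (\<Sum>i\<in>I. wall_sum I i r p / of_real (d I i v))) = sum h ?S"
    unfolding h_def sum_distrib_left using finite_T top(4) by (subst sum.Sigma) auto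
  also have "\<dots> = (\<Sum>J\<in>(\<lambda>(I, i). I - {i}) ` ?S. sum h {q \<in> ?S. (\<lambda>(I, i). I - {i}) q = J})"
    by (rule sum.image_gen[OF fin])
  also have "\<dots> = 0"
  proof (rule sum.neutral, rule ballI)
    fix J assume "J \<in> (\<lambda>(I, i). I - {i}) ` ?S"
    then obtain I0 i0 where 0: "I0 \<in> T" "i0 \<in> I0" "J = I0 - {i0}" by auto
    have J: "J \<in> simps \<Delta>" "card J < DIM('a)"
      using simplicial_cones(3)[OF fan top(5)[OF 0(1)], of J] 0 top(3,4)[OF 0(1)] by (auto simp: card_Diff1_less[THEN order.strict_trans2])
    let ?TJ = "{(I, i). I \<in> T \<and> i \<in> I \<and> I - {i} = J}"
    have TJ: "{q \<in> ?S. (\<lambda>(I, i). I - {i}) q = J} = ?TJ" by auto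
    obtain c where c: "\<forall>I i. basis_family V I \<and> V ` I \<subseteq> L \<and> i \<in> I \<and> I - {i} = J \<longrightarrow>
           of_nat (card (Q I)) * \<bar>d I i v\<bar> = (c :: real)"
      using card_quot_group_height[OF lattice, of V J v] by (rule exE)
    have "h q = of_real (case q of (I, i) \<Rightarrow> of_int (weight \<Delta> I) * sgn (d I i v)) * (wall_sum I0 i0 r p / of_real c)"
      if q: "q \<in> ?TJ" for q
    proof -
      obtain I i where I: "q = (I, i)" "I \<in> T" "i \<in> I" "I - {i} = J" using q by auto
      have ws: "wall_sum I i r p = wall_sum I0 i0 r p"
        using wall_sum_face[OF I(2,3) 0(1,2)] I(4) 0(3) by simp
      \<comment> \<open>Group order and absolute height combine into the constant \<open>c\<close>
        of the wall; only the sign remembers the side.\<close>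
      have "1 / (of_nat (card (Q I)) * d I i v) = sgn (d I i v) / (of_nat (card (Q I)) * \<bar>d I i v\<bar>)"
        by (auto simp: sgn_if abs_if)
      also have "\<dots> = sgn (d I i v) / c" using c top(1,2)[OF I(2)] I(3,4) by metis
      finally have "(of_real (1 / (of_nat (card (Q I)) * d I i v)) :: complex) = of_real (sgn (d I i v) / c)"
        by (rule arg_cong)
      then have e: "1 / (of_nat (card (Q I)) * of_real (d I i v)) = (of_real (sgn (d I i v)) / of_real c :: complex)"
        by simp
      have "h q = of_int (weight \<Delta> I) * wall_sum I0 i0 r p * (1 / (of_nat (card (Q I)) * of_real (d I i v)))"
        by (simp add: h_def I(1) ws)
      then show ?thesis unfolding e by (simp add: I(1))
    qed
    then have "sum h ?TJ = of_real (\<Sum>(I, i)\<in>?TJ. of_int (weight \<Delta> I) * sgn (d I i v)) * (wall_sum I0 i0 r p / of_real c)"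
      by (simp only: of_real_sum sum_distrib_right cong: sum.cong)
    also have "(\<Sum>(I, i)\<in>?TJ. of_int (weight \<Delta> I) * sgn (d I i v)) = 0"
      using complete_wall_balance[OF fan edges complete v J] by simp
    finally show "sum h {q \<in> ?S. (\<lambda>(I, i). I - {i}) q = J} = 0" unfolding TJ by simp
  qed
  finally show ?thesis .
qed

end

section \<open>Vanishing on generic lines\<close>

text \<open>Riemann's theorem applied to \<open>(s - s0) * f s\<close>: its extension by 0 is
  holomorphic, and \<open>f\<close> is the difference quotient of this extension at
  \<open>s0\<close>.\<close>

lemma tendsto_of_removable:
  fixes f :: "complex \<Rightarrow> complex"
  assumes f: "f analytic_on R" and R: "eventually (\<lambda>s. s \<in> R) (at s0)"
    and lim: "((\<lambda>s. (s - s0) * f s) \<longlongrightarrow> 0) (at s0)"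
  shows "isolated_singularity_at f s0" "\<exists>l. (f \<longlongrightarrow> l) (at s0)"
proof -
  obtain r where r: "r > 0" "\<And>s. s \<noteq> s0 \<Longrightarrow> dist s s0 < r \<Longrightarrow> s \<in> R"
    using R unfolding eventually_at by blast
  have sub: "ball s0 r - {s0} \<subseteq> R"
  proof
    fix s assume "s \<in> ball s0 r - {s0}"
    then show "s \<in> R" using r(2)[of s] by (simp add: dist_commute)
  qed
  then have an: "f analytic_on ball s0 r - {s0}" using f analytic_on_subset by blast
  then show "isolated_singularity_at f s0"
    using r(1) by (auto simp: isolated_singularity_at_def)
  have "(\<lambda>s. (s - s0) * f s) holomorphic_on ball s0 r - {s0}"
    using analytic_imp_holomorphic[OF an] by (intro holomorphic_intros)
  then have "(\<lambda>s. if s = s0 then 0 else (s - s0) * f s) holomorphic_on ball s0 r" (is "?g holomorphic_on _")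
    using lim by (intro removable_singularity) auto
  then have "\<forall>s\<in>ball s0 r. \<exists>l. (?g has_field_derivative l) (at s)"
    by (simp only: holomorphic_on_open[OF open_ball])
  then obtain l where "(?g has_field_derivative l) (at s0)"
    using r(1) by (meson centre_in_ball)
  then have "((\<lambda>s. (?g s - ?g s0) / (s - s0)) \<longlongrightarrow> l) (at s0)"
    by (simp add: has_field_derivative_iff)
  moreover have "eventually (\<lambda>s. (?g s - ?g s0) / (s - s0) = f s) (at s0)"
    by (auto simp: eventually_at_filter)
  ultimately have "(f \<longlongrightarrow> l) (at s0)" using tendsto_cong by fast
  then show "\<exists>l. (f \<longlongrightarrow> l) (at s0)" ..
qed

lemma quasi_periodic_vanish:
  fixes f :: "complex \<Rightarrow> complex"
  assumes tau: "Im \<tau> > 0" and m: "norm m = 1" "m \<noteq> 1"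
    and per: "\<And>s. f (s + 1) = f s" "\<And>s. f (s + \<tau>) = m * f s"
    and f: "f analytic_on R" and R: "\<And>s. eventually (\<lambda>s. s \<in> R) (at s)"
    and lim: "\<And>s0. ((\<lambda>s. (s - s0) * f s) \<longlongrightarrow> 0) (at s0)"
    and s: "s \<in> R"
  shows "f s = 0"
proof -
  \<comment> \<open>Outside \<open>R\<close> the values of \<open>f\<close> may be the defaults of a
    division by zero, so it is replaced by its continuous extension.\<close>
  define g where "g = remove_sings f"
  have lim': "(f \<longlongrightarrow> g s0) (at s0)" for s0
    using tendsto_of_removable(2)[OF f R lim, of s0] unfolding g_def by (metis remove_sings_eqI)
  have "g analytic_on {s0}" for s0
    unfolding g_def using remove_sings_analytic_at[OF tendsto_of_removable(1)[OF f R lim] lim'] .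
  then have "g analytic_on UNIV" using analytic_on_analytic_at by blast
  then have hol: "g holomorphic_on UNIV" by (rule analytic_imp_holomorphic)
  have shift: "((\<lambda>s. f (s + a)) \<longlongrightarrow> g (s0 + a)) (at s0)" for a s0
    using LIM_offset[OF lim'[of "s0 + a"], of a] by simp
  have g1: "g (s0 + 1) = g s0" for s0
    using shift[of 1 s0] lim'[of s0] unfolding per(1) by (intro tendsto_unique) auto
  have gt: "g (s0 + \<tau>) = m * g s0" for s0
    using shift[of \<tau> s0] tendsto_mult_left[OF lim'[of s0], of m] unfolding per(2)
    by (intro tendsto_unique[of "at s0"]) auto
  have n1: "norm (g (s0 + of_int a)) = norm (g s0)" for a s0
  proof (induction a rule: int_induct[where k = 0])
    case (step1 i)
    then show ?case using g1[of "s0 + of_int i"] by (simp add: add_ac)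
  next
    case (step2 i)
    then show ?case using g1[of "s0 + of_int i - 1"] by (simp add: algebra_simps)
  qed auto
  have nt: "norm (g (s0 + of_int b * \<tau>)) = norm (g s0)" for b s0
  proof (induction b rule: int_induct[where k = 0])
    case (step1 i)
    have "s0 + of_int (i + 1) * \<tau> = (s0 + of_int i * \<tau>) + \<tau>" by (simp add: algebra_simps)
    then have "g (s0 + of_int (i + 1) * \<tau>) = m * g (s0 + of_int i * \<tau>)" by (simp only: gt)
    then show ?case using step1 m(1) by (simp only: norm_mult mult_1)
  next
    case (step2 i)
    have "s0 + of_int i * \<tau> = (s0 + of_int (i - 1) * \<tau>) + \<tau>" by (simp add: algebra_simps)
    then have "g (s0 + of_int i * \<tau>) = m * g (s0 + of_int (i - 1) * \<tau>)" by (simp only: gt)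
    then show ?case using step2 m(1) by (simp only: norm_mult mult_1)
  qed auto
  let ?K = "(\<lambda>(X, Y). of_real X + of_real Y * \<tau>) ` ({0..1} \<times> {0..1 :: real})"
  have "compact ?K"
    by (intro compact_continuous_image compact_Times compact_Icc)
      (auto simp: case_prod_unfold intro!: continuous_intros)
  moreover have "continuous_on ?K g"
    by (rule continuous_on_subset[OF holomorphic_on_imp_continuous_on[OF hol]]) simp
  ultimately have "bounded (g ` ?K)"
    by (intro compact_imp_bounded compact_continuous_image[of ?K g])
  then obtain B where "\<forall>w\<in>g ` ?K. norm w \<le> B"
    unfolding bounded_iff ..
  then have B: "norm (g w) \<le> B" if "w \<in> ?K" for w using that by blast
  have "norm (g w) \<le> B" for w
  proof -
    \<comment> \<open>\<open>X\<close> and \<open>y\<close> are the real coordinates of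
      \<open>w\<close> in the basis 1, \<tau>. Dropping their integer parts moves \<open>w\<close>
      into the compact parallelogram \<open>?K\<close> without changing \<open>norm (g w)\<close>,
      because the multiplier has modulus 1.\<close>
    define y where "y = Im w / Im \<tau>"
    define X where "X = Re w - y * Re \<tau>"
    have w: "w = of_real X + of_real y * \<tau>"
      using tau by (simp add: complex_eq_iff X_def y_def)
    have "of_real (X - of_int \<lfloor>X\<rfloor>) + of_real (y - of_int \<lfloor>y\<rfloor>) * \<tau> \<in> ?K"
    proof (rule image_eqI[of _ _ "(X - of_int \<lfloor>X\<rfloor>, y - of_int \<lfloor>y\<rfloor>)"])
      show "(X - of_int \<lfloor>X\<rfloor>, y - of_int \<lfloor>y\<rfloor>) \<in> {0..1} \<times> {0..1}" by simp linarith
    qed simp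
    then have "norm (g (of_real (X - of_int \<lfloor>X\<rfloor>) + of_real (y - of_int \<lfloor>y\<rfloor>) * \<tau>)) \<le> B" by (rule B)
    moreover have "w = (of_real (X - of_int \<lfloor>X\<rfloor>) + of_real (y - of_int \<lfloor>y\<rfloor>) * \<tau>) + of_int \<lfloor>X\<rfloor> + of_int \<lfloor>y\<rfloor> * \<tau>"
      unfolding w by (simp add: algebra_simps)
    ultimately show ?thesis by (simp only: n1 nt)
  qed
  then have "bounded (range g)" by (auto simp: bounded_iff)
  then obtain a where a: "\<And>w. g w = a"
    using Liouville_theorem[OF hol] by (auto simp: constant_on_def)
  have "a = m * a" using gt[of 0] a by simp
  then have "a = 0" using m(2) by simp
  moreover have "f s = g s"
    using analytic_on_subset[OF f, of "{s}"] s by (simp add: g_def)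
  ultimately show ?thesis using a by simp
qed

text \<open>By \<open>one\<close> at most one term of the limit is nonzero. Writing it as a sum over
  all indices covers the regular case too and allows an exchange with the sums over classes
  later.\<close>

lemma tendsto_mult_prod_simple_poles:
  fixes F :: "'i \<Rightarrow> complex \<Rightarrow> complex"
  assumes fin: "finite I"
    and R: "\<And>i. i \<in> I \<Longrightarrow> S i \<Longrightarrow> ((\<lambda>s. (s - s0) * F i s) \<longlongrightarrow> R i) (at s0)"
    and C: "\<And>i. i \<in> I \<Longrightarrow> \<not> S i \<Longrightarrow> (F i \<longlongrightarrow> C i) (at s0)"
    and one: "\<And>i j. i \<in> I \<Longrightarrow> j \<in> I \<Longrightarrow> S i \<Longrightarrow> S j \<Longrightarrow> i = j"
  shows "((\<lambda>s. (s - s0) * (\<Prod>i\<in>I. F i s)) \<longlongrightarrow> (\<Sum>i\<in>I. if S i then R i * (\<Prod>j\<in>I - {i}. C j) else 0)) (at s0)"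
proof (cases "\<exists>i\<in>I. S i")
  case True
  then obtain i where i: "i \<in> I" "S i" by blast
  have "(\<Sum>j\<in>I. if S j then R j * (\<Prod>l\<in>I - {j}. C l) else 0) = (\<Sum>j\<in>I. if j = i then R i * (\<Prod>l\<in>I - {i}. C l) else 0)"
    using one i by (intro sum.cong) auto
  also have "\<dots> = R i * (\<Prod>l\<in>I - {i}. C l)" using fin i by simp
  finally have s: "(\<Sum>j\<in>I. if S j then R j * (\<Prod>l\<in>I - {j}. C l) else 0) = R i * (\<Prod>l\<in>I - {i}. C l)" .
  have "((\<lambda>s. ((s - s0) * F i s) * (\<Prod>l\<in>I - {i}. F l s)) \<longlongrightarrow> R i * (\<Prod>l\<in>I - {i}. C l)) (at s0)"
    using one i by (intro tendsto_mult tendsto_prod R C) auto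
  moreover have "((s - s0) * F i s) * (\<Prod>l\<in>I - {i}. F l s) = (s - s0) * (\<Prod>i\<in>I. F i s)" for s
    by (simp only: prod.remove[OF fin i(1), of "\<lambda>i. F i s"] mult.assoc)
  ultimately show ?thesis unfolding s by (simp only:)
next
  case False
  have "((\<lambda>s. (s - s0) * (\<Prod>i\<in>I. F i s)) \<longlongrightarrow> (s0 - s0) * (\<Prod>i\<in>I. C i)) (at s0)"
    using False by (intro tendsto_intros C) auto
  then show ?thesis using False by simp
qed

section \<open>The period lattice and real hyperplanes\<close>

lemma open_not_period: "Im \<tau> > 0 \<Longrightarrow> open (- period_lattice \<tau>)"
proof -
  assume tau: "Im \<tau> > 0"
  have "open (theta \<tau> -` (- {0}))"
    using holomorphic_on_imp_continuous_on[OF theta_holomorphic[OF tau]]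
    by (intro open_vimage) auto
  moreover have "theta \<tau> -` (- {0}) = - period_lattice \<tau>"
    using theta_eq_0_iff[OF tau] by auto
  ultimately show ?thesis by simp
qed

lemma countable_period_lattice: "countable (period_lattice \<tau>)"
proof -
  have "period_lattice \<tau> = (\<lambda>(a, b). of_int a + of_int b * \<tau>) ` (UNIV :: (int \<times> int) set)"
    by (auto simp: period_lattice_def)
  then show ?thesis by simp
qed

lemma period_lattice_real_iff:
  assumes "Im \<tau> > 0"
  shows "- (of_real \<alpha> + \<tau> * of_real \<beta>) \<in> period_lattice \<tau> \<longleftrightarrow> \<beta> \<in> \<int> \<and> \<alpha> \<in> \<int>"
proof
  assume "- (of_real \<alpha> + \<tau> * of_real \<beta>) \<in> period_lattice \<tau>"
  then obtain a b :: int where ab: "- (of_real \<alpha> + \<tau> * of_real \<beta>) = of_int a + of_int b * \<tau>"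
    by (auto simp: period_lattice_def)
  have "- \<beta> * Im \<tau> = of_int b * Im \<tau>" using arg_cong[OF ab, of Im] by (simp add: mult.commute)
  then have "- \<beta> = of_int b" using assms mult_right_cancel[of "Im \<tau>" "- \<beta>" "of_int b"] by simp
  then have b: "\<beta> = of_int (- b)" by simp
  have "\<alpha> = of_int (- a)" using arg_cong[OF ab, of Re] by (simp add: b)
  then show "\<beta> \<in> \<int> \<and> \<alpha> \<in> \<int>" using b by (metis Ints_of_int)
next
  assume "\<beta> \<in> \<int> \<and> \<alpha> \<in> \<int>"
  then obtain a b :: int where "\<alpha> = of_int a" "\<beta> = of_int b" by (auto elim!: Ints_cases)
  then have "- (of_real \<alpha> + \<tau> * of_real \<beta>) = of_int (- a) + of_int (- b) * \<tau>" by simp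
  then show "- (of_real \<alpha> + \<tau> * of_real \<beta>) \<in> period_lattice \<tau>" unfolding period_lattice_def by blast
qed

lemma complex_eq_real_tau:
  assumes "Im \<tau> > 0"
  obtains a b where "w = of_real a + \<tau> * of_real b"
proof -
  have "w = of_real (Re w - Im w / Im \<tau> * Re \<tau>) + \<tau> * of_real (Im w / Im \<tau>)"
    using assms by (simp add: complex_eq_iff)
  then show ?thesis using that by blast
qed

lemma linear_hyperplane_negligible:
  fixes f :: "'a::euclidean_space \<Rightarrow> real"
  assumes "linear f" "f \<noteq> (\<lambda>_. 0)"
  shows "negligible {c. f c = b}"
proof -
  define a where "a = adjoint f 1"
  have f: "f c = a \<bullet> c" for c
    using adjoint_works[OF assms(1), of c 1] by (simp add: a_def inner_commute)
  then have "a \<noteq> 0" using assms(2) by auto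
  then show ?thesis using negligible_hyperplane[of a b] by (simp add: f)
qed

section \<open>Cancellation of poles on affine lines\<close>

context divisible_fan
begin

definition farg :: "'i set \<Rightarrow> 'i \<Rightarrow> complex \<Rightarrow> 'a \<Rightarrow> 'a \<Rightarrow> complex" where
  "farg I i \<xi> h1 h2 = - (\<xi> - \<tau> * of_real (d I i h1) + of_real (d I i h2))"

lemma ffactor_farg: "ffactor I i \<xi> h1 h2 = ex (of_real (d I i h1) * \<sigma>) * P (farg I i \<xi> h1 h2)"
  by (simp add: ffactor_def farg_def)

definition regular :: "('i set \<Rightarrow> 'i \<Rightarrow> complex) \<Rightarrow> bool" where
  "regular \<xi> \<longleftrightarrow> (\<forall>I\<in>T. \<forall>g1\<in>Q I. \<forall>g2\<in>Q I. \<forall>i\<in>I. farg I i (\<xi> I i) (rep g1) (rep g2) \<notin> period_lattice \<tau>)"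

lemma P_isCont: "w \<notin> period_lattice \<tau> \<Longrightarrow> isCont P w"
  using holomorphic_on_imp_continuous_on[OF phi_theta_holomorphic[OF tau]] open_not_period[OF tau]
  by (metis ComplI continuous_on_eq_continuous_at)

lemma fsum_analytic:
  "(\<lambda>s. fsum (\<lambda>I i. \<xi> I i + s * of_real (d I i v))) analytic_on {s. regular (\<lambda>I i. \<xi> I i + s * of_real (d I i v))}"
  (is "_ analytic_on ?R")
  unfolding fsum_def
proof (intro analytic_intros)
  fix I g1 g2 i assume I: "I \<in> T" "g1 \<in> Q I" "g2 \<in> Q I" "i \<in> I"
  have P: "P analytic_on - period_lattice \<tau>"
    using phi_theta_holomorphic[OF tau] open_not_period[OF tau] by (simp add: analytic_on_open)
  have "(P \<circ> (\<lambda>s. farg I i (\<xi> I i + s * of_real (d I i v)) (rep g1) (rep g2))) analytic_on ?R"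
  proof (rule analytic_on_compose)
    show "(\<lambda>s. farg I i (\<xi> I i + s * of_real (d I i v)) (rep g1) (rep g2)) analytic_on ?R"
      unfolding farg_def by (intro analytic_intros)
    show "P analytic_on (\<lambda>s. farg I i (\<xi> I i + s * of_real (d I i v)) (rep g1) (rep g2)) ` ?R"
      using I by (intro analytic_on_subset[OF P]) (auto simp: regular_def)
  qed
  then show "(\<lambda>s. ffactor I i (\<xi> I i + s * of_real (d I i v)) (rep g1) (rep g2)) analytic_on ?R"
    unfolding ffactor_farg o_def by (intro analytic_intros)
qed

lemma farg_line: "farg I i (\<xi> + s * of_real D) h1 h2 = farg I i (\<xi> + s0 * of_real D) h1 h2 + - (s - s0) * of_real D"
  by (simp add: farg_def algebra_simps)

lemma filterlim_line:
  assumes "D \<noteq> 0"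
  shows "filterlim (\<lambda>s. - (s - s0) * of_real D :: complex) (at 0) (at s0)"
proof (rule filterlim_atI)
  have "((\<lambda>s. - (s - s0) * of_real D :: complex) \<longlongrightarrow> - (s0 - s0) * of_real D) (at s0)"
    by (intro tendsto_intros)
  then show "((\<lambda>s. - (s - s0) * of_real D :: complex) \<longlongrightarrow> 0) (at s0)" by simp
  show "eventually (\<lambda>s. - (s - s0) * of_real D \<noteq> (0 :: complex)) (at s0)"
    using assms by (auto simp: eventually_at_filter)
qed

lemma eventually_regular:
  assumes D: "\<And>I i. I \<in> T \<Longrightarrow> i \<in> I \<Longrightarrow> d I i v \<noteq> 0"
  shows "eventually (\<lambda>s. regular (\<lambda>I i. \<xi> I i + s * of_real (d I i v))) (at s0)"
  unfolding regular_def
proof (intro eventually_ball_finite finite_T finite_Q ballI)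
  fix I g1 g2 i assume I: "I \<in> T" "i \<in> I"
  let ?a = "farg I i (\<xi> I i + s0 * of_real (d I i v)) (rep g1) (rep g2)"
  have "filterlim (\<lambda>s. ?a + - (s - s0) * of_real (d I i v)) (at ?a) (at s0)"
  proof (rule filterlim_atI)
    note l = filterlim_line[OF D[OF I], of s0]
    have "((\<lambda>s. - (s - s0) * of_real (d I i v) :: complex) \<longlongrightarrow> 0) (at s0)"
      using l by (simp add: filterlim_at)
    from tendsto_add[OF tendsto_const this, of ?a]
    show "((\<lambda>s. ?a + - (s - s0) * of_real (d I i v)) \<longlongrightarrow> ?a) (at s0)" by simp
    show "eventually (\<lambda>s. ?a + - (s - s0) * of_real (d I i v) \<noteq> ?a) (at s0)"
      using l unfolding filterlim_at by (auto elim: eventually_mono)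
  qed
  from eventually_compose_filterlim[OF eventually_not_period[OF tau] this]
  show "eventually (\<lambda>s. farg I i (\<xi> I i + s * of_real (d I i v)) (rep g1) (rep g2) \<notin> period_lattice \<tau>) (at s0)"
    by (simp only: farg_line[symmetric])
qed (use top(4) in auto)

text \<open>
  For generic \<open>c\<close>, a point of the affine line \<open>z v + c + s v'\<close> lies on the polar hyperplanes of at
  most one index in each summand, so that only codimension one phenomena matter.
\<close>

definition nonresonant :: "('i set \<Rightarrow> 'i \<Rightarrow> complex) \<Rightarrow> 'a \<Rightarrow> bool" where
  "nonresonant \<xi> v \<longleftrightarrow> (\<forall>I\<in>T. \<forall>g1\<in>Q I. \<forall>g2\<in>Q I. \<forall>i\<in>I. \<forall>j\<in>I. i \<noteq> j \<longrightarrow>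
     \<not> (\<exists>s. farg I i (\<xi> I i + s * of_real (d I i v)) (rep g1) (rep g2) \<in> period_lattice \<tau> \<and>
          farg I j (\<xi> I j + s * of_real (d I j v)) (rep g1) (rep g2) \<in> period_lattice \<tau>))"

text \<open>Nonresonance leaves each summand at most a simple pole at \<open>s0\<close>, so the
  limit is a sum of residues. By \<open>rp\<close> the point at \<open>s0\<close> has the form
  \<open>r + \<tau> p\<close> with real vectors, for which the residues are expressed by
  \<open>wall_sum\<close>.\<close>

lemma fsum_pole_cancel:
  assumes v: "generic \<Delta> v" and D: "\<And>I i. I \<in> T \<Longrightarrow> i \<in> I \<Longrightarrow> d I i v \<noteq> 0"
    and nr: "nonresonant \<xi> v"
    and rp: "\<And>I i. I \<in> T \<Longrightarrow> i \<in> I \<Longrightarrow> \<xi> I i + s0 * of_real (d I i v) = of_real (d I i r) + \<tau> * of_real (d I i p)"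
  shows "((\<lambda>s. (s - s0) * fsum (\<lambda>I i. \<xi> I i + s * of_real (d I i v))) \<longlongrightarrow> 0) (at s0)"
proof -
  obtain \<rho> where \<rho>: "((\<lambda>z. z * P z) \<longlongrightarrow> \<rho>) (at 0)" using phi_theta_residue[OF tau] by blast
  let ?S = "\<lambda>I i g1 g2. d I i (p - rep g1) \<in> \<int> \<and> d I i (r + rep g2) \<in> \<int>"
  let ?f = "\<lambda>I i g1 g2 s. ffactor I i (\<xi> I i + s * of_real (d I i v)) (rep g1) (rep g2)"
  have arg: "farg I i (\<xi> I i + s0 * of_real (d I i v)) h1 h2
      = - (of_real (d I i (r + h2)) + \<tau> * of_real (d I i (p - h1)))"
    if "I \<in> T" "i \<in> I" for I i h1 h2
    unfolding farg_def rp[OF that] by (simp add: d_add[OF that] d_diff[OF that] algebra_simps)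
  have sing: "farg I i (\<xi> I i + s0 * of_real (d I i v)) (rep g1) (rep g2) \<in> period_lattice \<tau> \<longleftrightarrow> ?S I i g1 g2"
    if "I \<in> T" "i \<in> I" for I i g1 g2
    unfolding arg[OF that] by (rule period_lattice_real_iff[OF tau])
  have trm: "((\<lambda>s. (s - s0) * (\<Prod>i\<in>I. ?f I i g1 g2 s)) \<longlongrightarrow>
      (\<Sum>i\<in>I. if ?S I i g1 g2 then - \<rho> / of_real (d I i v) * wall_coeff I i r p (rep g1) (rep g2) else 0)) (at s0)"
    if I: "I \<in> T" "g1 \<in> Q I" "g2 \<in> Q I" for I g1 g2
  proof -
    \<comment> \<open>The argument of \<open>P\<close> moves along the line with velocity
      \<open>- d I i v\<close>, which accounts for the sign and the denominator.\<close>
    define R where "R = (\<lambda>i. - \<rho> / of_real (d I i v) * ex (of_real (d I i p) * \<sigma>))"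
    define C where "C = (\<lambda>i. ffactor I i (of_real (d I i r) + \<tau> * of_real (d I i p)) (rep g1) (rep g2))"
    have "((\<lambda>s. (s - s0) * (\<Prod>i\<in>I. ?f I i g1 g2 s)) \<longlongrightarrow>
      (\<Sum>i\<in>I. if ?S I i g1 g2 then R i * (\<Prod>j\<in>I - {i}. C j) else 0)) (at s0)"
    proof (rule tendsto_mult_prod_simple_poles[OF top(4)[OF I(1)]])
      fix i assume i: "i \<in> I" and S: "?S I i g1 g2"
      from S obtain a b :: int where ab: "d I i (p - rep g1) = of_int b" "d I i (r + rep g2) = of_int a"
        by (auto elim!: Ints_cases)
      \<comment> \<open>The pole is transported to the origin by a period; the multiplier acquired
        on the way turns \<open>rep g1\<close> into \<open>p\<close> in the exponential.\<close>
      have f: "?f I i g1 g2 s = ex (of_real (d I i p) * \<sigma>) * P (- (s - s0) * of_real (d I i v))" for s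
      proof -
        have "farg I i (\<xi> I i + s * of_real (d I i v)) (rep g1) (rep g2)
            = - (s - s0) * of_real (d I i v) + (of_int (- a) + of_int (- b) * \<tau>)"
          unfolding farg_line[of I i _ s _ _ _ s0] arg[OF I(1) i] ab by simp
        then have "?f I i g1 g2 s = (ex (of_real (d I i (rep g1)) * \<sigma>) * ex (- of_int (- b) * \<sigma>)) * P (- (s - s0) * of_real (d I i v))"
          unfolding ffactor_farg by (simp only: phi_theta_shift[OF tau] mult.assoc)
        also have "ex (of_real (d I i (rep g1)) * \<sigma>) * ex (- of_int (- b) * \<sigma>) = ex (of_real (d I i p) * \<sigma>)"
        proof -
          have "d I i p = d I i (rep g1) + of_int b" using ab(1) by (simp add: d_diff[OF I(1) i])
          then have "of_real (d I i p) * \<sigma> = of_real (d I i (rep g1)) * \<sigma> + - of_int (- b) * \<sigma>"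
            by (simp add: algebra_simps)
          then show ?thesis by (simp only: ex_add)
        qed
        finally show ?thesis .
      qed
      have "((\<lambda>s. (- (s - s0) * of_real (d I i v)) * P (- (s - s0) * of_real (d I i v))) \<longlongrightarrow> \<rho>) (at s0)"
        by (rule filterlim_compose[OF \<rho> filterlim_line[OF D[OF I(1) i]]])
      then have l: "((\<lambda>s. - ex (of_real (d I i p) * \<sigma>) / of_real (d I i v) *
          ((- (s - s0) * of_real (d I i v)) * P (- (s - s0) * of_real (d I i v)))) \<longlongrightarrow>
          - ex (of_real (d I i p) * \<sigma>) / of_real (d I i v) * \<rho>) (at s0)"
        by (rule tendsto_mult_left)
      have e: "- E / D' * ((- (s - s0) * D') * X) = (s - s0) * (E * X)" if "D' \<noteq> 0" for E D' X s :: complex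
        using that by (simp add: field_simps)
      have "- ex (of_real (d I i p) * \<sigma>) / of_real (d I i v) * \<rho> = R i" by (simp add: R_def)
      then show "((\<lambda>s. (s - s0) * ?f I i g1 g2 s) \<longlongrightarrow> R i) (at s0)"
        using l D[OF I(1) i] unfolding f by (simp only: e of_real_eq_0_iff not_False_eq_True simp_thms)
    next
      fix i assume i: "i \<in> I" and S: "\<not> ?S I i g1 g2"
      have "farg I i (\<xi> I i + s0 * of_real (d I i v)) (rep g1) (rep g2) \<notin> period_lattice \<tau>"
        using S sing[OF I(1) i] by blast
      then have "isCont P (farg I i (\<xi> I i + s0 * of_real (d I i v)) (rep g1) (rep g2))" by (rule P_isCont)
      moreover have "((\<lambda>s. farg I i (\<xi> I i + s * of_real (d I i v)) (rep g1) (rep g2)) \<longlongrightarrow>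
          farg I i (\<xi> I i + s0 * of_real (d I i v)) (rep g1) (rep g2)) (at s0)"
        unfolding farg_def by (intro tendsto_intros)
      ultimately have "((\<lambda>s. P (farg I i (\<xi> I i + s * of_real (d I i v)) (rep g1) (rep g2))) \<longlongrightarrow>
          P (farg I i (\<xi> I i + s0 * of_real (d I i v)) (rep g1) (rep g2))) (at s0)"
        by (rule isCont_tendsto_compose)
      then show "((\<lambda>s. ?f I i g1 g2 s) \<longlongrightarrow> C i) (at s0)"
        unfolding C_def rp[OF I(1) i, symmetric] ffactor_farg by (rule tendsto_mult_left)
    next
      fix i j assume ij: "i \<in> I" "j \<in> I" "?S I i g1 g2" "?S I j g1 g2"
      then show "i = j"
        using nr I sing[OF I(1) ij(1), of g1 g2] sing[OF I(1) ij(2), of g1 g2] unfolding nonresonant_def by blast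
    qed
    then show ?thesis by (simp only: R_def C_def wall_coeff_def mult.assoc)
  qed
  have "((\<lambda>s. \<Sum>I\<in>T. of_int (weight \<Delta> I) / of_nat (card (Q I)) *
      (\<Sum>g1\<in>Q I. \<Sum>g2\<in>Q I. (s - s0) * (\<Prod>i\<in>I. ?f I i g1 g2 s))) \<longlongrightarrow>
    (\<Sum>I\<in>T. of_int (weight \<Delta> I) / of_nat (card (Q I)) * (\<Sum>g1\<in>Q I. \<Sum>g2\<in>Q I.
      (\<Sum>i\<in>I. if ?S I i g1 g2 then - \<rho> / of_real (d I i v) * wall_coeff I i r p (rep g1) (rep g2) else 0)))) (at s0)"
    by (intro tendsto_sum tendsto_mult_left trm)
  moreover have "(\<Sum>I\<in>T. of_int (weight \<Delta> I) / of_nat (card (Q I)) *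
      (\<Sum>g1\<in>Q I. \<Sum>g2\<in>Q I. (s - s0) * (\<Prod>i\<in>I. ?f I i g1 g2 s)))
    = (s - s0) * fsum (\<lambda>I i. \<xi> I i + s * of_real (d I i v))" for s
    by (simp only: fsum_def sum_distrib_left mult.left_commute)
  moreover have "(\<Sum>I\<in>T. of_int (weight \<Delta> I) / of_nat (card (Q I)) * (\<Sum>g1\<in>Q I. \<Sum>g2\<in>Q I.
      (\<Sum>i\<in>I. if ?S I i g1 g2 then - \<rho> / of_real (d I i v) * wall_coeff I i r p (rep g1) (rep g2) else 0))) = 0"
  proof -
    have "(\<Sum>g1\<in>Q I. \<Sum>g2\<in>Q I.
      (\<Sum>i\<in>I. if ?S I i g1 g2 then - \<rho> / of_real (d I i v) * wall_coeff I i r p (rep g1) (rep g2) else 0))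
      = - \<rho> * (\<Sum>i\<in>I. wall_sum I i r p / of_real (d I i v))" for I
    proof -
      have "(\<Sum>g1\<in>Q I. \<Sum>g2\<in>Q I.
        (\<Sum>i\<in>I. if ?S I i g1 g2 then - \<rho> / of_real (d I i v) * wall_coeff I i r p (rep g1) (rep g2) else 0))
        = (\<Sum>g1\<in>Q I. \<Sum>i\<in>I. \<Sum>g2\<in>Q I.
        if ?S I i g1 g2 then - \<rho> / of_real (d I i v) * wall_coeff I i r p (rep g1) (rep g2) else 0)"
        by (intro sum.cong refl sum.swap)
      also have "\<dots> = (\<Sum>i\<in>I. \<Sum>g1\<in>Q I. \<Sum>g2\<in>Q I.
        if ?S I i g1 g2 then - \<rho> / of_real (d I i v) * wall_coeff I i r p (rep g1) (rep g2) else 0)"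
        by (rule sum.swap)
      also have "\<dots> = (\<Sum>i\<in>I. - \<rho> * (wall_sum I i r p / of_real (d I i v)))"
      proof (rule sum.cong[OF refl])
        fix i
        have "(\<Sum>g1\<in>Q I. \<Sum>g2\<in>Q I.
            if ?S I i g1 g2 then - \<rho> / of_real (d I i v) * wall_coeff I i r p (rep g1) (rep g2) else 0)
          = - \<rho> / of_real (d I i v) * wall_sum I i r p"
          unfolding wall_sum_def sum_distrib_left by (intro sum.cong refl) auto
        then show "(\<Sum>g1\<in>Q I. \<Sum>g2\<in>Q I.
            if ?S I i g1 g2 then - \<rho> / of_real (d I i v) * wall_coeff I i r p (rep g1) (rep g2) else 0)
          = - \<rho> * (wall_sum I i r p / of_real (d I i v))" by simp
      qed
      finally show ?thesis by (simp only: sum_distrib_left)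
    qed
    then have "(\<Sum>I\<in>T. of_int (weight \<Delta> I) / of_nat (card (Q I)) * (\<Sum>g1\<in>Q I. \<Sum>g2\<in>Q I.
      (\<Sum>i\<in>I. if ?S I i g1 g2 then - \<rho> / of_real (d I i v) * wall_coeff I i r p (rep g1) (rep g2) else 0)))
      = - \<rho> * (\<Sum>I\<in>T. of_int (weight \<Delta> I) / of_nat (card (Q I)) * (\<Sum>i\<in>I. wall_sum I i r p / of_real (d I i v)))"
      by (simp only: sum_distrib_left mult.left_commute)
    then show ?thesis using wall_residues_cancel[OF v] by simp
  qed
  ultimately show ?thesis by (simp only:)
qed

lemmas generic_d_nonzero = generic_dual_basis_nonzero[OF fan edges]

text \<open>Adding \<open>N\<close> times a lattice vector to an edge vector reaches a generic
  vector without changing \<open>u\<close> modulo \<open>N\<close>. The multiplier is then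
  \<open>ex \<sigma>\<close>, which differs from 1 because \<open>0 < k < N\<close>.\<close>

lemma direction_exists:
  "\<exists>v'\<in>L. generic \<Delta> v' \<and> ex (of_real (u v') * \<sigma>) \<noteq> 1"
proof -
  have lin: "linear u" using u by (simp add: dual_lattice_def)
  have "T \<noteq> {}" using fan unfolding simplicial_multi_fan_def by (elim conjE)
  then obtain I where I: "I \<in> T" by blast
  then have "I \<noteq> {}" using top(3)[OF I] DIM_positive[where 'a='a] by auto
  then obtain i where i: "i \<in> I" by blast
  have vert: "i \<in> verts \<Delta>"
    using simplicial_cones(3)[OF fan top(5)[OF I], of "{i}"] i by (simp add: verts_def)
  obtain g where g: "g \<in> L" "generic \<Delta> (V i + real N *\<^sub>R g)"
    using generic_lattice_point[OF lattice fan, of "{}" "real N" "V i"] k by auto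
  define v' where "v' = V i + real N *\<^sub>R g"
  have "real N *\<^sub>R g \<in> L" using full_lattice_of_int_scaleR[OF lattice g(1), of "int N"] by simp
  then have "v' \<in> L" unfolding v'_def using subgrp_add[OF subgrp_L] top(2)[OF I] i by blast
  moreover have "ex (of_real (u v') * \<sigma>) \<noteq> 1"
  proof -
    have "u g \<in> \<int>" using u g(1) by (auto simp: dual_lattice_def)
    then obtain m :: int where m: "u g = of_int m" by (auto elim: Ints_cases)
    have "u (V i) = 1 - of_nat N * of_int (Poly_Mapping.lookup x i)" using chern_coeff[OF vert] by simp
    then have uv: "u v' = 1 + of_int (int N * (m - Poly_Mapping.lookup x i))"
      by (simp add: v'_def linear_add[OF lin] linear_cmul[OF lin] m algebra_simps)
    have "of_real (u v') * \<sigma> = \<sigma> + of_int (int k * (m - Poly_Mapping.lookup x i))"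
      unfolding uv using k by (simp add: field_simps)
    then have "ex (of_real (u v') * \<sigma>) = ex \<sigma>" by (simp only: ex_add ex_of_int mult_1_right)
    moreover have "\<sigma> \<notin> \<int>"
    proof
      assume "\<sigma> \<in> \<int>"
      then obtain n :: int where "\<sigma> = of_int n" by (auto elim: Ints_cases)
      then have "(of_nat k :: complex) = of_int (n * int N)" using k by (simp add: field_simps)
      then have "of_int (int k) = (of_int (n * int N) :: complex)" by simp
      then have kn: "int k = n * int N" by (simp only: of_int_eq_iff)
      then have "n > 0" using k by (metis of_nat_0_less_iff zero_less_mult_pos2 k(1) less_trans)
      then have "int N \<le> n * int N" using mult_right_mono[of 1 n "int N"] by simp
      then show False using kn k by linarith
    qed
    ultimately show ?thesis by (simp add: ex_eq_1_iff)
  qed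
  ultimately show ?thesis using g(2) v'_def by blast
qed

lemma fsum_line_eq_0:
  assumes v': "v' \<in> L" "generic \<Delta> v'" "ex (of_real (u v') * \<sigma>) \<noteq> 1"
    and nr: "nonresonant (\<lambda>I i. z * of_real (d I i v) + of_real (d I i c)) v'"
    and reg: "regular (\<lambda>I i. z * of_real (d I i v) + of_real (d I i c))"
  shows "fsum (\<lambda>I i. z * of_real (d I i v) + of_real (d I i c)) = 0"
proof -
  define \<xi> where "\<xi> = (\<lambda>I i. z * of_real (d I i v) + of_real (d I i c))"
  define f where "f = (\<lambda>s. fsum (\<lambda>I i. \<xi> I i + s * of_real (d I i v')))"
  define R where "R = {s. regular (\<lambda>I i. \<xi> I i + s * of_real (d I i v'))}"
  have "f 0 = 0"
  proof (rule quasi_periodic_vanish[where f = f and R = R and s = 0, OF tau _ v'(3)])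
    have "of_real (u v') * \<sigma> = of_real (u v' * real k / real N)" by simp
    then show "norm (ex (of_real (u v') * \<sigma>)) = 1" by (simp add: norm_ex)
    show "f (s + 1) = f s" for s
      using fsum_add_1[OF v'(1), of "\<lambda>I i. \<xi> I i + s * of_real (d I i v')"]
      by (simp add: f_def algebra_simps)
    show "f (s + \<tau>) = ex (of_real (u v') * \<sigma>) * f s" for s
      using fsum_add_tau[OF v'(1), of "\<lambda>I i. \<xi> I i + s * of_real (d I i v')"]
      by (simp add: f_def algebra_simps)
    show "f analytic_on R" unfolding f_def R_def by (rule fsum_analytic)
    show "eventually (\<lambda>s. s \<in> R) (at s)" for s
      using eventually_regular[OF generic_d_nonzero[OF v'(2)]] by (simp add: R_def)
    show "((\<lambda>s. (s - s0) * f s) \<longlongrightarrow> 0) (at s0)" for s0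
    proof -
      \<comment> \<open>Splitting \<open>z\<close> and \<open>s0\<close> in the basis 1, \<tau>
        splits the point of the line into \<open>r + \<tau> p\<close>; the real shift
        \<open>c\<close> goes to \<open>r\<close>.\<close>
      obtain a b where ab: "z = of_real a + \<tau> * of_real b" by (rule complex_eq_real_tau[OF tau])
      obtain a' b' where ab': "s0 = of_real a' + \<tau> * of_real b'" by (rule complex_eq_real_tau[OF tau])
      show ?thesis unfolding f_def
      proof (rule fsum_pole_cancel[OF v'(2) generic_d_nonzero[OF v'(2)]])
        show "nonresonant \<xi> v'" using nr by (simp add: \<xi>_def)
        show "\<xi> I i + s0 * of_real (d I i v') = of_real (d I i (a *\<^sub>R v + c + a' *\<^sub>R v')) + \<tau> * of_real (d I i (b *\<^sub>R v + b' *\<^sub>R v'))"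
          if "I \<in> T" "i \<in> I" for I i
          unfolding \<xi>_def ab ab' by (simp add: d_add[OF that] d_scale[OF that] algebra_simps)
      qed
    qed
    show "0 \<in> R" using reg by (simp add: R_def \<xi>_def)
  qed
  then show ?thesis by (simp add: f_def \<xi>_def)
qed

text \<open>A resonance at indices \<open>i\<close> and \<open>j\<close> leaves, after elimination
  of \<open>s\<close>, one real affine equation for \<open>c\<close> for each pair of periods.
  Countably many hyperplanes have measure zero and cannot cover a ball.\<close>

lemma nonresonant_dense:
  assumes D: "\<And>I i. I \<in> T \<Longrightarrow> i \<in> I \<Longrightarrow> d I i v' \<noteq> 0" and e: "e > 0"
  shows "\<exists>c. norm c < e \<and> nonresonant (\<lambda>I i. z * of_real (d I i v) + of_real (d I i c)) v'"
proof -
  \<comment> \<open>On a resonance \<kappa> equals \<open>- (d I i c + s * d I i v')\<close>, so the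
    combination in \<open>H\<close> eliminates \<open>s\<close>. Taking the real part loses nothing
    that matters, because the other side of the equation is real.\<close>
  define \<kappa> where "\<kappa> = (\<lambda>I i g1 g2 l. l + z * of_real (d I i v) - \<tau> * of_real (d I i (rep g1)) + of_real (d I i (rep g2)))"
  define H where "H = (\<lambda>(I, i, j, g1, g2, l1, l2).
     {c. d I j v' * d I i c - d I i v' * d I j c =
         Re (of_real (d I i v') * \<kappa> I j g1 g2 l2 - of_real (d I j v') * \<kappa> I i g1 g2 l1)})"
  define X where "X = (SIGMA I:T. SIGMA i:I. SIGMA j:I - {i}. Q I \<times> Q I \<times> period_lattice \<tau> \<times> period_lattice \<tau>)"
  have "countable X" unfolding X_def
    using finite_T top(4) finite_Q
    by (intro countable_SIGMA countable_period_lattice) (auto intro: countable_finite)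
  moreover have "negligible (H q)" if "q \<in> X" for q
  proof -
    obtain I i j g1 g2 l1 l2 where q: "q = (I, i, j, g1, g2, l1, l2)" by (metis surj_pair)
    have I: "I \<in> T" "i \<in> I" "j \<in> I" "i \<noteq> j" using that by (auto simp: q X_def)
    have "linear (\<lambda>c. d I j v' * d I i c - d I i v' * d I j c)"
      using linear_d[OF I(1,2)] linear_d[OF I(1,3)]
      by (intro linearI) (auto simp: linear_add linear_cmul algebra_simps)
    moreover have "(\<lambda>c. d I j v' * d I i c - d I i v' * d I j c) \<noteq> (\<lambda>_. 0)"
    proof
      assume "(\<lambda>c. d I j v' * d I i c - d I i v' * d I j c) = (\<lambda>_. 0)"
      from fun_cong[OF this, of "V i"] show False
        using D[OF I(1,3)] dual_basis_eq[OF top(1)[OF I(1)] I(2) I(2)] dual_basis_eq[OF top(1)[OF I(1)] I(3) I(2)] I(4)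
        by simp
    qed
    ultimately show ?thesis unfolding H_def q by (simp add: linear_hyperplane_negligible)
  qed
  ultimately have "negligible (\<Union> (H ` X))" by (intro negligible_countable_Union) auto
  moreover have "\<not> negligible (ball (0 :: 'a) e)" using e by (intro open_not_negligible) auto
  ultimately have "\<not> ball 0 e \<subseteq> \<Union> (H ` X)" using negligible_subset by blast
  then obtain c where "c \<in> ball 0 e" and c2: "c \<notin> \<Union> (H ` X)" by blast
  then have c: "norm c < e" "c \<notin> \<Union> (H ` X)" by (simp_all only: mem_ball_0 not_False_eq_True)
  have "nonresonant (\<lambda>I i. z * of_real (d I i v) + of_real (d I i c)) v'"
    unfolding nonresonant_def
  proof (intro ballI impI notI, elim exE conjE)
    fix I g1 g2 i j s
    assume I: "I \<in> T" "g1 \<in> Q I" "g2 \<in> Q I" "i \<in> I" "j \<in> I" "i \<noteq> j"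
    define l1 l2 where "l1 = farg I i (z * of_real (d I i v) + of_real (d I i c) + s * of_real (d I i v')) (rep g1) (rep g2)"
      and "l2 = farg I j (z * of_real (d I j v) + of_real (d I j c) + s * of_real (d I j v')) (rep g1) (rep g2)"
    assume "farg I i (z * of_real (d I i v) + of_real (d I i c) + s * of_real (d I i v')) (rep g1) (rep g2) \<in> period_lattice \<tau>"
      "farg I j (z * of_real (d I j v) + of_real (d I j c) + s * of_real (d I j v')) (rep g1) (rep g2) \<in> period_lattice \<tau>"
    then have X: "(I, i, j, g1, g2, l1, l2) \<in> X" using I by (auto simp: X_def l1_def l2_def)
    have ks: "\<kappa> I i g1 g2 l1 = - (of_real (d I i c) + s * of_real (d I i v'))"
      "\<kappa> I j g1 g2 l2 = - (of_real (d I j c) + s * of_real (d I j v'))"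
      by (simp_all add: \<kappa>_def l1_def l2_def farg_def)
    have "of_real (d I i v') * \<kappa> I j g1 g2 l2 - of_real (d I j v') * \<kappa> I i g1 g2 l1
        = of_real (d I j v' * d I i c - d I i v' * d I j c)"
      unfolding ks by (simp add: algebra_simps)
    then have "c \<in> H (I, i, j, g1, g2, l1, l2)"
      unfolding H_def prod.case mem_Collect_eq by (simp only: Re_complex_of_real)
    then show False using c(2) X by blast
  qed
  then show ?thesis using c(1) by blast
qed

text \<open>A nonzero value would persist, together with regularity, under all small real
  translations \<open>c\<close>, and some of these are nonresonant.\<close>

lemma fsum_eq_0:
  assumes reg: "regular (\<lambda>I i. z * of_real (d I i v))"
  shows "fsum (\<lambda>I i. z * of_real (d I i v)) = 0"
proof (rule ccontr)
  assume nz: "fsum (\<lambda>I i. z * of_real (d I i v)) \<noteq> 0"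
  obtain v' where v': "v' \<in> L" "generic \<Delta> v'" "ex (of_real (u v') * \<sigma>) \<noteq> 1"
    using direction_exists by blast
  let ?\<xi> = "\<lambda>c I i. z * of_real (d I i v) + of_real (d I i c) :: complex"
  have d0: "d I i 0 = 0" if "I \<in> T" "i \<in> I" for I i using linear_0[OF linear_d[OF that]] .
  have dlim: "(d I i \<longlongrightarrow> 0) (at 0)" if "I \<in> T" "i \<in> I" for I i
    using linear_continuous_at[of "d I i" 0] linear_d[OF that] d0[OF that]
    by (simp add: isCont_def linear_conv_bounded_linear)
  have alim: "((\<lambda>c. farg I i (?\<xi> c I i) h1 h2) \<longlongrightarrow> farg I i (z * of_real (d I i v)) h1 h2) (at 0)"
    if "I \<in> T" "i \<in> I" for I i h1 h2
  proof -
    have "((\<lambda>c. farg I i (?\<xi> c I i) h1 h2) \<longlongrightarrow> farg I i (z * of_real (d I i v) + of_real 0) h1 h2) (at 0)"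
      unfolding farg_def by (intro tendsto_intros dlim that)
    then show ?thesis by simp
  qed
  have "((\<lambda>c. fsum (?\<xi> c)) \<longlongrightarrow> fsum (\<lambda>I i. z * of_real (d I i v))) (at 0)"
    unfolding fsum_def ffactor_farg
    using reg
    by (intro tendsto_sum tendsto_mult_left tendsto_prod isCont_tendsto_compose[OF P_isCont alim])
      (auto simp: regular_def)
  then have ev1: "eventually (\<lambda>c. fsum (?\<xi> c) \<noteq> 0) (at 0)"
    using nz by (rule tendsto_imp_eventually_ne)
  have ev2: "eventually (\<lambda>c. regular (?\<xi> c)) (at 0)"
    unfolding regular_def
  proof (intro eventually_ball_finite finite_T finite_Q ballI)
    fix I g1 g2 i assume I: "I \<in> T" "g1 \<in> Q I" "g2 \<in> Q I" "i \<in> I"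
    have "farg I i (z * of_real (d I i v)) (rep g1) (rep g2) \<in> - period_lattice \<tau>"
      using reg I by (auto simp: regular_def)
    from topological_tendstoD[OF alim[OF I(1,4)] open_not_period[OF tau] this]
    show "eventually (\<lambda>c. farg I i (?\<xi> c I i) (rep g1) (rep g2) \<notin> period_lattice \<tau>) (at 0)" by simp
  qed (use top(4) in auto)
  obtain e where e: "e > 0" "\<And>c. c \<noteq> 0 \<Longrightarrow> norm c < e \<Longrightarrow> fsum (?\<xi> c) \<noteq> 0 \<and> regular (?\<xi> c)"
    using eventually_conj[OF ev1 ev2] unfolding eventually_at by (auto simp: dist_norm)
  obtain c where c: "norm c < e" "nonresonant (?\<xi> c) v'"
    using nonresonant_dense[OF generic_d_nonzero[OF v'(2)] e(1)] by blast
  \<comment> \<open>Limits at 0 say nothing about \<open>c = 0\<close> itself; in that case the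
    unshifted line is already nonresonant.\<close>
  show False
  proof (cases "c = 0")
    case True
    have "fsum (?\<xi> 0) = fsum (\<lambda>I i. z * of_real (d I i v))" "regular (?\<xi> 0)"
      using reg by (simp_all add: fsum_def regular_def d0 cong: sum.cong prod.cong)
    then show False using fsum_line_eq_0[OF v', of z v c] c(2) nz True by simp
  next
    case False
    then show False using fsum_line_eq_0[OF v' c(2)] e(2)[OF False c(1)] by blast
  qed
qed

lemma genus_along_eq_0:
  assumes reg: "genus_regular L \<Delta> V v z \<tau>"
  shows "genus_along L \<Delta> V v z \<tau> \<sigma> = 0"
proof -
  have arg: "genus_arg V v z \<tau> I g1 g2 i = farg I i (z * of_real (d I i v)) (rep g1) (rep g2)" for I g1 g2 i
    by (simp add: genus_arg_def farg_def)
  have np: "genus_arg V v z \<tau> I g1 g2 i \<notin> period_lattice \<tau>"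
    if "I \<in> T" "g1 \<in> Q I" "g2 \<in> Q I" "i \<in> I" for I g1 g2 i
    using reg that by (auto simp: genus_regular_def period_lattice_def)
  have "genus_along L \<Delta> V v z \<tau> \<sigma> = fsum (\<lambda>I i. z * of_real (d I i v))"
    unfolding genus_along_def fsum_def sum.cartesian_product
    by (intro sum.cong prod.cong refl arg_cong2[where f = "(*)"])
      (auto simp: ffactor_farg arg[symmetric] phi_eq_phi_theta[OF tau np] intro!: prod.cong)
  moreover have "regular (\<lambda>I i. z * of_real (d I i v))"
    using np by (auto simp: regular_def arg)
  ultimately show ?thesis using fsum_eq_0 by simp
qed

end

section \<open>Uniqueness of the genus\<close>

text \<open>\<open>q = ex \<tau>\<close> is never 0, so nothing is known at the origin.
  Multiplication by \<open>q\<close> shifts the coefficients to \<open>b\<close> with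
  \<open>b 0 = 0\<close>: the series then has the right value at 0, and the nonzero coefficient has
  positive index, as isolation of zeros requires.\<close>

lemma powser_coeff_eq_0:
  fixes a :: "nat \<Rightarrow> complex"
  assumes r: "r > 0" and s: "\<And>q. q \<noteq> 0 \<Longrightarrow> norm q < r \<Longrightarrow> (\<lambda>m. a m * q ^ m) sums 0"
  shows "a m = 0"
proof (rule ccontr)
  assume am: "a m \<noteq> 0"
  define b where "b = (\<lambda>m. case m of 0 \<Rightarrow> 0 | Suc m \<Rightarrow> a m)"
  have "(\<lambda>m. b m * (q - 0) ^ m) sums 0" if q: "norm (q - 0) < r" for q
  proof (cases "q = 0")
    case True
    have "(\<lambda>m. b m * (q - 0) ^ m) = (\<lambda>_. 0)"
      by (rule ext) (auto simp: b_def True split: nat.splits)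
    then show ?thesis by simp
  next
    case False
    then have "(\<lambda>m. q * (a m * q ^ m)) sums (q * 0)" using q by (intro sums_mult s) auto
    then have "(\<lambda>m. b (Suc m) * (q - 0) ^ Suc m) sums 0" by (simp add: b_def mult_ac)
    then show ?thesis by (subst (asm) sums_Suc_iff) (simp add: b_def)
  qed
  note bs = this
  have bm: "b (Suc m) \<noteq> 0" using am by (simp add: b_def)
  show False
  proof (rule powser_0_nonzero[OF r, of 0 b "\<lambda>_. 0" "Suc m"])
    fix t :: real
    assume t: "0 < t" "\<And>z :: complex. z \<in> cball 0 t - {0} \<Longrightarrow> (0 :: complex) \<noteq> 0"
    have "complex_of_real t \<in> cball 0 t - {0}" using t(1) by simp
    from t(2)[OF this] show False by simp
  qed (use bs bm in simp_all)
qed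

text \<open>Along \<open>z = - \<i> * y\<close> with \<open>y\<close> tending to infinity, the
  character with the largest exponent \<open>a0 v\<close> dominates; divided by it, the sum tends to
  its coefficient. Injectivity makes the maximum unique.\<close>

lemma characters_independent:
  fixes c :: "('a::euclidean_space \<Rightarrow> real) \<Rightarrow>\<^sub>0 complex"
  assumes inj: "inj_on (\<lambda>a. a v) (Poly_Mapping.keys c)"
    and 0: "\<And>z. Im z \<noteq> 0 \<Longrightarrow> pullback_char v c z = 0"
  shows "c = 0"
proof (rule ccontr)
  assume "c \<noteq> 0"
  let ?K = "Poly_Mapping.keys c"
  have fin: "finite ((\<lambda>a. a v) ` ?K)" and ne: "(\<lambda>a. a v) ` ?K \<noteq> {}" using \<open>c \<noteq> 0\<close> by auto
  obtain a0 where a0: "a0 \<in> ?K" "a0 v = Max ((\<lambda>a. a v) ` ?K)" using Max_in[OF fin ne] by auto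
  have less: "a v - a0 v < 0" if "a \<in> ?K" "a \<noteq> a0" for a
  proof -
    have "a v \<le> a0 v" using that(1) fin a0(2) by simp
    moreover have "a v \<noteq> a0 v" using inj that a0(1) by (auto dest: inj_onD)
    ultimately show ?thesis by simp
  qed
  let ?t = "\<lambda>a y. Poly_Mapping.lookup c a * ex (of_real (a v - a0 v) * (- \<i> * of_real y))"
  have lim: "((?t a) \<longlongrightarrow> (if a = a0 then Poly_Mapping.lookup c a0 else 0)) at_top" if a: "a \<in> ?K" for a
  proof (cases "a = a0")
    case False
    have "filterlim (\<lambda>y. (2 * pi * (a v - a0 v)) * y) at_bot at_top"
      using less[OF a False] by (intro filterlim_tendsto_neg_mult_at_bot[OF tendsto_const _ filterlim_ident]) (simp add: mult_pos_neg)
    then have "((\<lambda>y. exp ((2 * pi * (a v - a0 v)) * y)) \<longlongrightarrow> 0) at_top"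
      by (rule filterlim_compose[OF exp_at_bot])
    then have "((\<lambda>y. norm (ex (of_real (a v - a0 v) * (- \<i> * of_real y)))) \<longlongrightarrow> 0) at_top"
      by (simp add: norm_ex mult_ac)
    then have "((\<lambda>y. ex (of_real (a v - a0 v) * (- \<i> * of_real y))) \<longlongrightarrow> 0) at_top"
      by (rule tendsto_norm_zero_cancel)
    from tendsto_mult_left[OF this, of "Poly_Mapping.lookup c a"] show ?thesis using False by simp
  qed simp
  have "((\<lambda>y. \<Sum>a\<in>?K. ?t a y) \<longlongrightarrow> (\<Sum>a\<in>?K. if a = a0 then Poly_Mapping.lookup c a0 else 0)) at_top"
    by (intro tendsto_sum lim)
  then have "((\<lambda>y. \<Sum>a\<in>?K. ?t a y) \<longlongrightarrow> Poly_Mapping.lookup c a0) at_top"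
    using a0(1) by simp
  moreover have "eventually (\<lambda>y. (\<Sum>a\<in>?K. ?t a y) = 0) at_top"
    using eventually_gt_at_top[of "0 :: real"]
  proof eventually_elim
    case (elim y)
    define z where "z = - \<i> * of_real y"
    have "ex (of_real (a v - a0 v) * z) = ex (of_real (- a0 v) * z) * ex (of_real (a v) * z)" for a
      by (simp add: ex_add[symmetric] algebra_simps)
    then have "(\<Sum>a\<in>?K. ?t a y) = ex (of_real (- a0 v) * z) * pullback_char v c z"
      unfolding z_def[symmetric] by (simp add: pullback_char_def sum_distrib_left mult_ac)
    moreover have "pullback_char v c z = 0" using elim by (intro 0) (simp add: z_def)
    ultimately show ?case by simp
  qed
  ultimately have "((\<lambda>y :: real. 0 :: complex) \<longlongrightarrow> Poly_Mapping.lookup c a0) at_top"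
    using tendsto_cong by fast
  then have "Poly_Mapping.lookup c a0 = 0"
    by (simp add: tendsto_const_iff)
  then show False using a0(1) by (simp add: in_keys_iff)
qed

text \<open>
  A zero of a denominator forces \<open>Im \<tau> = (Im z) (u v) / s\<close> with \<open>s\<close> in \<open>(1/M) \<int>\<close>, and \<open>s \<noteq> 0\<close> off the
  real axis, so that \<open>Im \<tau>\<close> is bounded.
\<close>

lemma genus_regular_large_Im:
  fixes \<Delta> :: "('i, 'a::euclidean_space) multi_fan"
  assumes L: "full_lattice L" and fan: "simplicial_multi_fan L \<Delta>" and edges: "edge_vectors L \<Delta> V"
    and v: "generic \<Delta> v" and z: "Im z \<noteq> 0"
  shows "\<exists>R. \<forall>\<tau>. Im \<tau> > R \<longrightarrow> genus_regular L \<Delta> V v z \<tau>"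
proof -
  note top = simplicial_top[OF fan edges]
  let ?d = "dual_basis V"
  obtain M :: nat where M: "M > 0" "\<forall>x\<in>L. \<forall>I\<in>top_simps \<Delta>. of_nat M *\<^sub>R x \<in> edge_lattice V I"
    using lattice_multiple_in_edge_lattice[OF L finite_top_simps[OF fan]] top(1,2) by metis
  define S where "S = (\<Sum>I\<in>top_simps \<Delta>. \<Sum>i\<in>I. \<bar>?d I i v\<bar>)"
  define R where "R = real M * \<bar>Im z\<bar> * S"
  have S: "\<bar>?d I i v\<bar> \<le> S" if "I \<in> top_simps \<Delta>" "i \<in> I" for I i
  proof -
    have "\<bar>?d I i v\<bar> \<le> (\<Sum>i\<in>I. \<bar>?d I i v\<bar>)"
      using that top(4) by (intro member_le_sum) auto
    also have "\<dots> \<le> S" unfolding S_def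
      using that finite_top_simps[OF fan] by (intro member_le_sum[of _ _ "\<lambda>I. \<Sum>i\<in>I. \<bar>?d I i v\<bar>"]) (auto intro: sum_nonneg)
    finally show ?thesis .
  qed
  have "genus_regular L \<Delta> V v z \<tau>" if \<tau>: "Im \<tau> > R" for \<tau>
    unfolding genus_regular_def
  proof (intro ballI allI notI)
    fix I h1 h2 i and a b :: int
    assume I: "I \<in> top_simps \<Delta>" and h: "h1 \<in> quot_group L V I" "h2 \<in> quot_group L V I" and i: "i \<in> I"
      and eq: "genus_arg V v z \<tau> I h1 h2 i = of_int a + of_int b * \<tau>"
    have lin: "linear (?d I i)" by (rule linear_dual_basis[OF top(1)[OF I] i])
    define s where "s = ?d I i (rep h1) - of_int b"
    have "Im (genus_arg V v z \<tau> I h1 h2 i) = of_int b * Im \<tau>" using arg_cong[OF eq, of Im] by simp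
    then have s: "Im \<tau> * s = Im z * ?d I i v" by (simp add: genus_arg_def s_def algebra_simps)
    have nz: "?d I i v \<noteq> 0" by (rule generic_dual_basis_nonzero[OF fan edges v I i])
    have "rep h1 \<in> L"
    proof -
      obtain y where y: "y \<in> L" "h1 = coset (edge_lattice V I) y" using h(1) by (auto simp: quot_group_def)
      have "rep h1 - y \<in> L"
        using rep_coset[OF subgrp_edge_lattice, of V I y] edge_lattice_subset[OF L top(2)[OF I]] y(2) by blast
      then show ?thesis using subgrp_add[OF subgrp_full_lattice[OF L] _ y(1), of "rep h1 - y"] by simp
    qed
    then have "?d I i (of_nat M *\<^sub>R rep h1) \<in> \<int>"
      using M(2) I i edge_lattice_iff[OF top(1)[OF I]] by blast
    then have "real M * s \<in> \<int>" by (simp add: linear_cmul[OF lin] s_def right_diff_distrib)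
    moreover have "s \<noteq> 0" using s z nz by auto
    ultimately have "1 \<le> \<bar>real M * s\<bar>" using M(1) Ints_nonzero_abs_ge1[of "real M * s"] by simp
    moreover have "0 \<le> R" using S[OF I i] by (simp add: R_def)
    ultimately have "Im \<tau> \<le> Im \<tau> * \<bar>real M * s\<bar>" using \<tau> mult_left_mono[of 1 "\<bar>real M * s\<bar>" "Im \<tau>"] by simp
    also have "\<dots> = real M * \<bar>Im \<tau> * s\<bar>" using \<tau> \<open>0 \<le> R\<close> by (simp add: abs_mult)
    also have "\<dots> = real M * \<bar>Im z\<bar> * \<bar>?d I i v\<bar>" unfolding s by (simp add: abs_mult)
    also have "\<dots> \<le> R" unfolding R_def using S[OF I i] by (intro mult_left_mono) auto
    finally show False using \<tau> by simp
  qed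
  then show ?thesis by blast
qed

text \<open>For \<open>z\<close> off the real axis all \<tau> with large imaginary part are regular,
  so the \<open>q\<close>-series vanishes on a whole punctured disc and every coefficient pulls back
  to 0. One \<open>v\<close> that separates the finitely many characters of a coefficient then shows
  that it is 0.\<close>

lemma orbifold_genus_unique_0:
  fixes \<Delta> :: "('i, 'a::euclidean_space) multi_fan"
  assumes L: "full_lattice L" and fan: "simplicial_multi_fan L \<Delta>" and edges: "edge_vectors L \<Delta> V"
    and vanish: "\<And>v z \<tau>. Im \<tau> > 0 \<Longrightarrow> genus_regular L \<Delta> V v z \<tau> \<Longrightarrow> genus_along L \<Delta> V v z \<tau> \<sigma> = 0"
  shows "orbifold_genus L \<Delta> V \<sigma> = 0"
  unfolding orbifold_genus_def
proof (rule the_equality)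
  show "is_orbifold_genus L \<Delta> V \<sigma> 0"
    unfolding is_orbifold_genus_def
  proof (intro conjI allI ballI impI)
    fix v z
    show "\<exists>R>0. \<forall>\<tau>. Im \<tau> > R \<and> genus_regular L \<Delta> V v z \<tau> \<longrightarrow>
        (\<lambda>m. pullback_char v (fps_nth 0 m) z * ex \<tau> ^ m) sums genus_along L \<Delta> V v z \<tau> \<sigma>"
      by (rule exI[of _ 1]) (auto simp: vanish pullback_char_def)
  qed auto
next
  fix G assume G: "is_orbifold_genus L \<Delta> V \<sigma> G"
  note top = simplicial_top[OF fan edges]
  obtain M :: nat where M: "M > 0" "\<forall>x\<in>L. \<forall>I\<in>top_simps \<Delta>. of_nat M *\<^sub>R x \<in> edge_lattice V I"
    using lattice_multiple_in_edge_lattice[OF L finite_top_simps[OF fan]] top(1,2) by metis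
  have pb: "pullback_char v (fps_nth G m) z = 0"
    if v: "v \<in> common_lattice \<Delta> V" "generic \<Delta> v" and z: "Im z \<noteq> 0" for v z m
  proof -
    obtain R1 where R1: "\<And>\<tau>. Im \<tau> > R1 \<Longrightarrow> genus_regular L \<Delta> V v z \<tau>"
      using genus_regular_large_Im[OF L fan edges v(2) z] by blast
    obtain R2 where R2: "R2 > 0" "\<And>\<tau>. Im \<tau> > R2 \<Longrightarrow> genus_regular L \<Delta> V v z \<tau> \<Longrightarrow>
        (\<lambda>m. pullback_char v (fps_nth G m) z * ex \<tau> ^ m) sums genus_along L \<Delta> V v z \<tau> \<sigma>"
      using G v unfolding is_orbifold_genus_def by blast
    define R where "R = max R1 R2"
    show ?thesis
    proof (rule powser_coeff_eq_0)
      show "exp (- 2 * pi * R) > 0" by simp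
      fix q :: complex assume q: "q \<noteq> 0" "norm q < exp (- 2 * pi * R)"
      \<comment> \<open>A preimage of \<open>q\<close> under \<open>ex\<close>; the bound on
        \<open>norm q\<close> becomes \<open>Im \<tau> > R\<close>.\<close>
      define \<tau> where "\<tau> = Ln q / (2 * of_real pi * \<i>)"
      have ex: "ex \<tau> = q" using q(1) by (simp add: ex_def \<tau>_def)
      have "exp (- 2 * pi * Im \<tau>) < exp (- 2 * pi * R)" using q(2) norm_ex[of \<tau>] ex by simp
      then have "Im \<tau> > R" by simp
      then have "Im \<tau> > R1" "Im \<tau> > R2" "Im \<tau> > 0" using R2(1) by (auto simp: R_def)
      then show "(\<lambda>m. pullback_char v (fps_nth G m) z * q ^ m) sums 0"
        using R2(2)[of \<tau>] R1[of \<tau>] vanish[of \<tau> v z] ex by simp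
    qed
  qed
  show "G = 0"
  proof (rule fps_ext)
    fix m
    let ?K = "Poly_Mapping.keys (fps_nth G m)"
    have K: "linear a" if "a \<in> ?K" for a
      using G that by (auto simp: is_orbifold_genus_def dual_lattice_def)
    \<comment> \<open>A vector on which no difference of distinct characters vanishes separates
      them; the factor \<open>M\<close> below puts it into the common lattice.\<close>
    define A where "A = (\<lambda>(a, b) y. a y - b y) ` {(a, b) \<in> ?K \<times> ?K. a \<noteq> b}"
    have "finite {(a, b) \<in> ?K \<times> ?K. a \<noteq> b}"
      by (rule finite_subset[of _ "?K \<times> ?K"]) auto
    then have "finite A" unfolding A_def by (rule finite_imageI)
    moreover have "linear f \<and> f \<noteq> (\<lambda>_. 0)" if f: "f \<in> A" for f
    proof -
      obtain a b where ab: "a \<in> ?K" "b \<in> ?K" "a \<noteq> b" "f = (\<lambda>y. a y - b y)" using f by (auto simp: A_def)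
      have "linear f" unfolding ab(4) using K ab by (intro linear_compose_sub) auto
      moreover have "f \<noteq> (\<lambda>_. 0)" using ab(3) unfolding ab(4) fun_eq_iff by auto
      ultimately show ?thesis ..
    qed
    ultimately obtain g where g: "g \<in> L" "generic \<Delta> (0 + real M *\<^sub>R g)" "\<forall>f\<in>A. f (0 + real M *\<^sub>R g) \<noteq> 0"
      using generic_lattice_point[OF L fan, of A "real M" 0] M(1) by auto
    define v where "v = real M *\<^sub>R g"
    have "v \<in> common_lattice \<Delta> V" using M(2) g(1) by (auto simp: common_lattice_def v_def)
    moreover have "generic \<Delta> v" using g(2) by (simp add: v_def)
    moreover have "inj_on (\<lambda>a. a v) ?K"
    proof (rule inj_onI, rule ccontr)
      fix a b assume ab: "a \<in> ?K" "b \<in> ?K" "a v = b v" "a \<noteq> b"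
      then have "(\<lambda>y. a y - b y) \<in> A" unfolding A_def by (intro image_eqI[of _ _ "(a, b)"]) auto
      then show False using g(3) ab(3) by (auto simp: v_def)
    qed
    ultimately show "fps_nth G m = fps_nth 0 m"
      using characters_independent[of v "fps_nth G m"] pb by simp
  qed
qed

theorem theorem3p3:
  fixes L :: "'a::euclidean_space set"
    and \<Delta> :: "('i, 'a) multi_fan"
    and V :: "'i \<Rightarrow> 'a"
    and N k :: nat
  assumes "full_lattice L"
    and "simplicial_multi_fan L \<Delta>"
    and "complete_multi_fan \<Delta>"
    and "edge_vectors L \<Delta> V"
    and "N > 1"
    and "c1_T_Cartier_divisible L \<Delta> V N"
    and "0 < k" and "k < N"
  shows "orbifold_genus L \<Delta> V (of_nat k / of_nat N) = 0"
proof -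
  obtain x u where xu: "T_Cartier L \<Delta> V x" "u \<in> dual_lattice L"
      "c1T \<Delta> = frag_cmul (int N) x + embed_dual \<Delta> V u"
    using assms(6) by (auto simp: c1_T_Cartier_divisible_def)
  have "divisible_fan L \<Delta> V N k \<tau> x u" if "Im \<tau> > 0" for \<tau>
    using assms xu that by unfold_locales
  then show ?thesis
    using divisible_fan.genus_along_eq_0 by (intro orbifold_genus_unique_0[OF assms(1,2,4)]) blast
qed

end
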